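(* The opposite category of a pretopos with finite colimits is arithmetical and ideally exact.
   Context: A category is regular if it is finitely complete, admits coequalizers of kernel pairs, and its regular epimorphisms are pullback stable. A regular category is exact (in the sense of Barr) if every internal equivalence relation in it is effective, i.e. is the kernel pair of some morphism. A category $\mathbb{C}$ is extensive if it admits finite coproducts and for each pair of objects $A$, $B$ the coproduct functor $(\mathbb{C}\downarrow A)\times(\mathbb{C}\downarrow B)\to(\mathbb{C}\downarrow A+B)$, sending $((X,f),(Y,g))$ to $(X+Y,f+g)$ and $(u,v)$ to $u+v$, is an equivalence of categories. A pretopos is a category that is exact and extensive. For an object $B$ of a category $\mathbb{D}$, the category $\mathbf{Pt}_{\mathbb{D}}(B)$ has as objects triples $(A,\alpha,\beta)$ with $\alpha:A\to B$, $\beta:B\to A$ and $\alpha\beta=1_B$; a morphism $(A,\alpha,\beta)\to(A',\alpha',\beta')$ is a morphism $f:A\to A'$ with $\alpha' f=\alpha$ and $f\beta=\beta'$. If pullbacks of split epimorphisms along arbitrary morphisms exist in $\mathbb{D}$, each $p:E\to B$ determines a pullback functor $p^*:\mathbf{Pt}_{\mathbb{D}}(B)\to\mathbf{Pt}_{\mathbb{D}}(E)$ sending $(A,\alpha,\beta)$ to $(E\times_B A,\pi_1,\langle 1_E,\beta p\rangle)$, where $(E\times_B A,\pi_1,\pi_2)$ is the pullback of $p$ and $\alpha$. The category $\mathbb{D}$ is protomodular if pullbacks of split epimorphisms along arbitrary morphisms exist in $\mathbb{D}$ and each functor $p^*$ reflects isomorphisms. A category is ideally exact if it is exact, protomodular,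 finitely cocomplete, and the unique morphism $0\to 1$ from the initial to the terminal object is a regular epimorphism. A Mal'tsev category is a finitely complete category in which every internal reflexive relation is an equivalence relation. A Mal'tsev category is arithmetical if, for each object in it, the equivalence relations on that object form a distributive lattice. *)

theory Defs
  imports "HOL-Algebra.Lattice"
begin

section \<open>Categories and functors\<close>

record ('o, 'm) cat =
  Ob :: "'o set"
  Ar :: "'m set"
  Dom :: "'m \<Rightarrow> 'o"
  Cod :: "'m \<Rightarrow> 'o"
  Ide :: "'o \<Rightarrow> 'm"
  Comp :: "'m \<Rightarrow> 'm \<Rightarrow> 'm" (infixl "\<cdot>\<index>" 70)

definition Hom :: "('o, 'm) cat \<Rightarrow> 'o \<Rightarrow> 'o \<Rightarrow> 'm set" where
  "Hom C A B = {f \<in> Ar C. Dom C f = A \<and> Cod C f = B}"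

locale category =
  fixes C :: "('o, 'm) cat" (structure)
  assumes Dom_in_Ob: "f \<in> Ar C \<Longrightarrow> Dom C f \<in> Ob C"
    and Cod_in_Ob: "f \<in> Ar C \<Longrightarrow> Cod C f \<in> Ob C"
    and Id_in_Hom: "A \<in> Ob C \<Longrightarrow> Ide C A \<in> Hom C A A"
    and Comp_in_Hom: "f \<in> Hom C A B \<Longrightarrow> g \<in> Hom C B D \<Longrightarrow> g \<cdot> f \<in> Hom C A D"
    and Id_left: "f \<in> Hom C A B \<Longrightarrow> Ide C B \<cdot> f = f"
    and Id_right: "f \<in> Hom C A B \<Longrightarrow> f \<cdot> Ide C A = f"
    and Comp_assoc: "f \<in> Hom C A B \<Longrightarrow> g \<in> Hom C B D \<Longrightarrow> h \<in> Hom C D E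
      \<Longrightarrow> h \<cdot> (g \<cdot> f) = (h \<cdot> g) \<cdot> f"

definition op_cat :: "('o, 'm) cat \<Rightarrow> ('o, 'm) cat" where
  "op_cat C = \<lparr>Ob = Ob C, Ar = Ar C, Dom = Cod C, Cod = Dom C, Ide = Ide C,
     Comp = (\<lambda>g f. f \<cdot>\<^bsub>C\<^esub> g)\<rparr>"

definition prod_cat :: "('o, 'm) cat \<Rightarrow> ('p, 'n) cat \<Rightarrow> ('o \<times> 'p, 'm \<times> 'n) cat" where
  "prod_cat C D = \<lparr>Ob = Ob C \<times> Ob D, Ar = Ar C \<times> Ar D,
     Dom = map_prod (Dom C) (Dom D), Cod = map_prod (Cod C) (Cod D),
     Ide = map_prod (Ide C) (Ide D),
     Comp = (\<lambda>(g, k) (f, h). (g \<cdot>\<^bsub>C\<^esub> f, k \<cdot>\<^bsub>D\<^esub> h))\<rparr>"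

text \<open>Objects of \<open>C\<close> with extra structure: \<open>K\<close> is the set of structured objects, \<open>U\<close> gives the
  underlying object, and \<open>H x u y\<close> says that \<open>u\<close> is compatible with the structures \<open>x\<close> and \<open>y\<close>.
  Arrows carry their structured domain and codomain.\<close>

definition structured_cat ::
  "('o, 'm) cat \<Rightarrow> 'k set \<Rightarrow> ('k \<Rightarrow> 'o) \<Rightarrow> ('k \<Rightarrow> 'm \<Rightarrow> 'k \<Rightarrow> bool) \<Rightarrow> ('k, 'k \<times> 'm \<times> 'k) cat" where
  "structured_cat C K U H = \<lparr>Ob = K,
     Ar = {(x, u, y). x \<in> K \<and> y \<in> K \<and> u \<in> Hom C (U x) (U y) \<and> H x u y},
     Dom = (\<lambda>(x, u, y). x), Cod = (\<lambda>(x, u, y). y),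
     Ide = (\<lambda>x. (x, Ide C (U x), x)),
     Comp = (\<lambda>(y', v, z) (x, u, y). (x, v \<cdot>\<^bsub>C\<^esub> u, z))\<rparr>"

record ('o, 'm, 'p, 'n) cfunctor =
  FOb :: "'o \<Rightarrow> 'p"
  FAr :: "'m \<Rightarrow> 'n"

definition is_functor :: "('o, 'm) cat \<Rightarrow> ('p, 'n) cat \<Rightarrow> ('o, 'm, 'p, 'n) cfunctor \<Rightarrow> bool" where
  "is_functor C D F \<longleftrightarrow>
     (\<forall>A\<in>Ob C. FOb F A \<in> Ob D) \<and>
     (\<forall>f\<in>Ar C. FAr F f \<in> Hom D (FOb F (Dom C f)) (FOb F (Cod C f))) \<and>
     (\<forall>A\<in>Ob C. FAr F (Ide C A) = Ide D (FOb F A)) \<and>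
     (\<forall>f\<in>Ar C. \<forall>g\<in>Ar C. Cod C f = Dom C g \<longrightarrow> FAr F (g \<cdot>\<^bsub>C\<^esub> f) = FAr F g \<cdot>\<^bsub>D\<^esub> FAr F f)"

definition id_functor :: "('o, 'm, 'o, 'm) cfunctor" where
  "id_functor = \<lparr>FOb = id, FAr = id\<rparr>"

definition comp_functor ::
  "('p, 'n, 'q, 'r) cfunctor \<Rightarrow> ('o, 'm, 'p, 'n) cfunctor \<Rightarrow> ('o, 'm, 'q, 'r) cfunctor" where
  "comp_functor G F = \<lparr>FOb = FOb G \<circ> FOb F, FAr = FAr G \<circ> FAr F\<rparr>"

definition is_iso :: "('o, 'm) cat \<Rightarrow> 'm \<Rightarrow> bool" where
  "is_iso C f \<longleftrightarrow> f \<in> Ar C \<and>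
     (\<exists>g \<in> Hom C (Cod C f) (Dom C f). g \<cdot>\<^bsub>C\<^esub> f = Ide C (Dom C f) \<and> f \<cdot>\<^bsub>C\<^esub> g = Ide C (Cod C f))"

definition is_nat_iso :: "('o, 'm) cat \<Rightarrow> ('p, 'n) cat \<Rightarrow> ('o, 'm, 'p, 'n) cfunctor \<Rightarrow>
    ('o, 'm, 'p, 'n) cfunctor \<Rightarrow> ('o \<Rightarrow> 'n) \<Rightarrow> bool" where
  "is_nat_iso C D F G \<eta> \<longleftrightarrow>
     (\<forall>A\<in>Ob C. \<eta> A \<in> Hom D (FOb F A) (FOb G A) \<and> is_iso D (\<eta> A)) \<and>
     (\<forall>f\<in>Ar C. \<eta> (Cod C f) \<cdot>\<^bsub>D\<^esub> FAr F f = FAr G f \<cdot>\<^bsub>D\<^esub> \<eta> (Dom C f))"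

definition is_equivalence :: "('o, 'm) cat \<Rightarrow> ('p, 'n) cat \<Rightarrow> ('o, 'm, 'p, 'n) cfunctor \<Rightarrow> bool" where
  "is_equivalence C D F \<longleftrightarrow> is_functor C D F \<and>
     (\<exists>G. is_functor D C G \<and>
        (\<exists>\<eta>. is_nat_iso C C id_functor (comp_functor G F) \<eta>) \<and>
        (\<exists>\<epsilon>. is_nat_iso D D (comp_functor F G) id_functor \<epsilon>))"

definition reflects_isos :: "('o, 'm) cat \<Rightarrow> ('p, 'n) cat \<Rightarrow> ('o, 'm, 'p, 'n) cfunctor \<Rightarrow> bool" where
  "reflects_isos C D F \<longleftrightarrow> (\<forall>f\<in>Ar C. is_iso D (FAr F f) \<longrightarrow> is_iso C f)"


section \<open>Limits and colimits\<close>

definition is_cone ::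
  "('o, 'm) cat \<Rightarrow> ('i, 'j) cat \<Rightarrow> ('i, 'j, 'o, 'm) cfunctor \<Rightarrow> 'o \<Rightarrow> ('i \<Rightarrow> 'm) \<Rightarrow> bool" where
  "is_cone C J D L p \<longleftrightarrow> L \<in> Ob C \<and> (\<forall>j\<in>Ob J. p j \<in> Hom C L (FOb D j)) \<and>
     (\<forall>u\<in>Ar J. FAr D u \<cdot>\<^bsub>C\<^esub> p (Dom J u) = p (Cod J u))"

definition is_limit ::
  "('o, 'm) cat \<Rightarrow> ('i, 'j) cat \<Rightarrow> ('i, 'j, 'o, 'm) cfunctor \<Rightarrow> 'o \<Rightarrow> ('i \<Rightarrow> 'm) \<Rightarrow> bool" where
  "is_limit C J D L p \<longleftrightarrow> is_cone C J D L p \<and>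
     (\<forall>M q. is_cone C J D M q \<longrightarrow> (\<exists>!h. h \<in> Hom C M L \<and> (\<forall>j\<in>Ob J. p j \<cdot>\<^bsub>C\<^esub> h = q j)))"

definition is_cocone ::
  "('o, 'm) cat \<Rightarrow> ('i, 'j) cat \<Rightarrow> ('i, 'j, 'o, 'm) cfunctor \<Rightarrow> 'o \<Rightarrow> ('i \<Rightarrow> 'm) \<Rightarrow> bool" where
  "is_cocone C J D L p \<longleftrightarrow> L \<in> Ob C \<and> (\<forall>j\<in>Ob J. p j \<in> Hom C (FOb D j) L) \<and>
     (\<forall>u\<in>Ar J. p (Cod J u) \<cdot>\<^bsub>C\<^esub> FAr D u = p (Dom J u))"

definition is_colimit ::
  "('o, 'm) cat \<Rightarrow> ('i, 'j) cat \<Rightarrow> ('i, 'j, 'o, 'm) cfunctor \<Rightarrow> 'o \<Rightarrow> ('i \<Rightarrow> 'm) \<Rightarrow> bool" where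
  "is_colimit C J D L p \<longleftrightarrow> is_cocone C J D L p \<and>
     (\<forall>M q. is_cocone C J D M q \<longrightarrow> (\<exists>!h. h \<in> Hom C L M \<and> (\<forall>j\<in>Ob J. h \<cdot>\<^bsub>C\<^esub> p j = q j)))"

text \<open>Every finite category is isomorphic to one whose objects and arrows are natural numbers,
  so these serve as the shapes of finite diagrams.\<close>

definition finite_shape :: "(nat, nat) cat \<Rightarrow> bool" where
  "finite_shape J \<longleftrightarrow> category J \<and> finite (Ob J) \<and> finite (Ar J)"

definition finitely_complete :: "('o, 'm) cat \<Rightarrow> bool" where
  "finitely_complete C \<longleftrightarrow>
     (\<forall>J D. finite_shape J \<and> is_functor J C D \<longrightarrow> (\<exists>L p. is_limit C J D L p))"

definition finitely_cocomplete :: "('o, 'm) cat \<Rightarrow> bool" where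
  "finitely_cocomplete C \<longleftrightarrow>
     (\<forall>J D. finite_shape J \<and> is_functor J C D \<longrightarrow> (\<exists>L p. is_colimit C J D L p))"

text \<open>Finite coproducts are the colimits of finite discrete diagrams.\<close>

definition has_finite_coproducts :: "('o, 'm) cat \<Rightarrow> bool" where
  "has_finite_coproducts C \<longleftrightarrow>
     (\<forall>J D. finite_shape J \<and> Ar J = Ide J ` Ob J \<and> is_functor J C D
        \<longrightarrow> (\<exists>L p. is_colimit C J D L p))"

definition is_initial :: "('o, 'm) cat \<Rightarrow> 'o \<Rightarrow> bool" where
  "is_initial C Z \<longleftrightarrow> Z \<in> Ob C \<and> (\<forall>A\<in>Ob C. \<exists>!f. f \<in> Hom C Z A)"

definition is_terminal :: "('o, 'm) cat \<Rightarrow> 'o \<Rightarrow> bool" where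
  "is_terminal C T \<longleftrightarrow> T \<in> Ob C \<and> (\<forall>A\<in>Ob C. \<exists>!f. f \<in> Hom C A T)"

definition is_coproduct :: "('o, 'm) cat \<Rightarrow> 'o \<Rightarrow> 'o \<Rightarrow> 'o \<Rightarrow> 'm \<Rightarrow> 'm \<Rightarrow> bool" where
  "is_coproduct C A B P i j \<longleftrightarrow> i \<in> Hom C A P \<and> j \<in> Hom C B P \<and>
     (\<forall>X. \<forall>f \<in> Hom C A X. \<forall>g \<in> Hom C B X.
        \<exists>!h. h \<in> Hom C P X \<and> h \<cdot>\<^bsub>C\<^esub> i = f \<and> h \<cdot>\<^bsub>C\<^esub> j = g)"

definition is_pullback :: "('o, 'm) cat \<Rightarrow> 'm \<Rightarrow> 'm \<Rightarrow> 'o \<Rightarrow> 'm \<Rightarrow> 'm \<Rightarrow> bool" where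
  "is_pullback C f g P p q \<longleftrightarrow> f \<in> Ar C \<and> g \<in> Ar C \<and> Cod C f = Cod C g \<and>
     p \<in> Hom C P (Dom C f) \<and> q \<in> Hom C P (Dom C g) \<and> f \<cdot>\<^bsub>C\<^esub> p = g \<cdot>\<^bsub>C\<^esub> q \<and>
     (\<forall>X. \<forall>u \<in> Hom C X (Dom C f). \<forall>v \<in> Hom C X (Dom C g). f \<cdot>\<^bsub>C\<^esub> u = g \<cdot>\<^bsub>C\<^esub> v \<longrightarrow>
        (\<exists>!h. h \<in> Hom C X P \<and> p \<cdot>\<^bsub>C\<^esub> h = u \<and> q \<cdot>\<^bsub>C\<^esub> h = v))"

definition is_coequalizer :: "('o, 'm) cat \<Rightarrow> 'm \<Rightarrow> 'm \<Rightarrow> 'm \<Rightarrow> bool" where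
  "is_coequalizer C f g q \<longleftrightarrow> f \<in> Ar C \<and> g \<in> Hom C (Dom C f) (Cod C f) \<and>
     q \<in> Ar C \<and> Dom C q = Cod C f \<and> q \<cdot>\<^bsub>C\<^esub> f = q \<cdot>\<^bsub>C\<^esub> g \<and>
     (\<forall>X. \<forall>h \<in> Hom C (Cod C f) X. h \<cdot>\<^bsub>C\<^esub> f = h \<cdot>\<^bsub>C\<^esub> g \<longrightarrow>
        (\<exists>!k. k \<in> Hom C (Cod C q) X \<and> k \<cdot>\<^bsub>C\<^esub> q = h))"

definition is_kernel_pair :: "('o, 'm) cat \<Rightarrow> 'm \<Rightarrow> 'o \<Rightarrow> 'm \<Rightarrow> 'm \<Rightarrow> bool" where
  "is_kernel_pair C f R r1 r2 \<longleftrightarrow> is_pullback C f f R r1 r2"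

definition is_regular_epi :: "('o, 'm) cat \<Rightarrow> 'm \<Rightarrow> bool" where
  "is_regular_epi C q \<longleftrightarrow> (\<exists>f g. is_coequalizer C f g q)"


section \<open>Internal relations\<close>

definition is_relation :: "('o, 'm) cat \<Rightarrow> 'o \<Rightarrow> 'o \<times> 'm \<times> 'm \<Rightarrow> bool" where
  "is_relation C X = (\<lambda>(R, r1, r2). r1 \<in> Hom C R X \<and> r2 \<in> Hom C R X \<and>
     (\<forall>Y. \<forall>u \<in> Hom C Y R. \<forall>v \<in> Hom C Y R.
        r1 \<cdot>\<^bsub>C\<^esub> u = r1 \<cdot>\<^bsub>C\<^esub> v \<and> r2 \<cdot>\<^bsub>C\<^esub> u = r2 \<cdot>\<^bsub>C\<^esub> v \<longrightarrow> u = v))"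

definition is_reflexive_relation :: "('o, 'm) cat \<Rightarrow> 'o \<Rightarrow> 'o \<times> 'm \<times> 'm \<Rightarrow> bool" where
  "is_reflexive_relation C X = (\<lambda>(R, r1, r2). is_relation C X (R, r1, r2) \<and>
     (\<exists>s \<in> Hom C X R. r1 \<cdot>\<^bsub>C\<^esub> s = Ide C X \<and> r2 \<cdot>\<^bsub>C\<^esub> s = Ide C X))"

definition is_equivalence_relation :: "('o, 'm) cat \<Rightarrow> 'o \<Rightarrow> 'o \<times> 'm \<times> 'm \<Rightarrow> bool" where
  "is_equivalence_relation C X = (\<lambda>(R, r1, r2). is_reflexive_relation C X (R, r1, r2) \<and>
     (\<exists>s \<in> Hom C R R. r1 \<cdot>\<^bsub>C\<^esub> s = r2 \<and> r2 \<cdot>\<^bsub>C\<^esub> s = r1) \<and>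
     (\<forall>P p q. is_pullback C r2 r1 P p q \<longrightarrow>
        (\<exists>t \<in> Hom C P R. r1 \<cdot>\<^bsub>C\<^esub> t = r1 \<cdot>\<^bsub>C\<^esub> p \<and> r2 \<cdot>\<^bsub>C\<^esub> t = r2 \<cdot>\<^bsub>C\<^esub> q)))"

definition relation_le :: "('o, 'm) cat \<Rightarrow> 'o \<times> 'm \<times> 'm \<Rightarrow> 'o \<times> 'm \<times> 'm \<Rightarrow> bool" where
  "relation_le C = (\<lambda>(R, r1, r2) (S, s1, s2).
     \<exists>h \<in> Hom C R S. s1 \<cdot>\<^bsub>C\<^esub> h = r1 \<and> s2 \<cdot>\<^bsub>C\<^esub> h = r2)"

text \<open>Relations are subobjects, so they are only compared up to isomorphism over \<open>X\<close>:
  the carrier consists of representatives, and the equality of the order structure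
  identifies representatives of the same subobject.\<close>

definition equivalence_relations :: "('o, 'm) cat \<Rightarrow> 'o \<Rightarrow> ('o \<times> 'm \<times> 'm) gorder" where
  "equivalence_relations C X = \<lparr>carrier = {R. is_equivalence_relation C X R},
     eq = (\<lambda>R S. relation_le C R S \<and> relation_le C S R),
     le = relation_le C\<rparr>"

locale weak_distributive_lattice = weak_lattice L for L (structure) +
  assumes meet_join_distrib: "x \<in> carrier L \<Longrightarrow> y \<in> carrier L \<Longrightarrow> z \<in> carrier L
    \<Longrightarrow> x \<sqinter> (y \<squnion> z) .= (x \<sqinter> y) \<squnion> (x \<sqinter> z)"


section \<open>Regular, exact and extensive categories\<close>

locale regular_category = category +
  assumes finitely_complete: "finitely_complete C"
    and kernel_pair_coequalizer: "is_kernel_pair C f R r1 r2 \<Longrightarrow> \<exists>q. is_coequalizer C r1 r2 q"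
    and regular_epi_stable: "is_regular_epi C f \<Longrightarrow> is_pullback C g f P p q \<Longrightarrow> is_regular_epi C p"

locale exact_category = regular_category +
  assumes effective: "is_equivalence_relation C X (R, r1, r2) \<Longrightarrow> \<exists>f. is_kernel_pair C f R r1 r2"

definition slice :: "('o, 'm) cat \<Rightarrow> 'o \<Rightarrow> ('o \<times> 'm, ('o \<times> 'm) \<times> 'm \<times> ('o \<times> 'm)) cat" where
  "slice C A = structured_cat C {(X, f). f \<in> Hom C X A} fst (\<lambda>(X, f) u (Y, g). g \<cdot>\<^bsub>C\<^esub> u = f)"

text \<open>The coproduct functor is formed with respect to a choice of binary coproducts; whether it is an
  equivalence does not depend on the choice. The same applies to pullbacks and \<open>pb_functor\<close> below.\<close>

definition coprod :: "('o, 'm) cat \<Rightarrow> 'o \<Rightarrow> 'o \<Rightarrow> 'o \<times> 'm \<times> 'm" where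
  "coprod C A B = (SOME (P, i, j). is_coproduct C A B P i j)"

definition coprod_ob :: "('o, 'm) cat \<Rightarrow> 'o \<Rightarrow> 'o \<Rightarrow> 'o" where
  "coprod_ob C A B = (case coprod C A B of (P, i, j) \<Rightarrow> P)"

definition coprod_ar :: "('o, 'm) cat \<Rightarrow> 'm \<Rightarrow> 'm \<Rightarrow> 'm" where
  "coprod_ar C f g =
     (case coprod C (Dom C f) (Dom C g) of (P, i, j) \<Rightarrow>
      case coprod C (Cod C f) (Cod C g) of (P', i', j') \<Rightarrow>
        THE h. h \<in> Hom C P P' \<and> h \<cdot>\<^bsub>C\<^esub> i = i' \<cdot>\<^bsub>C\<^esub> f \<and> h \<cdot>\<^bsub>C\<^esub> j = j' \<cdot>\<^bsub>C\<^esub> g)"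

definition coprod_slice_ob :: "('o, 'm) cat \<Rightarrow> ('o \<times> 'm) \<times> ('o \<times> 'm) \<Rightarrow> 'o \<times> 'm" where
  "coprod_slice_ob C = (\<lambda>((X, f), (Y, g)). (coprod_ob C X Y, coprod_ar C f g))"

definition coprod_functor :: "('o, 'm) cat \<Rightarrow>
    (('o \<times> 'm) \<times> ('o \<times> 'm), (('o \<times> 'm) \<times> 'm \<times> ('o \<times> 'm)) \<times> (('o \<times> 'm) \<times> 'm \<times> ('o \<times> 'm)),
     'o \<times> 'm, ('o \<times> 'm) \<times> 'm \<times> ('o \<times> 'm)) cfunctor" where
  "coprod_functor C = \<lparr>FOb = coprod_slice_ob C,
     FAr = (\<lambda>((x, u, x'), (y, v, y')).
       (coprod_slice_ob C (x, y), coprod_ar C u v, coprod_slice_ob C (x', y')))\<rparr>"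

locale extensive_category = category +
  assumes finite_coproducts: "has_finite_coproducts C"
    and coprod_equivalence: "A \<in> Ob C \<Longrightarrow> B \<in> Ob C \<Longrightarrow>
      is_equivalence (prod_cat (slice C A) (slice C B)) (slice C (coprod_ob C A B))
        (coprod_functor C)"

locale pretopos = exact_category + extensive_category


section \<open>Protomodular, ideally exact, Mal'tsev and arithmetical categories\<close>

definition Pt :: "('o, 'm) cat \<Rightarrow> 'o \<Rightarrow>
    ('o \<times> 'm \<times> 'm, ('o \<times> 'm \<times> 'm) \<times> 'm \<times> ('o \<times> 'm \<times> 'm)) cat" where
  "Pt C B = structured_cat C
     {(A, \<alpha>, \<beta>). \<alpha> \<in> Hom C A B \<and> \<beta> \<in> Hom C B A \<and> \<alpha> \<cdot>\<^bsub>C\<^esub> \<beta> = Ide C B} fst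
     (\<lambda>(A, \<alpha>, \<beta>) f (A', \<alpha>', \<beta>'). \<alpha>' \<cdot>\<^bsub>C\<^esub> f = \<alpha> \<and> f \<cdot>\<^bsub>C\<^esub> \<beta> = \<beta>')"

definition pullback :: "('o, 'm) cat \<Rightarrow> 'm \<Rightarrow> 'm \<Rightarrow> 'o \<times> 'm \<times> 'm" where
  "pullback C f g = (SOME (P, p, q). is_pullback C f g P p q)"

definition pb_ob :: "('o, 'm) cat \<Rightarrow> 'm \<Rightarrow> 'o \<times> 'm \<times> 'm \<Rightarrow> 'o \<times> 'm \<times> 'm" where
  "pb_ob C p = (\<lambda>(A, \<alpha>, \<beta>). case pullback C p \<alpha> of (P, \<pi>1, \<pi>2) \<Rightarrow>
     (P, \<pi>1, THE h. h \<in> Hom C (Dom C p) P \<and> \<pi>1 \<cdot>\<^bsub>C\<^esub> h = Ide C (Dom C p) \<and> \<pi>2 \<cdot>\<^bsub>C\<^esub> h = \<beta> \<cdot>\<^bsub>C\<^esub> p))"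

definition pb_ar :: "('o, 'm) cat \<Rightarrow> 'm \<Rightarrow> ('o \<times> 'm \<times> 'm) \<times> 'm \<times> ('o \<times> 'm \<times> 'm) \<Rightarrow> 'm" where
  "pb_ar C p = (\<lambda>((A, \<alpha>, \<beta>), f, (A', \<alpha>', \<beta>')).
     case pullback C p \<alpha> of (P, \<pi>1, \<pi>2) \<Rightarrow> case pullback C p \<alpha>' of (P', \<pi>1', \<pi>2') \<Rightarrow>
       THE h. h \<in> Hom C P P' \<and> \<pi>1' \<cdot>\<^bsub>C\<^esub> h = \<pi>1 \<and> \<pi>2' \<cdot>\<^bsub>C\<^esub> h = f \<cdot>\<^bsub>C\<^esub> \<pi>2)"

definition pb_functor :: "('o, 'm) cat \<Rightarrow> 'm \<Rightarrow>
    ('o \<times> 'm \<times> 'm, ('o \<times> 'm \<times> 'm) \<times> 'm \<times> ('o \<times> 'm \<times> 'm),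
     'o \<times> 'm \<times> 'm, ('o \<times> 'm \<times> 'm) \<times> 'm \<times> ('o \<times> 'm \<times> 'm)) cfunctor" where
  "pb_functor C p = \<lparr>FOb = pb_ob C p,
     FAr = (\<lambda>(x, f, y). (pb_ob C p x, pb_ar C p (x, f, y), pb_ob C p y))\<rparr>"

locale protomodular_category = category +
  assumes split_epi_pullbacks: "\<alpha> \<in> Hom C A B \<Longrightarrow> \<beta> \<in> Hom C B A \<Longrightarrow> \<alpha> \<cdot> \<beta> = Ide C B
      \<Longrightarrow> p \<in> Hom C E B \<Longrightarrow> \<exists>P \<pi>1 \<pi>2. is_pullback C p \<alpha> P \<pi>1 \<pi>2"
    and pb_reflects_isos: "p \<in> Hom C E B \<Longrightarrow> reflects_isos (Pt C B) (Pt C E) (pb_functor C p)"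

locale ideally_exact_category = exact_category + protomodular_category +
  assumes finitely_cocomplete: "finitely_cocomplete C"
    and initial_to_terminal: "is_initial C Z \<Longrightarrow> is_terminal C T \<Longrightarrow> f \<in> Hom C Z T
      \<Longrightarrow> is_regular_epi C f"

locale maltsev_category = category +
  assumes finitely_complete: "finitely_complete C"
    and reflexive_is_equivalence:
      "is_reflexive_relation C X (R, r1, r2) \<Longrightarrow> is_equivalence_relation C X (R, r1, r2)"

locale arithmetical_category = maltsev_category +
  assumes distributive: "X \<in> Ob C \<Longrightarrow> weak_distributive_lattice (equivalence_relations C X)"

end

theory Submission
  imports Defs
begin

text \<open>A pretopos supports reasoning with generalized elements \<open>t: T \<rightarrow> X\<close> up to finite covers of \<open>T\<close>
  built from regular epimorphisms and coproduct decompositions: equality, and factorization through a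
  monomorphism, can be checked on a cover. The key construction glues \<open>B\<close> and \<open>E\<close> along a monomorphism
  \<open>m: A \<rightarrow> B\<close> and a map \<open>f: A \<rightarrow> E\<close> as the quotient of \<open>B + E\<close> by an explicit equivalence relation. As
  every pushout of \<open>m\<close> and \<open>f\<close> maps to it, pushouts of monomorphisms are monomorphisms with the expected
  elementwise description; in particular every monomorphism is an equalizer and every epimorphism is
  regular.

  If \<open>r1, r2: X \<rightarrow> R\<close> are jointly epic with a common retraction, then \<open>[r1, r2]: X + X \<rightarrow> R\<close> is a regular
  epimorphism that can only identify the two copies of an element \<open>x\<close> of \<open>X\<close>, so \<open>R\<close> is the cokernel pair
  of the equalizer of \<open>r1\<close> and \<open>r2\<close>. Hence reflexive relations in the opposite category are
  equivalence relations and effective, and the equivalence relations on \<open>X\<close> correspond, with reversed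
  order, to the subobjects of \<open>X\<close>, which form a distributive lattice. Protomodularity follows from the
  description of pushouts along split monomorphisms, and \<open>0 \<rightarrow> 1\<close> is monic because \<open>0\<close> is strict.\<close>

section \<open>Categories, duality and finite limits\<close>

text \<open>A pushout is given only by its universal property, which describes the maps out of it
  but not which elements its legs identify. The glued object supplies the missing half. Nothing is
  proved about its own universality, only that its legs identify no more than the obvious pairs. A
  pushout maps to every cocone, so it identifies no more than the glued object does. Effectiveness
  of equivalence relations in C enters only here, as the step from an explicit equivalence relation
  to a map that has it as kernel pair.

  Covers are forced by the fact that quotients and coproducts are described by elements only
  locally: an element of a quotient lifts after pulling back a regular epimorphism, and an element
  of a coproduct lies in a summand after its domain has been decomposed. No topology has to be
  developed, because only two conclusions are ever drawn from a cover, equality of maps and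
  factorization through a jointly monic pair, and both descend along each generating kind of
  cover.\<close>

lemma op_cat_simps [simp]:
  "Ob (op_cat C) = Ob C" "Ar (op_cat C) = Ar C" "Dom (op_cat C) = Cod C" "Cod (op_cat C) = Dom C"
  "Ide (op_cat C) = Ide C" "g \<cdot>\<^bsub>op_cat C\<^esub> f = f \<cdot>\<^bsub>C\<^esub> g"
  by (simp_all add: op_cat_def)

lemma Hom_op_cat [simp]: "Hom (op_cat C) A B = Hom C B A"
  by (auto simp: Hom_def)

lemma op_cat_op_cat [simp]: "op_cat (op_cat C) = C"
  by (cases C) (simp add: op_cat_def)

context category
begin

lemma comp_arr [simp]: "f \<in> Ar C \<Longrightarrow> g \<in> Ar C \<Longrightarrow> Cod C f = Dom C g \<Longrightarrow> g \<cdot> f \<in> Ar C"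
  and dom_comp [simp]: "f \<in> Ar C \<Longrightarrow> g \<in> Ar C \<Longrightarrow> Cod C f = Dom C g \<Longrightarrow> Dom C (g \<cdot> f) = Dom C f"
  and cod_comp [simp]: "f \<in> Ar C \<Longrightarrow> g \<in> Ar C \<Longrightarrow> Cod C f = Dom C g \<Longrightarrow> Cod C (g \<cdot> f) = Cod C g"
  using Comp_in_Hom[of f "Dom C f" "Cod C f" g "Cod C g"] by (auto simp: Hom_def)

lemma ide_arr [simp]: "A \<in> Ob C \<Longrightarrow> Ide C A \<in> Ar C"
  and dom_ide [simp]: "A \<in> Ob C \<Longrightarrow> Dom C (Ide C A) = A"
  and cod_ide [simp]: "A \<in> Ob C \<Longrightarrow> Cod C (Ide C A) = A"
  using Id_in_Hom[of A] by (auto simp: Hom_def)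

lemma ide_comp [simp]: "f \<in> Ar C \<Longrightarrow> Cod C f = B \<Longrightarrow> Ide C B \<cdot> f = f"
  and comp_ide [simp]: "f \<in> Ar C \<Longrightarrow> Dom C f = A \<Longrightarrow> f \<cdot> Ide C A = f"
  using Id_left[of f] Id_right[of f] by (auto simp: Hom_def)

lemma assoc:
  "f \<in> Ar C \<Longrightarrow> g \<in> Ar C \<Longrightarrow> h \<in> Ar C \<Longrightarrow> Cod C f = Dom C g \<Longrightarrow> Cod C g = Dom C h
    \<Longrightarrow> (h \<cdot> g) \<cdot> f = h \<cdot> (g \<cdot> f)"
  using Comp_assoc[of f "Dom C f" "Dom C g" g "Dom C h" h "Cod C h"] by (auto simp: Hom_def)

lemma Hom_Ob: "f \<in> Hom C A B \<Longrightarrow> A \<in> Ob C \<and> B \<in> Ob C"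
  using Dom_in_Ob Cod_in_Ob by (auto simp: Hom_def)

text \<open>Evaluates a commutative square at a generalized element. Associativity carries typing
  hypotheses, so diagram chases quote this packaged form.\<close>

lemma comp_eq_comp:
  assumes "g \<cdot> f = k \<cdot> h" "f \<in> Hom C A B" "g \<in> Hom C B D" "h \<in> Hom C A B'" "k \<in> Hom C B' D"
    "z \<in> Hom C T A"
  shows "g \<cdot> (f \<cdot> z) = k \<cdot> (h \<cdot> z)"
  using Comp_assoc[OF assms(6,2,3)] Comp_assoc[OF assms(6,4,5)] assms(1) by simp

lemma category_op_cat: "category (op_cat C)"
  by unfold_locales (auto simp: Hom_def Dom_in_Ob Cod_in_Ob assoc)

end

lemma is_functor_op_cat: "is_functor J (op_cat C) D \<longleftrightarrow> is_functor (op_cat J) C D"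
  by (auto simp: is_functor_def)

lemma is_cone_op_cat: "is_cone (op_cat C) J D L p \<longleftrightarrow> is_cocone C (op_cat J) D L p"
  by (auto simp: is_cone_def is_cocone_def)

lemma is_limit_op_cat: "is_limit (op_cat C) J D L p \<longleftrightarrow> is_colimit C (op_cat J) D L p"
  by (simp add: is_limit_def is_colimit_def is_cone_op_cat)

lemma finite_shape_op_cat: "finite_shape J \<Longrightarrow> finite_shape (op_cat J)"
  by (simp add: finite_shape_def category.category_op_cat)

text \<open>Dualizing the category also dualizes the shape of a diagram. Quantification over all
  finite shapes absorbs this, because these are closed under duality.\<close>

lemma finitely_complete_op_cat:
  assumes "finitely_cocomplete C"
  shows "finitely_complete (op_cat C)"
  using assms
  by (simp add: finitely_complete_def finitely_cocomplete_def is_functor_op_cat is_limit_op_cat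
      finite_shape_op_cat)

lemma finitely_cocomplete_op_cat:
  assumes "finitely_complete C"
  shows "finitely_cocomplete (op_cat C)"
proof -
  have "is_colimit (op_cat C) J D L p \<longleftrightarrow> is_limit C (op_cat J) D L p"
    for J :: "(nat, nat) cat" and D L p
    using is_limit_op_cat[of "op_cat C" "op_cat J"] by simp
  then show ?thesis
    using assms
    by (simp add: finitely_complete_def finitely_cocomplete_def is_functor_op_cat
        finite_shape_op_cat)
qed

text \<open>The shape with objects \<open>0, \<dots>, n - 1\<close> and one non-identity arrow for each edge. No two edges are
  composable, so a composite is determined by its non-identity factor.\<close>

definition edge_shape :: "nat \<Rightarrow> (nat \<times> nat) list \<Rightarrow> (nat, nat) cat" where
  "edge_shape n es = \<lparr>Ob = {..<n}, Ar = {..<n + length es},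
     Dom = (\<lambda>u. if u < n then u else fst (es ! (u - n))),
     Cod = (\<lambda>u. if u < n then u else snd (es ! (u - n))),
     Ide = id, Comp = (\<lambda>g f. if f < n then g else f)\<rparr>"

locale edge_graph =
  fixes n :: nat and es :: "(nat \<times> nat) list"
  assumes edges: "e \<in> set es \<Longrightarrow> fst e < n \<and> snd e < n"
    and not_composable: "e \<in> set es \<Longrightarrow> e' \<in> set es \<Longrightarrow> snd e \<noteq> fst e'"
begin

lemma finite_shape_edge_shape: "finite_shape (edge_shape n es)"
proof -
  have e: "fst (es ! k) < n \<and> snd (es ! k) < n" if "k < length es" for k
    using edges that by simp
  have c: "snd (es ! k) \<noteq> fst (es ! l)" if "k < length es" "l < length es" for k l
    using not_composable that by simp
  have "category (edge_shape n es)"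
  proof
    fix f g A B D
    assume f: "f \<in> Hom (edge_shape n es) A B" and g: "g \<in> Hom (edge_shape n es) B D"
    show "g \<cdot>\<^bsub>edge_shape n es\<^esub> f \<in> Hom (edge_shape n es) A D"
    proof (cases "f < n \<or> g < n")
      case True
      then show ?thesis using f g by (auto simp: Hom_def edge_shape_def split: if_splits)
    next
      case False
      then have "f - n < length es" "g - n < length es"
        using f g by (auto simp: Hom_def edge_shape_def)
      with False show ?thesis
        using f g c[of "f - n" "g - n"] by (simp add: Hom_def edge_shape_def)
    qed
  next
    fix f A B
    assume f: "f \<in> Hom (edge_shape n es) A B"
    show "Ide (edge_shape n es) B \<cdot>\<^bsub>edge_shape n es\<^esub> f = f"
      using f by (auto simp: Hom_def edge_shape_def split: if_splits)
    show "f \<cdot>\<^bsub>edge_shape n es\<^esub> Ide (edge_shape n es) A = f"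
    proof (cases "f < n")
      case True
      then show ?thesis using f by (simp add: Hom_def edge_shape_def)
    next
      case False
      then have "f - n < length es" using f by (auto simp: Hom_def edge_shape_def)
      with False show ?thesis using f e[of "f - n"] by (auto simp: Hom_def edge_shape_def)
    qed
  next
    fix f assume "f \<in> Ar (edge_shape n es)"
    then have "f < n \<or> f - n < length es" by (auto simp: edge_shape_def)
    then show "Dom (edge_shape n es) f \<in> Ob (edge_shape n es)"
      "Cod (edge_shape n es) f \<in> Ob (edge_shape n es)"
      using e[of "f - n"] by (simp_all add: edge_shape_def) auto
  qed (auto simp: Hom_def edge_shape_def split: if_splits)
  then show ?thesis by (simp add: finite_shape_def) (simp add: edge_shape_def)
qed

end

text \<open>Identity arrows impose no condition on a cone with well-typed legs, so one equation per
  edge is left. In this form concrete shapes can be evaluated.\<close>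

definition edge_cone ::
  "('o, 'm) cat \<Rightarrow> nat \<Rightarrow> (nat \<times> nat) list \<Rightarrow> (nat \<Rightarrow> 'o) \<Rightarrow> (nat \<Rightarrow> 'm) \<Rightarrow> 'o \<Rightarrow> (nat \<Rightarrow> 'm) \<Rightarrow> bool"
where
  "edge_cone C n es X U L p \<longleftrightarrow> L \<in> Ob C \<and> (\<forall>i<n. p i \<in> Hom C L (X i)) \<and>
     (\<forall>k<length es. U k \<cdot>\<^bsub>C\<^esub> p (fst (es ! k)) = p (snd (es ! k)))"

lemma (in category) edge_limit:
  assumes complete: "finitely_complete C" and g: "edge_graph n es"
    and X: "\<And>i. i < n \<Longrightarrow> X i \<in> Ob C"
    and U: "\<And>k. k < length es \<Longrightarrow> U k \<in> Hom C (X (fst (es ! k))) (X (snd (es ! k)))"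
  shows "\<exists>L p. edge_cone C n es X U L p \<and>
    (\<forall>M q. edge_cone C n es X U M q \<longrightarrow> (\<exists>!h. h \<in> Hom C M L \<and> (\<forall>i<n. p i \<cdot> h = q i)))"
proof -
  interpret edge_graph n es by fact
  define J where "J = edge_shape n es"
  \<comment> \<open>Arrows below \<open>n\<close> are the identities; edge \<open>k\<close> is the
    arrow \<open>n + k\<close>, hence the shift.\<close>
  define D where "D = \<lparr>FOb = X, FAr = (\<lambda>u. if u < n then Ide C (X u) else U (u - n))\<rparr>"
  have e: "fst (es ! k) < n \<and> snd (es ! k) < n" if "k < length es" for k
    using edges that by simp
  have c: "snd (es ! k) \<noteq> fst (es ! l)" if "k < length es" "l < length es" for k l
    using not_composable that by simp
  have U': "U k \<in> Ar C" "Dom C (U k) = X (fst (es ! k))" "Cod C (U k) = X (snd (es ! k))"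
    if "k < length es" for k using U[OF that] by (auto simp: Hom_def)
  have F: "is_functor J C D"
    unfolding is_functor_def
  proof (intro conjI ballI impI)
    fix f g assume f: "f \<in> Ar J" and g: "g \<in> Ar J" and fg: "Cod J f = Dom J g"
    have fg': "f < n \<or> f - n < length es" "g < n \<or> g - n < length es"
      using f g by (auto simp: J_def edge_shape_def)
    show "FAr D (g \<cdot>\<^bsub>J\<^esub> f) = FAr D g \<cdot> FAr D f"
    proof (cases "f < n \<or> g < n")
      case True
      then show ?thesis
        using fg' fg e[of "f - n"] U'[of "g - n"] U'[of "f - n"]
        by (auto simp: J_def D_def edge_shape_def X)
    next
      case False
      then show ?thesis using fg' fg c[of "f - n" "g - n"] by (simp add: J_def edge_shape_def)
    qed
  next
    fix f assume f: "f \<in> Ar J"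
    show "FAr D f \<in> Hom C (FOb D (Dom J f)) (FOb D (Cod J f))"
      using f U[of "f - n"] X Id_in_Hom by (auto simp: J_def D_def edge_shape_def)
  qed (auto simp: J_def D_def edge_shape_def X)
  have cone: "is_cone C J D M q \<longleftrightarrow> edge_cone C n es X U M q" for M q
  proof
    assume A: "is_cone C J D M q"
    then have "FAr D u \<cdot> q (Dom J u) = q (Cod J u)" if "u \<in> Ar J" for u
      using that by (simp add: is_cone_def)
    \<comment> \<open>Cone equations are wanted only at the non-identity arrows, which are the
      numbers \<open>n + k\<close>.\<close>
    from this[of "n + k" for k]
    have "FAr D (n + k) \<cdot> q (Dom J (n + k)) = q (Cod J (n + k))" if "k < length es" for k
      using that by (simp add: J_def edge_shape_def)
    then show "edge_cone C n es X U M q"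
      using A by (simp add: is_cone_def edge_cone_def J_def D_def edge_shape_def)
  next
    assume A: "edge_cone C n es X U M q"
    have "FAr D u \<cdot> q (Dom J u) = q (Cod J u)" if "u \<in> Ar J" for u
    proof (cases "u < n")
      case True
      then show ?thesis using A by (auto simp: edge_cone_def J_def D_def edge_shape_def Hom_def)
    next
      case False
      then have "u - n < length es" using that by (auto simp: J_def edge_shape_def)
      then show ?thesis using A False by (simp add: edge_cone_def J_def D_def edge_shape_def)
    qed
    then show "is_cone C J D M q"
      using A by (simp add: is_cone_def edge_cone_def) (simp add: J_def D_def edge_shape_def)
  qed
  have "finite_shape J" unfolding J_def by (rule finite_shape_edge_shape)
  then have "\<exists>L p. is_limit C J D L p"
    using complete F unfolding finitely_complete_def by blast
  moreover have Ob_J: "(\<forall>i\<in>Ob J. Q i) \<longleftrightarrow> (\<forall>i<n. Q i)" for Q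
    by (auto simp: J_def edge_shape_def)
  ultimately show ?thesis by (simp only: is_limit_def cone Ob_J)
qed

text \<open>Products, equalizers and pushouts are written as coproducts, coequalizers and pullbacks of the
  opposite category.\<close>

locale complete_category = category +
  assumes complete: "finitely_complete C"
begin

lemma terminal_exists: "\<exists>T. is_terminal C T"
proof -
  have "edge_graph 0 []" by unfold_locales auto
  \<comment> \<open>A cone over the empty shape is a bare object, so the diagram may be
    \<open>undefined\<close>.\<close>
  from edge_limit[OF complete this, of undefined undefined] show ?thesis
    by (simp add: edge_cone_def is_terminal_def Ball_def)
qed

lemma product_exists:
  assumes "A \<in> Ob C" "B \<in> Ob C"
  shows "\<exists>P p q. is_coproduct (op_cat C) A B P p q"
proof -
  have g: "edge_graph 2 []" by unfold_locales auto
  define X where "X = (\<lambda>i::nat. if i = 0 then A else B)"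
  have "X i \<in> Ob C" for i using assms by (simp add: X_def)
  with edge_limit[OF complete g, of X undefined] obtain L p where
    L: "edge_cone C 2 [] X undefined L p" and
    un: "\<And>M q. edge_cone C 2 [] X undefined M q \<Longrightarrow>
      \<exists>!h. h \<in> Hom C M L \<and> (\<forall>i<2. p i \<cdot> h = q i)" by auto
  have less2: "(\<forall>i<2. Q i) \<longleftrightarrow> Q 0 \<and> Q (1::nat)" for Q
    by (auto simp: less_2_cases_iff)
  have "\<exists>!h. h \<in> Hom C T L \<and> p 0 \<cdot> h = f \<and> p 1 \<cdot> h = g"
    if "f \<in> Hom C T A" "g \<in> Hom C T B" for T f g
    using un[of T "\<lambda>i. if i = 0 then f else g"] that Hom_Ob[OF that(1)]
    by (simp add: edge_cone_def X_def less2)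
  then have "is_coproduct (op_cat C) A B L (p 0) (p 1)"
    using L by (simp add: is_coproduct_def edge_cone_def X_def less2)
  then show ?thesis by blast
qed

lemma equalizer_exists:
  assumes f: "f \<in> Hom C A B" and g: "g \<in> Hom C A B"
  shows "\<exists>e. is_coequalizer (op_cat C) f g e"
proof -
  \<comment> \<open>Two parallel edges. The leg at 1 is forced to be \<open>f \<cdot> q 0\<close>,
    so a cone amounts to one map on which \<open>f\<close> and \<open>g\<close> agree.\<close>
  define es where "es = [(0::nat, 1::nat), (0, 1)]"
  have gr: "edge_graph 2 es" by unfold_locales (auto simp: es_def)
  define X where "X = (\<lambda>i::nat. if i = 0 then A else B)"
  define U where "U = (\<lambda>i::nat. if i = 0 then f else g)"
  have X: "X i \<in> Ob C" for i using Hom_Ob[OF f] by (simp add: X_def)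
  have U: "U k \<in> Hom C (X (fst (es ! k))) (X (snd (es ! k)))" if "k < length es" for k
    using that f g by (auto simp: X_def U_def es_def less_Suc_eq)
  have less2: "(\<forall>i<2. Q i) \<longleftrightarrow> Q 0 \<and> Q (1::nat)" for Q
    by (auto simp: less_2_cases_iff)
  have cone: "edge_cone C 2 es X U M q \<longleftrightarrow>
    q 0 \<in> Hom C M A \<and> f \<cdot> q 0 = q 1 \<and> g \<cdot> q 0 = q 1" for M q
  proof -
    have "length es = 2" by (simp add: es_def)
    then show ?thesis
      using f g Hom_Ob[of "q 0" M A] Comp_in_Hom[of "q 0" M A f B]
      by (auto simp: edge_cone_def less2) (auto simp: X_def U_def es_def)
  qed
  from edge_limit[OF complete gr, of X U] X U obtain L p where
    L: "edge_cone C 2 es X U L p" and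
    un: "\<And>M q. edge_cone C 2 es X U M q \<Longrightarrow>
      \<exists>!h. h \<in> Hom C M L \<and> (\<forall>i<2. p i \<cdot> h = q i)" by auto
  have L': "p 0 \<in> Hom C L A" "f \<cdot> p 0 = p 1" "g \<cdot> p 0 = p 1"
    using L by (simp_all add: cone)
  have "\<exists>!k. k \<in> Hom C T L \<and> p 0 \<cdot> k = h"
    if h: "h \<in> Hom C T A" "f \<cdot> h = g \<cdot> h" for T h
  proof -
    have "p 1 \<cdot> k = f \<cdot> (p 0 \<cdot> k)" if "k \<in> Hom C T L" for k
      using Comp_assoc[OF that L'(1) f] L'(2) by simp
    then have "(k \<in> Hom C T L \<and> (\<forall>i<2. p i \<cdot> k = (if i = 0 then h else f \<cdot> h))) \<longleftrightarrow>
       (k \<in> Hom C T L \<and> p 0 \<cdot> k = h)" for k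
      by (auto simp: less2)
    then show ?thesis using un[of T "\<lambda>i. if i = 0 then h else f \<cdot> h"] h by (simp add: cone)
  qed
  then have "is_coequalizer (op_cat C) f g (p 0)"
    using L' f g by (simp add: is_coequalizer_def) (simp add: Hom_def)
  then show ?thesis by blast
qed

lemma pullback_exists:
  assumes f: "f \<in> Hom C A D" and g: "g \<in> Hom C B D"
  shows "\<exists>P p q. is_pullback C f g P p q"
proof -
  \<comment> \<open>The cospan with vertex 2; again the leg at the vertex is determined by the
    others.\<close>
  define es where "es = [(0::nat, 2::nat), (1, 2)]"
  have gr: "edge_graph 3 es" by unfold_locales (auto simp: es_def)
  define X where "X = (\<lambda>i::nat. if i = 0 then A else if i = 1 then B else D)"
  define U where "U = (\<lambda>i::nat. if i = 0 then f else g)"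
  have X: "X i \<in> Ob C" for i using Hom_Ob[OF f] Hom_Ob[OF g] by (simp add: X_def)
  have U: "U k \<in> Hom C (X (fst (es ! k))) (X (snd (es ! k)))" if "k < length es" for k
    using that f g by (auto simp: X_def U_def less_Suc_eq es_def)
  have less3: "(\<forall>i<3. Q i) \<longleftrightarrow> Q 0 \<and> Q 1 \<and> Q (2::nat)" for Q
    by (auto simp: less_Suc_eq numeral_3_eq_3 numeral_2_eq_2)
  have cone: "edge_cone C 3 es X U M q \<longleftrightarrow>
    q 0 \<in> Hom C M A \<and> q 1 \<in> Hom C M B \<and> f \<cdot> q 0 = q 2 \<and> g \<cdot> q 1 = q 2" for M q
  proof -
    have "length es = 2" by (simp add: es_def)
    then have es: "(\<forall>k<length es. Q k) \<longleftrightarrow> Q 0 \<and> Q 1" for Q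
      by (auto simp: less_2_cases_iff)
    have "es ! 0 = (0, 2)" "es ! 1 = (1, 2)" "X 0 = A" "X 1 = B" "X 2 = D" "U 0 = f" "U 1 = g"
      by (simp_all add: es_def X_def U_def)
    moreover have "M \<in> Ob C" "f \<cdot> q 0 \<in> Hom C M D" if "q 0 \<in> Hom C M A"
      using that f Hom_Ob Comp_in_Hom by blast+
    ultimately show ?thesis unfolding edge_cone_def less3 es by auto
  qed
  from edge_limit[OF complete gr, of X U] X U obtain L p where
    L: "edge_cone C 3 es X U L p" and
    un: "\<And>M q. edge_cone C 3 es X U M q \<Longrightarrow>
      \<exists>!h. h \<in> Hom C M L \<and> (\<forall>i<3. p i \<cdot> h = q i)" by auto
  have L': "p 0 \<in> Hom C L A" "p 1 \<in> Hom C L B" "f \<cdot> p 0 = p 2" "g \<cdot> p 1 = p 2"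
    using L by (simp_all add: cone)
  have "\<exists>!h. h \<in> Hom C T L \<and> p 0 \<cdot> h = u \<and> p 1 \<cdot> h = v"
    if h: "u \<in> Hom C T A" "v \<in> Hom C T B" "f \<cdot> u = g \<cdot> v" for T u v
  proof -
    define q where "q = (\<lambda>i::nat. if i = 0 then u else if i = 1 then v else f \<cdot> u)"
    have "p 2 \<cdot> k = f \<cdot> (p 0 \<cdot> k)" if "k \<in> Hom C T L" for k
      using Comp_assoc[OF that L'(1) f] L'(3) by simp
    then have "(k \<in> Hom C T L \<and> (\<forall>i<3. p i \<cdot> k = q i)) \<longleftrightarrow>
       (k \<in> Hom C T L \<and> p 0 \<cdot> k = u \<and> p 1 \<cdot> k = v)" for k
      by (auto simp: less3 q_def)
    moreover have "\<exists>!k. k \<in> Hom C T L \<and> (\<forall>i<3. p i \<cdot> k = q i)"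
      by (rule un) (use h in \<open>simp add: cone q_def\<close>)
    ultimately show ?thesis by simp
  qed
  moreover have "f \<in> Ar C" "g \<in> Ar C" "Cod C f = Cod C g" "f \<cdot> p 0 = g \<cdot> p 1"
    and dom: "Dom C f = A" "Dom C g = B"
    using f g L' by (auto simp: Hom_def)
  ultimately have "is_pullback C f g L (p 0) (p 1)"
    unfolding is_pullback_def dom using L'(1,2) by blast
  then show ?thesis by blast
qed

end

section \<open>Local reasoning in regular categories\<close>

definition is_mono :: "('o, 'm) cat \<Rightarrow> 'm \<Rightarrow> bool" where
  "is_mono C m \<longleftrightarrow> m \<in> Ar C \<and> (\<forall>T. \<forall>x \<in> Hom C T (Dom C m). \<forall>y \<in> Hom C T (Dom C m).
     m \<cdot>\<^bsub>C\<^esub> x = m \<cdot>\<^bsub>C\<^esub> y \<longrightarrow> x = y)"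

lemma mono_cancel:
  "is_mono C m \<Longrightarrow> m \<in> Hom C A B \<Longrightarrow> x \<in> Hom C T A \<Longrightarrow> y \<in> Hom C T A
    \<Longrightarrow> m \<cdot>\<^bsub>C\<^esub> x = m \<cdot>\<^bsub>C\<^esub> y \<Longrightarrow> x = y"
  by (auto simp: is_mono_def Hom_def)

lemma is_monoI:
  "m \<in> Hom C A B \<Longrightarrow> (\<And>T x y. x \<in> Hom C T A \<Longrightarrow> y \<in> Hom C T A
    \<Longrightarrow> m \<cdot>\<^bsub>C\<^esub> x = m \<cdot>\<^bsub>C\<^esub> y \<Longrightarrow> x = y) \<Longrightarrow> is_mono C m"
  by (auto simp: is_mono_def Hom_def)

text \<open>Repeating the leg turns a subobject into a relation, so that descent has to be proved
  only for jointly monic pairs.\<close>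

lemma mono_is_relation: "is_mono C m \<Longrightarrow> m \<in> Hom C A B \<Longrightarrow> is_relation C B (A, m, m)"
  unfolding is_relation_def by (auto intro: mono_cancel)

lemma pullback_ump:
  assumes "is_pullback C f g P p q" "f \<in> Hom C A D" "g \<in> Hom C B D"
    "u \<in> Hom C T A" "v \<in> Hom C T B" "f \<cdot>\<^bsub>C\<^esub> u = g \<cdot>\<^bsub>C\<^esub> v"
  shows "\<exists>!h. h \<in> Hom C T P \<and> p \<cdot>\<^bsub>C\<^esub> h = u \<and> q \<cdot>\<^bsub>C\<^esub> h = v"
proof -
  have "Dom C f = A" "Dom C g = B" using assms(2,3) by (simp_all add: Hom_def)
  then show ?thesis using assms unfolding is_pullback_def by blast
qed

lemma pullback_Hom:
  assumes "is_pullback C f g P p q" "f \<in> Hom C A D" "g \<in> Hom C B D"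
  shows "p \<in> Hom C P A" "q \<in> Hom C P B" "f \<cdot>\<^bsub>C\<^esub> p = g \<cdot>\<^bsub>C\<^esub> q"
  using assms by (simp_all add: is_pullback_def Hom_def)

lemma coequalizer_ump:
  assumes "is_coequalizer C f g q" "f \<in> Hom C A B" "q \<in> Hom C B D"
    "h \<in> Hom C B X" "h \<cdot>\<^bsub>C\<^esub> f = h \<cdot>\<^bsub>C\<^esub> g"
  shows "\<exists>!k. k \<in> Hom C D X \<and> k \<cdot>\<^bsub>C\<^esub> q = h"
proof -
  have "Cod C f = B" "Cod C q = D" using assms(2,3) by (simp_all add: Hom_def)
  then show ?thesis using assms unfolding is_coequalizer_def by blast
qed

lemma coproduct_ump:
  assumes "is_coproduct C A B P i j" "f \<in> Hom C A X" "g \<in> Hom C B X"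
  shows "\<exists>!h. h \<in> Hom C P X \<and> h \<cdot>\<^bsub>C\<^esub> i = f \<and> h \<cdot>\<^bsub>C\<^esub> j = g"
  using assms unfolding is_coproduct_def by blast

lemma coproduct_Hom:
  assumes "is_coproduct C A B P i j"
  shows "i \<in> Hom C A P" "j \<in> Hom C B P"
  using assms unfolding is_coproduct_def by auto

section \<open>Regular epimorphisms, coproducts and finite covers\<close>

context category
begin

lemma coproduct_eqI:
  assumes "is_coproduct C A B P i j" "x \<in> Hom C P X" "y \<in> Hom C P X" "x \<cdot> i = y \<cdot> i" "x \<cdot> j = y \<cdot> j"
  shows "x = y"
proof -
  note ij = coproduct_Hom[OF assms(1)]
  have "\<exists>!h. h \<in> Hom C P X \<and> h \<cdot> i = x \<cdot> i \<and> h \<cdot> j = x \<cdot> j"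
    by (rule coproduct_ump[OF assms(1)]) (rule Comp_in_Hom[OF ij(1) assms(2)]
      Comp_in_Hom[OF ij(2) assms(2)])+
  then show ?thesis using assms by metis
qed

lemma regular_epi_cancel:
  assumes e: "is_regular_epi C e" "e \<in> Hom C S T"
      and xy: "x \<in> Hom C T X" "y \<in> Hom C T X" "x \<cdot> e = y \<cdot> e"
  shows "x = y"
proof -
  from e(1) obtain f g where c: "is_coequalizer C f g e" by (auto simp: is_regular_epi_def)
  then have fg: "f \<in> Hom C (Dom C f) S" "g \<in> Hom C (Dom C f) S" "e \<cdot> f = e \<cdot> g"
    using e(2) by (auto simp: is_coequalizer_def Hom_def)
  have "(x \<cdot> e) \<cdot> f = (x \<cdot> e) \<cdot> g"
    using fg Comp_assoc[OF fg(1) e(2) xy(1)] Comp_assoc[OF fg(2) e(2) xy(1)] by simp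
  from coequalizer_ump[OF c fg(1) e(2) Comp_in_Hom[OF e(2) xy(1)] this]
  show ?thesis using xy by metis
qed

text \<open>Regular epimorphisms are orthogonal to jointly monic pairs. The composites of
  \<open>z\<close> with both legs coequalize whatever \<open>e\<close> coequalizes, hence so does
  \<open>z\<close>, and it descends along \<open>e\<close>; the legs of the descended map are found
  by cancelling \<open>e\<close>.\<close>

lemma regular_epi_factor:
  assumes e: "is_regular_epi C e" "e \<in> Hom C S T"
    and R: "is_relation C X (R, r1, r2)"
    and xy: "x \<in> Hom C T X" "y \<in> Hom C T X"
    and z: "z \<in> Hom C S R" "r1 \<cdot> z = x \<cdot> e" "r2 \<cdot> z = y \<cdot> e"
  shows "\<exists>w\<in>Hom C T R. r1 \<cdot> w = x \<and> r2 \<cdot> w = y"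
proof -
  from e(1) obtain f g where c: "is_coequalizer C f g e" by (auto simp: is_regular_epi_def)
  then have fg: "f \<in> Hom C (Dom C f) S" "g \<in> Hom C (Dom C f) S" "e \<cdot> f = e \<cdot> g"
    using e(2) by (auto simp: is_coequalizer_def Hom_def)
  have r: "r1 \<in> Hom C R X" "r2 \<in> Hom C R X" using R by (auto simp: is_relation_def)
  have "r \<cdot> (z \<cdot> f) = r \<cdot> (z \<cdot> g)" if "r \<in> Hom C R X" "u \<in> Hom C T X" "r \<cdot> z = u \<cdot> e" for r u
    using Comp_assoc[OF fg(1) z(1) that(1)] Comp_assoc[OF fg(2) z(1) that(1)]
      Comp_assoc[OF fg(1) e(2) that(2)] Comp_assoc[OF fg(2) e(2) that(2)] that fg(3) by simp
  from this[OF r(1) xy(1) z(2)] this[OF r(2) xy(2) z(3)] have "z \<cdot> f = z \<cdot> g"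
    using R Comp_in_Hom[OF fg(1) z(1)] Comp_in_Hom[OF fg(2) z(1)] by (auto simp: is_relation_def)
  from coequalizer_ump[OF c fg(1) e(2) z(1) this] obtain w where
    w: "w \<in> Hom C T R" "w \<cdot> e = z" by auto
  have "r \<cdot> w = u" if "r \<in> Hom C R X" "u \<in> Hom C T X" "r \<cdot> z = u \<cdot> e" for r u
    using regular_epi_cancel[OF e Comp_in_Hom[OF w(1) that(1)] that(2)]
      Comp_assoc[OF e(2) w(1) that(1)] w(2) that(3) by simp
  from this[OF r(1) xy(1) z(2)] this[OF r(2) xy(2) z(3)] w(1) show ?thesis by blast
qed

text \<open>\<open>cov T P\<close> says that the generalized elements \<open>t\<close> of \<open>T\<close> satisfying \<open>P\<close> contain a finite
  family covering \<open>T\<close>: it is local truth in the internal language.\<close>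

inductive cov :: "'o \<Rightarrow> ('m \<Rightarrow> bool) \<Rightarrow> bool" where
  cov_ide: "T \<in> Ob C \<Longrightarrow> P (Ide C T) \<Longrightarrow> cov T P"
| cov_epi: "is_regular_epi C e \<Longrightarrow> e \<in> Hom C S T \<Longrightarrow> cov S (\<lambda>s. P (e \<cdot> s)) \<Longrightarrow> cov T P"
| cov_coproduct: "is_coproduct C S1 S2 T i j \<Longrightarrow> cov S1 (\<lambda>s. P (i \<cdot> s)) \<Longrightarrow> cov S2 (\<lambda>s. P (j \<cdot> s))
    \<Longrightarrow> cov T P"
| cov_initial: "is_initial C T \<Longrightarrow> cov T P"

lemma cov_mono:
  "cov T P \<Longrightarrow> (\<And>S t. t \<in> Hom C S T \<Longrightarrow> P t \<Longrightarrow> Q t) \<Longrightarrow> cov T Q"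
proof (induction T P arbitrary: Q rule: cov.induct)
  case (cov_ide T P)
  then show ?case using Id_in_Hom cov.cov_ide by blast
next
  case (cov_epi e S T P)
  show ?case
    by (rule cov.cov_epi[OF cov_epi(1,2)], rule cov_epi(4))
      (use cov_epi(5) Comp_in_Hom[OF _ cov_epi(2)] in blast)
next
  case (cov_coproduct S1 S2 T i j P)
  note ij = coproduct_Hom[OF cov_coproduct(1)]
  show ?case
    by (rule cov.cov_coproduct[OF cov_coproduct(1)]; rule cov_coproduct(4) cov_coproduct(5))
      (use cov_coproduct(6) Comp_in_Hom[OF _ ij(1)] Comp_in_Hom[OF _ ij(2)] in blast)+
next
  case (cov_initial T P)
  then show ?case by (blast intro: cov.cov_initial)
qed

text \<open>Covers compose: a statement that holds locally on the pieces of a cover holds locally.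
  With \<open>cov_mono\<close> this makes local truth usable as a modality.\<close>

lemma cov_bind:
  assumes "cov T P" "\<And>S t. t \<in> Hom C S T \<Longrightarrow> P t \<Longrightarrow> cov S (\<lambda>s. Q (t \<cdot> s))"
  shows "cov T Q"
  using assms
proof (induction T P arbitrary: Q rule: cov.induct)
  case (cov_ide T P)
  have "cov T (\<lambda>s. Q (Ide C T \<cdot> s))" using cov_ide Id_in_Hom by blast
  then show ?case by (rule cov_mono) (auto simp: Hom_def)
next
  case (cov_epi e S T P)
  show ?case
  proof (rule cov.cov_epi[OF cov_epi(1,2)], rule cov_epi(4))
    fix S' t assume t: "t \<in> Hom C S' S" "P (e \<cdot> t)"
    have "cov S' (\<lambda>s. Q ((e \<cdot> t) \<cdot> s))"
      by (rule cov_epi(5)[OF Comp_in_Hom[OF t(1) cov_epi(2)] t(2)])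
    then show "cov S' (\<lambda>s. Q (e \<cdot> (t \<cdot> s)))"
      by (rule cov_mono) (use Comp_assoc t cov_epi(2) in metis)
  qed
next
  case (cov_coproduct S1 S2 T i j P)
  have *: "cov S' (\<lambda>s. Q (k \<cdot> (t \<cdot> s)))"
    if t: "t \<in> Hom C S' S" "P (k \<cdot> t)" and k: "k \<in> Hom C S T" for S S' t k
  proof -
    have "cov S' (\<lambda>s. Q ((k \<cdot> t) \<cdot> s))"
      by (rule cov_coproduct(6)[OF Comp_in_Hom[OF t(1) k] t(2)])
    then show ?thesis by (rule cov_mono) (use Comp_assoc t k in metis)
  qed
  note ij = coproduct_Hom[OF cov_coproduct(1)]
  show ?case
    by (rule cov.cov_coproduct[OF cov_coproduct(1)]; rule cov_coproduct(4) cov_coproduct(5))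
      (use * ij in blast)+
next
  case (cov_initial T P)
  then show ?case by (blast intro: cov.cov_initial)
qed

text \<open>Descent for jointly monic pairs, one argument per kind of cover: orthogonality for a
  regular epimorphism, copairing for a coproduct, and existence and uniqueness of maps for an
  initial stage. The pair \<open>x\<close>, \<open>y\<close> is generalized because each step
  replaces it by its restriction to a piece.\<close>

lemma cov_factor:
  assumes "cov T P" and R: "is_relation C X (R, r1, r2)"
    and "x \<in> Hom C T X" "y \<in> Hom C T X"
    and "\<And>S t. t \<in> Hom C S T \<Longrightarrow> P t \<Longrightarrow> \<exists>z\<in>Hom C S R. r1 \<cdot> z = x \<cdot> t \<and> r2 \<cdot> z = y \<cdot> t"
  shows "\<exists>z\<in>Hom C T R. r1 \<cdot> z = x \<and> r2 \<cdot> z = y"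
  using assms(1,3,4,5)
proof (induction T P arbitrary: x y rule: cov.induct)
  case (cov_ide T P)
  then show ?case using Id_in_Hom[OF cov_ide(1)] Id_right by metis
next
  case (cov_epi e S T P)
  have "\<exists>z\<in>Hom C S R. r1 \<cdot> z = x \<cdot> e \<and> r2 \<cdot> z = y \<cdot> e"
  proof (rule cov_epi(4))
    fix S' t assume t: "t \<in> Hom C S' S" "P (e \<cdot> t)"
    show "\<exists>z\<in>Hom C S' R. r1 \<cdot> z = (x \<cdot> e) \<cdot> t \<and> r2 \<cdot> z = (y \<cdot> e) \<cdot> t"
      using cov_epi(7)[OF Comp_in_Hom[OF t(1) cov_epi(2)] t(2)]
        Comp_assoc[OF t(1) cov_epi(2) cov_epi(5)] Comp_assoc[OF t(1) cov_epi(2) cov_epi(6)]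
      by simp
  qed (rule Comp_in_Hom cov_epi)+
  then show ?case using regular_epi_factor[OF cov_epi(1,2) R cov_epi(5,6)] by blast
next
  case (cov_coproduct S1 S2 T i j P)
  note ij = coproduct_Hom[OF cov_coproduct(1)]
  have *: "\<exists>z\<in>Hom C S' R. r1 \<cdot> z = (x \<cdot> k) \<cdot> t \<and> r2 \<cdot> z = (y \<cdot> k) \<cdot> t"
    if t: "t \<in> Hom C S' S" "P (k \<cdot> t)" and k: "k \<in> Hom C S T" for S S' t k
    using cov_coproduct(8)[OF Comp_in_Hom[OF t(1) k] t(2)]
        Comp_assoc[OF t(1) k cov_coproduct(6)] Comp_assoc[OF t(1) k cov_coproduct(7)]
      by simp
  have "\<exists>z\<in>Hom C S1 R. r1 \<cdot> z = x \<cdot> i \<and> r2 \<cdot> z = y \<cdot> i"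
    by (rule cov_coproduct(4)) (use * ij Comp_in_Hom cov_coproduct(6,7) in blast)+
  then obtain z1 where z1: "z1 \<in> Hom C S1 R" "r1 \<cdot> z1 = x \<cdot> i" "r2 \<cdot> z1 = y \<cdot> i" by blast
  have "\<exists>z\<in>Hom C S2 R. r1 \<cdot> z = x \<cdot> j \<and> r2 \<cdot> z = y \<cdot> j"
    by (rule cov_coproduct(5)) (use * ij Comp_in_Hom cov_coproduct(6,7) in blast)+
  then obtain z2 where z2: "z2 \<in> Hom C S2 R" "r1 \<cdot> z2 = x \<cdot> j" "r2 \<cdot> z2 = y \<cdot> j" by blast
  obtain w where w: "w \<in> Hom C T R" "w \<cdot> i = z1" "w \<cdot> j = z2"
    using coproduct_ump[OF cov_coproduct(1) z1(1) z2(1)] by blast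
  have "r \<cdot> w = u" if "r \<in> Hom C R X" "u \<in> Hom C T X" "r \<cdot> z1 = u \<cdot> i" "r \<cdot> z2 = u \<cdot> j" for r u
  proof (rule coproduct_eqI[OF cov_coproduct(1) Comp_in_Hom[OF w(1) that(1)] that(2)])
    show "(r \<cdot> w) \<cdot> i = u \<cdot> i" "(r \<cdot> w) \<cdot> j = u \<cdot> j"
      using Comp_assoc[OF ij(1) w(1) that(1)] Comp_assoc[OF ij(2) w(1) that(1)] that(3,4) w(2,3)
      by simp_all
  qed
  moreover have "r1 \<in> Hom C R X" "r2 \<in> Hom C R X" using R by (auto simp: is_relation_def)
  ultimately show ?case using w(1) z1 z2 cov_coproduct(6,7) by blast
next
  case (cov_initial T P)
  have r: "r1 \<in> Hom C R X" "r2 \<in> Hom C R X" using R by (auto simp: is_relation_def)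
  have un: "\<exists>!f. f \<in> Hom C T A" if "A \<in> Ob C" for A
    using cov_initial(1) that by (auto simp: is_initial_def)
  have "R \<in> Ob C" "X \<in> Ob C" using Hom_Ob[OF r(1)] by auto
  from un[OF this(1)] obtain z where "z \<in> Hom C T R" by blast
  then show ?case using un[OF \<open>X \<in> Ob C\<close>] r Comp_in_Hom cov_initial(2,3) by blast
qed

lemma cov_factor_mono:
  assumes "cov T P" "is_mono C m" "m \<in> Hom C A B" "x \<in> Hom C T B"
    "\<And>S t. t \<in> Hom C S T \<Longrightarrow> P t \<Longrightarrow> \<exists>z\<in>Hom C S A. m \<cdot> z = x \<cdot> t"
  shows "\<exists>z\<in>Hom C T A. m \<cdot> z = x"
  using cov_factor[OF assms(1) mono_is_relation[OF assms(2,3)] assms(4,4)] assms(5) by auto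

text \<open>The instance of descent for the diagonal relation, whose legs are both the identity:
  factoring \<open>x\<close> and \<open>y\<close> through it is an equality.\<close>

lemma cov_eq:
  assumes "cov T P" "x \<in> Hom C T X" "y \<in> Hom C T X"
    "\<And>S t. t \<in> Hom C S T \<Longrightarrow> P t \<Longrightarrow> x \<cdot> t = y \<cdot> t"
  shows "x = y"
proof -
  have X: "X \<in> Ob C" using Hom_Ob assms(2) by blast
  note I = Id_in_Hom[OF X]
  have "is_relation C X (X, Ide C X, Ide C X)"
    using I Id_left by (auto simp: is_relation_def)
  moreover have "\<exists>z\<in>Hom C S X. Ide C X \<cdot> z = x \<cdot> t \<and> Ide C X \<cdot> z = y \<cdot> t"
    if "t \<in> Hom C S T" "P t" for S t
    using assms(4)[OF that] Comp_in_Hom[OF that(1) assms(2)] Id_left by auto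
  ultimately obtain z where "z \<in> Hom C T X" "Ide C X \<cdot> z = x" "Ide C X \<cdot> z = y"
    using cov_factor[OF assms(1) _ assms(2,3)] by blast
  then show ?thesis by simp
qed

end

section \<open>Lifting along regular epimorphisms and images\<close>

context regular_category
begin

sublocale complete_category
  using finitely_complete by unfold_locales

text \<open>Pullback stability makes the pullback of \<open>e\<close> along \<open>y\<close> a
  one-step cover of \<open>T\<close>, and the other projection is the lift.\<close>

lemma regular_epi_lift:
  assumes "is_regular_epi C e" "e \<in> Hom C X Y" "y \<in> Hom C T Y"
  shows "cov T (\<lambda>t. \<exists>x\<in>Hom C (Dom C t) X. e \<cdot> x = y \<cdot> t)"
proof -
  obtain P p q where pb: "is_pullback C y e P p q" using pullback_exists[OF assms(3,2)] by blast
  note pq = pullback_Hom[OF pb assms(3,2)]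
  have P: "P \<in> Ob C" using Hom_Ob[OF pq(1)] by blast
  show ?thesis
  proof (rule cov_epi[OF regular_epi_stable[OF assms(1) pb] pq(1)], rule cov_ide[OF P])
    show "\<exists>x\<in>Hom C (Dom C (p \<cdot> Ide C P)) X. e \<cdot> x = y \<cdot> (p \<cdot> Ide C P)"
      using pq by (auto simp: Id_right[OF pq(1)] Hom_def)
  qed
qed

text \<open>The regular epimorphism is the quotient by the kernel pair of \<open>f\<close>. For
  monicity of \<open>m\<close>, two elements with equal image are lifted to \<open>X\<close>, each
  on its own cover, hence the two nested covers. The lifts have equal value under \<open>f\<close>,
  so they form an element of the kernel pair, whose legs \<open>e\<close> coequalizes.\<close>

lemma image_factorization:
  assumes f: "f \<in> Hom C X Y"
  shows "\<exists>I e m. e \<in> Hom C X I \<and> is_regular_epi C e \<and> m \<in> Hom C I Y \<and> is_mono C m \<and> m \<cdot> e = f"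
proof -
  obtain K k1 k2 where K: "is_pullback C f f K k1 k2" using pullback_exists[OF f f] by blast
  note k = pullback_Hom[OF K f f]
  obtain e where e: "is_coequalizer C k1 k2 e"
    using kernel_pair_coequalizer K unfolding is_kernel_pair_def by blast
  define I where "I = Cod C e"
  have eH: "e \<in> Hom C X I" "e \<cdot> k1 = e \<cdot> k2"
    using e k by (auto simp: is_coequalizer_def I_def Hom_def)
  obtain m where m: "m \<in> Hom C I Y" "m \<cdot> e = f"
    using coequalizer_ump[OF e k(1) eH(1) f k(3)] by blast
  have re: "is_regular_epi C e" using e by (auto simp: is_regular_epi_def)
  have "is_mono C m"
  proof (rule is_monoI[OF m(1)])
    fix T x y assume x: "x \<in> Hom C T I" and y: "y \<in> Hom C T I" and xy: "m \<cdot> x = m \<cdot> y"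
    have fe: "f \<cdot> x' = m \<cdot> (e \<cdot> x')" if "x' \<in> Hom C S X" for x' S
      using Comp_assoc[OF that eH(1) m(1)] m(2) by simp
    show "x = y"
    proof (rule cov_eq[OF regular_epi_lift[OF re eH(1) x] x y])
      fix S t assume t: "t \<in> Hom C S T" and "\<exists>x'\<in>Hom C (Dom C t) X. e \<cdot> x' = x \<cdot> t"
      then obtain x' where x': "x' \<in> Hom C S X" "e \<cdot> x' = x \<cdot> t" by (auto simp: Hom_def)
      note yt = Comp_in_Hom[OF t y] and xt = Comp_in_Hom[OF t x]
      show "x \<cdot> t = y \<cdot> t"
      proof (rule cov_eq[OF regular_epi_lift[OF re eH(1) yt] xt yt])
        fix S' s assume s: "s \<in> Hom C S' S" and "\<exists>y'\<in>Hom C (Dom C s) X. e \<cdot> y' = y \<cdot> t \<cdot> s"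
        then obtain y' where y': "y' \<in> Hom C S' X" "e \<cdot> y' = (y \<cdot> t) \<cdot> s" by (auto simp: Hom_def)
        have x's: "x' \<cdot> s \<in> Hom C S' X" "e \<cdot> (x' \<cdot> s) = (x \<cdot> t) \<cdot> s"
          using Comp_in_Hom[OF s x'(1)] Comp_assoc[OF s x'(1) eH(1)] x'(2) by simp_all
        have "m \<cdot> (x \<cdot> t) = m \<cdot> (y \<cdot> t)"
          using Comp_assoc[OF t x m(1)] Comp_assoc[OF t y m(1)] xy by simp
        then have "m \<cdot> ((x \<cdot> t) \<cdot> s) = m \<cdot> ((y \<cdot> t) \<cdot> s)"
          using Comp_assoc[OF s xt m(1)] Comp_assoc[OF s yt m(1)] by simp
        then have "f \<cdot> (x' \<cdot> s) = f \<cdot> y'" using fe[OF x's(1)] fe[OF y'(1)] x's(2) y'(2) by simp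
        from pullback_ump[OF K f f x's(1) y'(1) this] obtain k where
          k': "k \<in> Hom C S' K" "k1 \<cdot> k = x' \<cdot> s" "k2 \<cdot> k = y'" by blast
        have "e \<cdot> (x' \<cdot> s) = e \<cdot> y'"
          using Comp_assoc[OF k'(1) k(1) eH(1)] Comp_assoc[OF k'(1) k(2) eH(1)] k'(2,3) eH(2)
            by simp
        then show "(x \<cdot> t) \<cdot> s = (y \<cdot> t) \<cdot> s" using x's y' by simp
      qed
    qed
  qed
  with eH(1) re m show ?thesis by blast
qed

text \<open>The image of the pairing into \<open>Y \<times> Y\<close>, rewritten as a jointly monic
  pair so that the product disappears from later arguments.\<close>

lemma relation_image:
  assumes s: "s1 \<in> Hom C S Y" "s2 \<in> Hom C S Y"
  shows "\<exists>R e r1 r2. is_relation C Y (R, r1, r2) \<and> e \<in> Hom C S R \<and> is_regular_epi C e \<and>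
    r1 \<cdot> e = s1 \<and> r2 \<cdot> e = s2"
proof -
  have Y: "Y \<in> Ob C" using Hom_Ob[OF s(1)] by blast
  obtain P p q where P: "is_coproduct (op_cat C) Y Y P p q" using product_exists[OF Y Y] by blast
  have pq: "p \<in> Hom C P Y" "q \<in> Hom C P Y" using coproduct_Hom[OF P] by simp_all
  obtain f where f: "f \<in> Hom C S P" "p \<cdot> f = s1" "q \<cdot> f = s2"
    using coproduct_ump[OF P, of s1 S s2] s by auto
  obtain R e m where e: "e \<in> Hom C S R" "is_regular_epi C e" and m: "m \<in> Hom C R P" "is_mono C m"
    and me: "m \<cdot> e = f"
    using image_factorization[OF f(1)] by blast
  have "is_relation C Y (R, p \<cdot> m, q \<cdot> m)"
    unfolding is_relation_def prod.case
  proof (intro conjI allI ballI impI)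
    fix T u v assume u: "u \<in> Hom C T R" and v: "v \<in> Hom C T R"
      and "p \<cdot> m \<cdot> u = p \<cdot> m \<cdot> v \<and> q \<cdot> m \<cdot> u = q \<cdot> m \<cdot> v"
    then have "p \<cdot> (m \<cdot> u) = p \<cdot> (m \<cdot> v)" "q \<cdot> (m \<cdot> u) = q \<cdot> (m \<cdot> v)"
      using Comp_assoc[OF u m(1) pq(1)] Comp_assoc[OF u m(1) pq(2)]
        Comp_assoc[OF v m(1) pq(1)] Comp_assoc[OF v m(1) pq(2)] by auto
    then have "m \<cdot> u = m \<cdot> v"
      using category.coproduct_eqI[OF category_op_cat P, of "m \<cdot> u" T "m \<cdot> v"]
        Comp_in_Hom[OF u m(1)] Comp_in_Hom[OF v m(1)] by simp
    then show "u = v" using mono_cancel[OF m(2,1) u v] by blast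
  qed (rule Comp_in_Hom[OF m(1) pq(1)] Comp_in_Hom[OF m(1) pq(2)])+
  moreover have "p \<cdot> m \<cdot> e = s1" "q \<cdot> m \<cdot> e = s2"
    using Comp_assoc[OF e(1) m(1) pq(1)] Comp_assoc[OF e(1) m(1) pq(2)] me f by simp_all
  ultimately show ?thesis using e by blast
qed

end

section \<open>Equivalences and extensivity\<close>

lemma Hom_structured_cat:
  "Hom (structured_cat C K U H) x y =
    {(x, u, y) |u. x \<in> K \<and> y \<in> K \<and> u \<in> Hom C (U x) (U y) \<and> H x u y}"
  unfolding Hom_def[of "structured_cat C K U H"] by (auto simp: structured_cat_def)

lemma structured_cat_simps:
  "Ob (structured_cat C K U H) = K"
  "Ide (structured_cat C K U H) x = (x, Ide C (U x), x)"
  "(y', v, z) \<cdot>\<^bsub>structured_cat C K U H\<^esub> (x, u, y) = (x, v \<cdot>\<^bsub>C\<^esub> u, z)"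
  by (simp_all add: structured_cat_def)

lemma (in category) category_structured_cat:
  assumes U: "\<And>x. x \<in> K \<Longrightarrow> U x \<in> Ob C"
    and ide: "\<And>x. x \<in> K \<Longrightarrow> H x (Ide C (U x)) x"
    and comp: "\<And>x y z u v. x \<in> K \<Longrightarrow> y \<in> K \<Longrightarrow> z \<in> K \<Longrightarrow> u \<in> Hom C (U x) (U y)
      \<Longrightarrow> v \<in> Hom C (U y) (U z) \<Longrightarrow> H x u y \<Longrightarrow> H y v z \<Longrightarrow> H x (v \<cdot> u) z"
  shows "category (structured_cat C K U H)"
proof
  fix f assume f: "f \<in> Ar (structured_cat C K U H)"
  then show "Dom (structured_cat C K U H) f \<in> Ob (structured_cat C K U H)"
    "Cod (structured_cat C K U H) f \<in> Ob (structured_cat C K U H)"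
    by (auto simp: structured_cat_def)
next
  fix f g x y z
  assume "f \<in> Hom (structured_cat C K U H) x y" "g \<in> Hom (structured_cat C K U H) y z"
  then show "g \<cdot>\<^bsub>structured_cat C K U H\<^esub> f \<in> Hom (structured_cat C K U H) x z"
    unfolding Hom_structured_cat by (auto simp: structured_cat_simps Comp_in_Hom comp)
next
  fix f g h x y z w
  assume "f \<in> Hom (structured_cat C K U H) x y" "g \<in> Hom (structured_cat C K U H) y z"
    "h \<in> Hom (structured_cat C K U H) z w"
  then show "h \<cdot>\<^bsub>structured_cat C K U H\<^esub> (g \<cdot>\<^bsub>structured_cat C K U H\<^esub> f) =
    (h \<cdot>\<^bsub>structured_cat C K U H\<^esub> g) \<cdot>\<^bsub>structured_cat C K U H\<^esub> f"
    unfolding Hom_structured_cat by (auto simp: structured_cat_simps Comp_assoc)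
qed (auto simp: Hom_structured_cat structured_cat_simps U ide Id_in_Hom Id_left Id_right)

lemma (in category) category_slice: "category (slice C A)"
  unfolding slice_def
proof (rule category_structured_cat)
  fix x y z u v
  assume "u \<in> Hom C (fst x) (fst y)" "v \<in> Hom C (fst y) (fst z)" "z \<in> {(X, f). f \<in> Hom C X A}"
    "(case x of (X, f) \<Rightarrow> \<lambda>u (Y, g). g \<cdot> u = f) u y" "(case y of (X, f) \<Rightarrow> \<lambda>u (Y, g). g \<cdot> u = f) v z"
  then show "(case x of (X, f) \<Rightarrow> \<lambda>u (Y, g). g \<cdot> u = f) (v \<cdot> u) z"
    using Comp_assoc[of u "fst x" "fst y" v "fst z" "snd z" A] by (simp add: split_beta)
next
  fix x assume "x \<in> {(X, f). f \<in> Hom C X A}"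
  then have "snd x \<in> Hom C (fst x) A" by auto
  then show "fst x \<in> Ob C" "(case x of (X, f) \<Rightarrow> \<lambda>u (Y, g). g \<cdot> u = f) (Ide C (fst x)) x"
    using Hom_Ob[of "snd x"] Id_right[of "snd x"] by (simp_all add: split_beta)
qed

lemma Hom_prod_cat: "Hom (prod_cat C D) (A, B) (A', B') = Hom C A A' \<times> Hom D B B'"
  by (auto simp: Hom_def prod_cat_def)

lemma category_prod_cat:
  assumes "category C" "category D"
  shows "category (prod_cat C D)"
proof -
  interpret C: category C by fact
  interpret D: category D by fact
  have Hom: "f \<in> Hom (prod_cat C D) X Y \<longleftrightarrow>
      fst f \<in> Hom C (fst X) (fst Y) \<and> snd f \<in> Hom D (snd X) (snd Y)" for f X Y
    by (cases f; cases X; cases Y) (simp add: Hom_prod_cat)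
  have sel: "Ob (prod_cat C D) = Ob C \<times> Ob D" "Ar (prod_cat C D) = Ar C \<times> Ar D"
    "Dom (prod_cat C D) f = (Dom C (fst f), Dom D (snd f))"
    "Cod (prod_cat C D) f = (Cod C (fst f), Cod D (snd f))"
    "Ide (prod_cat C D) A = (Ide C (fst A), Ide D (snd A))"
    "f \<cdot>\<^bsub>prod_cat C D\<^esub> g = (fst f \<cdot>\<^bsub>C\<^esub> fst g, snd f \<cdot>\<^bsub>D\<^esub> snd g)" for f g A
    by (simp_all add: prod_cat_def map_prod_def split_beta)
  show ?thesis
  proof
    fix f g h X Y Z W
    assume "f \<in> Hom (prod_cat C D) X Y" "g \<in> Hom (prod_cat C D) Y Z" "h \<in> Hom (prod_cat C D) Z W"
    then show "h \<cdot>\<^bsub>prod_cat C D\<^esub> (g \<cdot>\<^bsub>prod_cat C D\<^esub> f) =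
      (h \<cdot>\<^bsub>prod_cat C D\<^esub> g) \<cdot>\<^bsub>prod_cat C D\<^esub> f"
      unfolding sel Hom prod.inject fst_conv snd_conv by (blast intro: C.Comp_assoc D.Comp_assoc)
  next
    fix f g X Y Z
    assume "f \<in> Hom (prod_cat C D) X Y" "g \<in> Hom (prod_cat C D) Y Z"
    then show "g \<cdot>\<^bsub>prod_cat C D\<^esub> f \<in> Hom (prod_cat C D) X Z"
      unfolding sel Hom fst_conv snd_conv by (blast intro: C.Comp_in_Hom D.Comp_in_Hom)
  next
    fix f X Y assume "f \<in> Hom (prod_cat C D) X Y"
    then show "Ide (prod_cat C D) Y \<cdot>\<^bsub>prod_cat C D\<^esub> f = f"
      "f \<cdot>\<^bsub>prod_cat C D\<^esub> Ide (prod_cat C D) X = f"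
      unfolding sel Hom by (auto simp: prod_eq_iff intro: C.Id_left D.Id_left C.Id_right D.Id_right)
  qed (auto simp: sel Hom C.Dom_in_Ob D.Dom_in_Ob C.Cod_in_Ob D.Cod_in_Ob C.Id_in_Hom D.Id_in_Hom)
qed

section \<open>Isomorphisms and equivalences of categories\<close>

context category
begin

lemma iso_inverse:
  assumes "is_iso C h" "h \<in> Hom C A B"
  shows "\<exists>k\<in>Hom C B A. k \<cdot> h = Ide C A \<and> h \<cdot> k = Ide C B"
  using assms by (auto simp: is_iso_def Hom_def)

lemma left_inverse_cancel:
  assumes "k \<cdot> h = Ide C A" "h \<in> Hom C A B" "k \<in> Hom C B A" "x \<in> Hom C T A" "y \<in> Hom C T A"
    "h \<cdot> x = h \<cdot> y"
  shows "x = y"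
proof -
  have "x = k \<cdot> (h \<cdot> x)" using Comp_assoc[OF assms(4,2,3)] assms(1) Id_left[OF assms(4)] by simp
  also have "\<dots> = k \<cdot> (h \<cdot> y)" using assms(6) by simp
  also have "\<dots> = y" using Comp_assoc[OF assms(5,2,3)] assms(1) Id_left[OF assms(5)] by simp
  finally show ?thesis .
qed

lemma right_inverse_cancel:
  assumes "h \<cdot> k = Ide C B" "h \<in> Hom C A B" "k \<in> Hom C B A" "x \<in> Hom C B X" "y \<in> Hom C B X"
    "x \<cdot> h = y \<cdot> h"
  shows "x = y"
proof -
  have "x = (x \<cdot> h) \<cdot> k" using Comp_assoc[OF assms(3,2,4)] assms(1) Id_right[OF assms(4)] by simp
  also have "\<dots> = (y \<cdot> h) \<cdot> k" using assms(6) by simp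
  also have "\<dots> = y" using Comp_assoc[OF assms(3,2,5)] assms(1) Id_right[OF assms(5)] by simp
  finally show ?thesis .
qed

end

text \<open>The preimage is \<open>FAr G g\<close> conjugated by \<eta>. Since \<eta> and \<epsilon>
  are not linked by triangle identities, \<eta> only shows that \<open>FAr F f\<close> and
  \<open>g\<close> agree after applying \<open>G\<close>; naturality of \<epsilon>, which makes
  \<open>G\<close> faithful, then removes \<open>G\<close>.\<close>

lemma equivalence_full:
  assumes "category C" "category D" "is_equivalence C D F"
    and AB: "A \<in> Ob C" "B \<in> Ob C" and g: "g \<in> Hom D (FOb F A) (FOb F B)"
  shows "\<exists>f\<in>Hom C A B. FAr F f = g"
proof -
  interpret C: category C by fact
  interpret D: category D by fact
  from assms(3) obtain G \<eta> \<epsilon> where F: "is_functor C D F" and G: "is_functor D C G"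
    and \<eta>: "is_nat_iso C C id_functor (comp_functor G F) \<eta>"
    and \<epsilon>: "is_nat_iso D D (comp_functor F G) id_functor \<epsilon>"
    by (auto simp: is_equivalence_def)
  have \<eta>H: "\<eta> X \<in> Hom C X (FOb G (FOb F X))" "is_iso C (\<eta> X)" if "X \<in> Ob C" for X
    using \<eta> that by (auto simp: is_nat_iso_def id_functor_def comp_functor_def)
  have \<eta>N: "\<eta> Y \<cdot>\<^bsub>C\<^esub> f = FAr G (FAr F f) \<cdot>\<^bsub>C\<^esub> \<eta> X" if "f \<in> Hom C X Y" for f X Y
    using \<eta> that by (auto simp: is_nat_iso_def id_functor_def comp_functor_def Hom_def)
  have \<epsilon>H: "\<epsilon> X \<in> Hom D (FOb F (FOb G X)) X" "is_iso D (\<epsilon> X)" if "X \<in> Ob D" for X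
    using \<epsilon> that by (auto simp: is_nat_iso_def id_functor_def comp_functor_def)
  have \<epsilon>N: "\<epsilon> Y \<cdot>\<^bsub>D\<^esub> FAr F (FAr G f) = f \<cdot>\<^bsub>D\<^esub> \<epsilon> X" if "f \<in> Hom D X Y" for f X Y
    using \<epsilon> that by (auto simp: is_nat_iso_def id_functor_def comp_functor_def Hom_def)
  have FH: "FAr F f \<in> Hom D (FOb F X) (FOb F Y)" if "f \<in> Hom C X Y" for f X Y
    using F that by (auto simp: is_functor_def Hom_def)
  have GH: "FAr G f \<in> Hom C (FOb G X) (FOb G Y)" if "f \<in> Hom D X Y" for f X Y
    using G that by (auto simp: is_functor_def Hom_def)
  obtain k where k: "k \<in> Hom C (FOb G (FOb F B)) B" "\<eta> B \<cdot>\<^bsub>C\<^esub> k = Ide C (FOb G (FOb F B))"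
    using C.iso_inverse[OF \<eta>H(2,1)[OF AB(2)]] by blast
  define f where "f = k \<cdot>\<^bsub>C\<^esub> (FAr G g \<cdot>\<^bsub>C\<^esub> \<eta> A)"
  have Gg\<eta>: "FAr G g \<cdot>\<^bsub>C\<^esub> \<eta> A \<in> Hom C A (FOb G (FOb F B))"
    by (rule C.Comp_in_Hom[OF \<eta>H(1)[OF AB(1)] GH[OF g]])
  have f: "f \<in> Hom C A B" unfolding f_def by (rule C.Comp_in_Hom[OF Gg\<eta> k(1)])
  have "\<eta> B \<cdot>\<^bsub>C\<^esub> f = FAr G g \<cdot>\<^bsub>C\<^esub> \<eta> A"
    unfolding f_def using C.Comp_assoc[OF Gg\<eta> k(1) \<eta>H(1)[OF AB(2)]] k(2) C.Id_left[OF Gg\<eta>] by simp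
  then have "FAr G (FAr F f) \<cdot>\<^bsub>C\<^esub> \<eta> A = FAr G g \<cdot>\<^bsub>C\<^esub> \<eta> A" using \<eta>N[OF f] by simp
  moreover obtain l where "l \<in> Hom C (FOb G (FOb F A)) A" "\<eta> A \<cdot>\<^bsub>C\<^esub> l = Ide C (FOb G (FOb F A))"
    using C.iso_inverse[OF \<eta>H(2,1)[OF AB(1)]] by blast
  ultimately have "FAr G (FAr F f) = FAr G g"
    using C.right_inverse_cancel \<eta>H(1)[OF AB(1)] GH[OF FH[OF f]] GH[OF g] by blast
  then have "FAr F f \<cdot>\<^bsub>D\<^esub> \<epsilon> (FOb F A) = g \<cdot>\<^bsub>D\<^esub> \<epsilon> (FOb F A)"
    using \<epsilon>N[OF FH[OF f]] \<epsilon>N[OF g] by simp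
  moreover have FA: "FOb F A \<in> Ob D" using D.Hom_Ob[OF g] by blast
  moreover obtain l where "l \<in> Hom D (FOb F A) (FOb F (FOb G (FOb F A)))"
    "\<epsilon> (FOb F A) \<cdot>\<^bsub>D\<^esub> l = Ide D (FOb F A)"
    using D.iso_inverse[OF \<epsilon>H(2,1)[OF FA]] by blast
  ultimately have "FAr F f = g"
    using D.right_inverse_cancel \<epsilon>H(1)[OF FA] FH[OF f] g by blast
  with f show ?thesis by blast
qed

lemma equivalence_essentially_surjective:
  assumes "is_equivalence C D F" "Y \<in> Ob D"
  shows "\<exists>X\<in>Ob C. \<exists>h\<in>Hom D (FOb F X) Y. is_iso D h"
proof -
  from assms(1) obtain G \<epsilon> where G: "is_functor D C G"
    and \<epsilon>: "is_nat_iso D D (comp_functor F G) id_functor \<epsilon>"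
    by (auto simp: is_equivalence_def)
  have "FOb G Y \<in> Ob C" using G assms(2) by (auto simp: is_functor_def)
  moreover have "\<epsilon> Y \<in> Hom D (FOb F (FOb G Y)) Y" "is_iso D (\<epsilon> Y)"
    using \<epsilon> assms(2) by (auto simp: is_nat_iso_def id_functor_def comp_functor_def)
  ultimately show ?thesis by blast
qed

section \<open>Binary coproducts in an extensive category\<close>

locale cocomplete_pretopos = pretopos +
  assumes cocomplete: "finitely_cocomplete C"
begin

lemma complete_category_op_cat: "complete_category (op_cat C)"
  using category_op_cat finitely_complete_op_cat[OF cocomplete]
  by (simp add: complete_category_def complete_category_axioms_def)

text \<open>The injections belong to the very coproduct chosen by \<open>coprod\<close>, because
  extensivity speaks about the functor built from that choice.\<close>

definition inl :: "'a \<Rightarrow> 'a \<Rightarrow> 'b" where "inl A B = fst (snd (coprod C A B))"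
definition inr :: "'a \<Rightarrow> 'a \<Rightarrow> 'b" where "inr A B = snd (snd (coprod C A B))"

lemma coprod_eq: "coprod C A B = (coprod_ob C A B, inl A B, inr A B)"
  by (simp add: inl_def inr_def coprod_ob_def split: prod.splits)

lemma is_coproduct_coprod:
  assumes "A \<in> Ob C" "B \<in> Ob C"
  shows "is_coproduct C A B (coprod_ob C A B) (inl A B) (inr A B)"
proof -
  have "\<exists>P i j. is_coproduct C A B P i j"
    using complete_category.product_exists[OF complete_category_op_cat] assms by simp
  then have "\<exists>x. case x of (P, i, j) \<Rightarrow> is_coproduct C A B P i j" by auto
  from someI_ex[OF this] show ?thesis
    using coprod_eq[of A B] by (simp add: coprod_def)
qed

lemma inl_Hom: "A \<in> Ob C \<Longrightarrow> B \<in> Ob C \<Longrightarrow> inl A B \<in> Hom C A (coprod_ob C A B)"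
  and inr_Hom: "A \<in> Ob C \<Longrightarrow> B \<in> Ob C \<Longrightarrow> inr A B \<in> Hom C B (coprod_ob C A B)"
  by (rule coproduct_Hom[OF is_coproduct_coprod]; assumption)+

lemma coprod_Ob: "A \<in> Ob C \<Longrightarrow> B \<in> Ob C \<Longrightarrow> coprod_ob C A B \<in> Ob C"
  using Hom_Ob[OF inl_Hom] by blast

lemma coprod_copair:
  assumes "f \<in> Hom C A X" "g \<in> Hom C B X"
  shows "\<exists>h\<in>Hom C (coprod_ob C A B) X. h \<cdot> inl A B = f \<and> h \<cdot> inr A B = g"
proof -
  have "A \<in> Ob C" "B \<in> Ob C" using Hom_Ob assms by auto
  from coproduct_ump[OF is_coproduct_coprod[OF this] assms] show ?thesis by blast
qed

lemma coprod_eqI: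
  assumes "x \<in> Hom C (coprod_ob C A B) X" "y \<in> Hom C (coprod_ob C A B) X"
    "x \<cdot> inl A B = y \<cdot> inl A B" "x \<cdot> inr A B = y \<cdot> inr A B" "A \<in> Ob C" "B \<in> Ob C"
  shows "x = y"
  by (rule coproduct_eqI[OF is_coproduct_coprod[OF assms(5,6)] assms(1-4)])

lemma coprod_ar:
  assumes f: "f \<in> Hom C A A'" and g: "g \<in> Hom C B B'"
  shows "coprod_ar C f g \<in> Hom C (coprod_ob C A B) (coprod_ob C A' B')"
    and "coprod_ar C f g \<cdot> inl A B = inl A' B' \<cdot> f"
    and "coprod_ar C f g \<cdot> inr A B = inr A' B' \<cdot> g"
proof -
  have Ob: "A \<in> Ob C" "A' \<in> Ob C" "B \<in> Ob C" "B' \<in> Ob C" using Hom_Ob f g by auto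
  have "Dom C f = A" "Cod C f = A'" "Dom C g = B" "Cod C g = B'" using f g by (auto simp: Hom_def)
  then have eq: "coprod_ar C f g = (THE h. h \<in> Hom C (coprod_ob C A B) (coprod_ob C A' B') \<and>
    h \<cdot> inl A B = inl A' B' \<cdot> f \<and> h \<cdot> inr A B = inr A' B' \<cdot> g)"
    by (simp add: coprod_ar_def coprod_eq)
  have "\<exists>!h. h \<in> Hom C (coprod_ob C A B) (coprod_ob C A' B') \<and>
    h \<cdot> inl A B = inl A' B' \<cdot> f \<and> h \<cdot> inr A B = inr A' B' \<cdot> g"
    by (rule coproduct_ump[OF is_coproduct_coprod])
      (use Ob f g inl_Hom inr_Hom Comp_in_Hom in blast)+
  from theI'[OF this] show "coprod_ar C f g \<in> Hom C (coprod_ob C A B) (coprod_ob C A' B')"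
    "coprod_ar C f g \<cdot> inl A B = inl A' B' \<cdot> f" "coprod_ar C f g \<cdot> inr A B = inr A' B' \<cdot> g"
    unfolding eq by blast+
qed

lemma Hom_slice:
  "Hom (slice C A) (X, f) (Y, g) =
    {((X, f), u, (Y, g)) |u. f \<in> Hom C X A \<and> g \<in> Hom C Y A \<and> u \<in> Hom C X Y \<and> g \<cdot> u = f}"
  unfolding slice_def Hom_structured_cat by auto

lemma Ob_slice: "Ob (slice C A) = {(X, f). f \<in> Hom C X A}"
  by (simp add: slice_def structured_cat_def)

text \<open>Fullness of the coproduct functor, unwound: a map between sums over
  \<open>coprod_ob C A B\<close> is itself a sum. Disjointness and monicity of the injections are
  both extracted from this.\<close>

lemma coprod_full:
  assumes x: "x \<in> Hom C X A" "y \<in> Hom C Y B" and x': "x' \<in> Hom C X' A" "y' \<in> Hom C Y' B"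
    and w: "w \<in> Hom C (coprod_ob C X Y) (coprod_ob C X' Y')"
        "coprod_ar C x' y' \<cdot> w = coprod_ar C x y"
  shows "\<exists>u\<in>Hom C X X'. \<exists>v\<in>Hom C Y Y'. x' \<cdot> u = x \<and> y' \<cdot> v = y \<and> coprod_ar C u v = w"
proof -
  have AB: "A \<in> Ob C" "B \<in> Ob C" using x Hom_Ob by auto
  let ?S = "prod_cat (slice C A) (slice C B)" and ?U = "((X, x), (Y, y))"
      and ?V = "((X', x'), (Y', y'))"
  have F: "FOb (coprod_functor C) ((Z, z), (W, w)) = (coprod_ob C Z W, coprod_ar C z w)" for Z z W w
    by (simp add: coprod_functor_def coprod_slice_ob_def)
  have "\<exists>f\<in>Hom ?S ?U ?V. FAr (coprod_functor C) f =
      ((coprod_ob C X Y, coprod_ar C x y), w, (coprod_ob C X' Y', coprod_ar C x' y'))"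
  proof (rule equivalence_full[OF category_prod_cat[OF category_slice category_slice] category_slice
        coprod_equivalence[OF AB]])
    show "?U \<in> Ob ?S" "?V \<in> Ob ?S" using x x' by (simp_all add: prod_cat_def Ob_slice)
    show "((coprod_ob C X Y, coprod_ar C x y), w, (coprod_ob C X' Y', coprod_ar C x' y')) \<in>
      Hom (slice C (coprod_ob C A B)) (FOb (coprod_functor C) ?U) (FOb (coprod_functor C) ?V)"
      using w coprod_ar(1)[OF x] coprod_ar(1)[OF x'] by (simp add: F Hom_slice)
  qed
  then show ?thesis by (auto simp: Hom_prod_cat Hom_slice coprod_functor_def)
qed

lemma coproduct_iso:
  assumes cp: "is_coproduct C A B P i j" and h: "h \<in> Hom C P Q" "k \<in> Hom C Q P"
    "k \<cdot> h = Ide C P" "h \<cdot> k = Ide C Q"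
  shows "is_coproduct C A B Q (h \<cdot> i) (h \<cdot> j)"
  unfolding is_coproduct_def
proof (intro conjI allI ballI)
  note ij = coproduct_Hom[OF cp]
  show "h \<cdot> i \<in> Hom C A Q" "h \<cdot> j \<in> Hom C B Q"
    by (rule Comp_in_Hom[OF ij(1) h(1)] Comp_in_Hom[OF ij(2) h(1)])+
  fix X f g assume f: "f \<in> Hom C A X" and g: "g \<in> Hom C B X"
  obtain l where l: "l \<in> Hom C P X" "l \<cdot> i = f" "l \<cdot> j = g"
    using coproduct_ump[OF cp f g] by blast
  have lk: "l \<cdot> k \<in> Hom C Q X" by (rule Comp_in_Hom[OF h(2) l(1)])
  have khi: "k \<cdot> (h \<cdot> z) = z" if "z \<in> Hom C Z P" for z Z
    using Comp_assoc[OF that h(1,2)] h(3) Id_left[OF that] by simp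
  have lkh: "(l \<cdot> k) \<cdot> (h \<cdot> z) = l \<cdot> z" if "z \<in> Hom C Z P" for z Z
    using Comp_assoc[OF Comp_in_Hom[OF that h(1)] h(2) l(1)] khi[OF that] by simp
  show "\<exists>!m. m \<in> Hom C Q X \<and> m \<cdot> (h \<cdot> i) = f \<and> m \<cdot> (h \<cdot> j) = g"
  proof (rule ex1I[of _ "l \<cdot> k"])
    show "l \<cdot> k \<in> Hom C Q X \<and> (l \<cdot> k) \<cdot> (h \<cdot> i) = f \<and> (l \<cdot> k) \<cdot> (h \<cdot> j) = g"
      using lk lkh[OF ij(1)] lkh[OF ij(2)] l by simp
    fix m assume m: "m \<in> Hom C Q X \<and> m \<cdot> (h \<cdot> i) = f \<and> m \<cdot> (h \<cdot> j) = g"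
    then have mH: "m \<in> Hom C Q X" by blast
    have "m \<cdot> h = l"
      by (rule coproduct_eqI[OF cp Comp_in_Hom[OF h(1) mH] l(1)])
        (use m l Comp_assoc[OF ij(1) h(1) mH] Comp_assoc[OF ij(2) h(1) mH] in simp_all)
    then show "m = l \<cdot> k" using Comp_assoc[OF h(2,1) mH] h(4) Id_right[OF mH] by simp
  qed
qed

text \<open>Essential surjectivity, applied to \<open>t\<close> as an object of the slice. It
  presents \<open>T\<close> only up to isomorphism as a sum, and the coproduct structure is
  transported along that isomorphism.\<close>

lemma coprod_decompose:
  assumes AB: "A \<in> Ob C" "B \<in> Ob C" and t: "t \<in> Hom C T (coprod_ob C A B)"
  shows "\<exists>T1 T2 k1 k2. is_coproduct C T1 T2 T k1 k2 \<and>
    (\<exists>a\<in>Hom C T1 A. t \<cdot> k1 = inl A B \<cdot> a) \<and> (\<exists>b\<in>Hom C T2 B. t \<cdot> k2 = inr A B \<cdot> b)"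
proof -
  have "(T, t) \<in> Ob (slice C (coprod_ob C A B))" using t by (simp add: Ob_slice)
  from equivalence_essentially_surjective[OF coprod_equivalence[OF AB] this]
  obtain T1 a T2 b h where a: "a \<in> Hom C T1 A" and b: "b \<in> Hom C T2 B"
    and h: "h \<in> Hom (slice C (coprod_ob C A B)) (coprod_ob C T1 T2, coprod_ar C a b) (T, t)"
      "is_iso (slice C (coprod_ob C A B)) h"
    by (auto simp: prod_cat_def Ob_slice coprod_functor_def coprod_slice_ob_def)
  obtain u where u: "h = ((coprod_ob C T1 T2, coprod_ar C a b), u, (T, t))"
    "u \<in> Hom C (coprod_ob C T1 T2) T" "t \<cdot> u = coprod_ar C a b"
    using h(1) by (auto simp: Hom_slice)
  obtain h' where h': "h' \<in> Hom (slice C (coprod_ob C A B)) (T, t) (coprod_ob C T1 T2, coprod_ar C a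
      b)"
    "h' \<cdot>\<^bsub>slice C (coprod_ob C A B)\<^esub> h = Ide (slice C (coprod_ob C A B)) (coprod_ob C T1 T2,
        coprod_ar C a b)"
    "h \<cdot>\<^bsub>slice C (coprod_ob C A B)\<^esub> h' = Ide (slice C (coprod_ob C A B)) (T, t)"
    using category.iso_inverse[OF category_slice h(2,1)] by blast
  obtain v where v: "h' = ((T, t), v, (coprod_ob C T1 T2, coprod_ar C a b))"
    "v \<in> Hom C T (coprod_ob C T1 T2)"
    using h'(1) by (auto simp: Hom_slice)
  have vu: "v \<cdot> u = Ide C (coprod_ob C T1 T2)" "u \<cdot> v = Ide C T"
    using h'(2,3) unfolding u(1) v(1) by (simp_all add: slice_def structured_cat_def)
  have Ob: "T1 \<in> Ob C" "T2 \<in> Ob C" using Hom_Ob a b by auto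
  note ar = coprod_ar[OF a b]
  have "t \<cdot> (u \<cdot> inl T1 T2) = inl A B \<cdot> a" "t \<cdot> (u \<cdot> inr T1 T2) = inr A B \<cdot> b"
    using Comp_assoc[OF inl_Hom[OF Ob] u(2) t] Comp_assoc[OF inr_Hom[OF Ob] u(2) t] ar u(3)
      by simp_all
  with coproduct_iso[OF is_coproduct_coprod[OF Ob] u(2) v(2) vu] a b show ?thesis by blast
qed

lemma cov_coprod:
  assumes "A \<in> Ob C" "B \<in> Ob C" "t \<in> Hom C T (coprod_ob C A B)"
  shows "cov T (\<lambda>s. (\<exists>a\<in>Hom C (Dom C s) A. t \<cdot> s = inl A B \<cdot> a) \<or>
    (\<exists>b\<in>Hom C (Dom C s) B. t \<cdot> s = inr A B \<cdot> b))"
proof -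
  obtain T1 T2 k1 k2 a b where cp: "is_coproduct C T1 T2 T k1 k2"
    and a: "a \<in> Hom C T1 A" "t \<cdot> k1 = inl A B \<cdot> a" and b: "b \<in> Hom C T2 B" "t \<cdot> k2 = inr A B \<cdot> b"
    using coprod_decompose[OF assms] by blast
  have k: "k1 \<in> Hom C T1 T" "k2 \<in> Hom C T2 T" using coproduct_Hom[OF cp] by auto
  have "T1 \<in> Ob C" "T2 \<in> Ob C" using Hom_Ob a b by auto
  then show ?thesis
    by (intro cov_coproduct[OF cp] cov_ide)
      (use a b k in \<open>auto simp: Id_right[OF k(1)] Id_right[OF k(2)] Hom_def\<close>)
qed

text \<open>Places two elements in summands at the same stage: the cover for \<open>p\<close> is
  refined by one for \<open>q\<close>, and lying in a summand survives restriction.\<close>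

lemma cov_coprod2:
  assumes AB: "A \<in> Ob C" "B \<in> Ob C"
    and pq: "p \<in> Hom C T (coprod_ob C A B)" "q \<in> Hom C T (coprod_ob C A B)"
  shows "cov T (\<lambda>t.
    ((\<exists>a\<in>Hom C (Dom C t) A. p \<cdot> t = inl A B \<cdot> a) \<or> (\<exists>b\<in>Hom C (Dom C t) B. p \<cdot> t = inr A B \<cdot> b)) \<and>
    ((\<exists>a\<in>Hom C (Dom C t) A. q \<cdot> t = inl A B \<cdot> a) \<or> (\<exists>b\<in>Hom C (Dom C t) B. q \<cdot> t = inr A B \<cdot> b)))"
proof (rule cov_bind[OF cov_coprod[OF AB pq(1)]])
  fix S t assume t: "t \<in> Hom C S T" and c: "(\<exists>a\<in>Hom C (Dom C t) A. p \<cdot> t = inl A B \<cdot> a) \<or>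
    (\<exists>b\<in>Hom C (Dom C t) B. p \<cdot> t = inr A B \<cdot> b)"
  note qt = Comp_in_Hom[OF t pq(2)]
  show "cov S (\<lambda>s.
    ((\<exists>a\<in>Hom C (Dom C (t \<cdot> s)) A. p \<cdot> (t \<cdot> s) = inl A B \<cdot> a) \<or>
     (\<exists>b\<in>Hom C (Dom C (t \<cdot> s)) B. p \<cdot> (t \<cdot> s) = inr A B \<cdot> b)) \<and>
    ((\<exists>a\<in>Hom C (Dom C (t \<cdot> s)) A. q \<cdot> (t \<cdot> s) = inl A B \<cdot> a) \<or>
     (\<exists>b\<in>Hom C (Dom C (t \<cdot> s)) B. q \<cdot> (t \<cdot> s) = inr A B \<cdot> b)))"
  proof (rule cov_mono[OF cov_coprod[OF AB qt]])
    fix S' s assume s: "s \<in> Hom C S' S" and c': "(\<exists>a\<in>Hom C (Dom C s) A. (q \<cdot> t) \<cdot> s = inl A B \<cdot> a) \<or>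
      (\<exists>b\<in>Hom C (Dom C s) B. (q \<cdot> t) \<cdot> s = inr A B \<cdot> b)"
    have D: "Dom C t = S" "Dom C s = S'" "Dom C (t \<cdot> s) = S'"
      using t s Comp_in_Hom[OF s t] by (auto simp: Hom_def)
    have "(k \<cdot> a) \<cdot> s = k \<cdot> (a \<cdot> s)" "a \<cdot> s \<in> Hom C S' K"
      if "a \<in> Hom C S K" "k \<in> Hom C K (coprod_ob C A B)" for k a K
      using Comp_assoc[OF s that] Comp_in_Hom[OF s that(1)] by simp_all
    from this[OF _ inl_Hom[OF AB]] this[OF _ inr_Hom[OF AB]] c
    have "(\<exists>a\<in>Hom C S' A. (p \<cdot> t) \<cdot> s = inl A B \<cdot> a) \<or> (\<exists>b\<in>Hom C S' B. (p \<cdot> t) \<cdot> s = inr A B \<cdot> b)"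
      unfolding D by metis
    then show "((\<exists>a\<in>Hom C (Dom C (t \<cdot> s)) A. p \<cdot> (t \<cdot> s) = inl A B \<cdot> a) \<or>
       (\<exists>b\<in>Hom C (Dom C (t \<cdot> s)) B. p \<cdot> (t \<cdot> s) = inr A B \<cdot> b)) \<and>
      ((\<exists>a\<in>Hom C (Dom C (t \<cdot> s)) A. q \<cdot> (t \<cdot> s) = inl A B \<cdot> a) \<or>
       (\<exists>b\<in>Hom C (Dom C (t \<cdot> s)) B. q \<cdot> (t \<cdot> s) = inr A B \<cdot> b))"
      using c' unfolding D Comp_assoc[OF s t pq(1)] Comp_assoc[OF s t pq(2)] by blast
  qed
qed

text \<open>Lift along \<open>e\<close> locally, then decompose the lift. Thus the two summands
  jointly cover every quotient of their coproduct.\<close>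

lemma regular_epi_coprod_lift:
  assumes e: "is_regular_epi C e" "e \<in> Hom C (coprod_ob C A B) Y" and AB: "A \<in> Ob C" "B \<in> Ob C"
    and y: "y \<in> Hom C T Y"
  shows "cov T (\<lambda>t. (\<exists>a\<in>Hom C (Dom C t) A. y \<cdot> t = (e \<cdot> inl A B) \<cdot> a) \<or>
    (\<exists>b\<in>Hom C (Dom C t) B. y \<cdot> t = (e \<cdot> inr A B) \<cdot> b))"
proof (rule cov_bind[OF regular_epi_lift[OF e y]])
  fix S t assume t: "t \<in> Hom C S T" and "\<exists>x\<in>Hom C (Dom C t) (coprod_ob C A B). e \<cdot> x = y \<cdot> t"
  then obtain x where x: "x \<in> Hom C S (coprod_ob C A B)" "e \<cdot> x = y \<cdot> t" by (auto simp: Hom_def)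
  show "cov S (\<lambda>s. (\<exists>a\<in>Hom C (Dom C (t \<cdot> s)) A. y \<cdot> (t \<cdot> s) = (e \<cdot> inl A B) \<cdot> a) \<or>
    (\<exists>b\<in>Hom C (Dom C (t \<cdot> s)) B. y \<cdot> (t \<cdot> s) = (e \<cdot> inr A B) \<cdot> b))"
  proof (rule cov_mono[OF cov_coprod[OF AB x(1)]])
    fix S' s assume s: "s \<in> Hom C S' S" and c: "(\<exists>a\<in>Hom C (Dom C s) A. x \<cdot> s = inl A B \<cdot> a) \<or>
      (\<exists>b\<in>Hom C (Dom C s) B. x \<cdot> s = inr A B \<cdot> b)"
    have D: "Dom C s = S'" "Dom C (t \<cdot> s) = S'" using s Comp_in_Hom[OF s t] by (auto simp: Hom_def)
    have eq: "y \<cdot> (t \<cdot> s) = e \<cdot> (x \<cdot> s)"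
      using Comp_assoc[OF s t y] Comp_assoc[OF s x(1) e(2)] x(2) by simp
    have "e \<cdot> (k \<cdot> a) = (e \<cdot> k) \<cdot> a" if "k \<in> Hom C K (coprod_ob C A B)" "a \<in> Hom C S' K" for k K a
      using Comp_assoc[OF that(2,1) e(2)] .
    from this[OF inl_Hom[OF AB]] this[OF inr_Hom[OF AB]]
    show "(\<exists>a\<in>Hom C (Dom C (t \<cdot> s)) A. y \<cdot> (t \<cdot> s) = (e \<cdot> inl A B) \<cdot> a) \<or>
      (\<exists>b\<in>Hom C (Dom C (t \<cdot> s)) B. y \<cdot> (t \<cdot> s) = (e \<cdot> inr A B) \<cdot> b)"
      using c unfolding D eq by metis
  qed
qed

section \<open>Strict initial objects, disjoint and monic injections\<close>

lemma initial_exists: "\<exists>Z. is_initial C Z"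
  using complete_category.terminal_exists[OF complete_category_op_cat]
  by (simp add: is_terminal_def is_initial_def)

lemma initial_Hom_unique:
  "is_initial C Z \<Longrightarrow> f \<in> Hom C Z A \<Longrightarrow> g \<in> Hom C Z A \<Longrightarrow> f = g"
  unfolding is_initial_def using Hom_Ob[of f Z A] by blast

lemma initial_Hom_exists: "is_initial C Z \<Longrightarrow> A \<in> Ob C \<Longrightarrow> \<exists>f. f \<in> Hom C Z A"
  unfolding is_initial_def by blast

text \<open>With \<open>x: T \<rightarrow> A\<close>, \<open>y: T \<rightarrow> B\<close> and \<open>inl \<cdot> x = inr \<cdot> y\<close>, the objects \<open>(x, 0)\<close> and \<open>(0, y)\<close> have isomorphic
  images under the coproduct functor, so fullness yields a map \<open>T \<rightarrow> 0\<close>.\<close>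

lemma coprod_disjoint:
  assumes x: "x \<in> Hom C T A" and y: "y \<in> Hom C T B" and eq: "inl A B \<cdot> x = inr A B \<cdot> y"
  shows "is_initial C T"
proof -
  have Ob: "T \<in> Ob C" "A \<in> Ob C" "B \<in> Ob C" using Hom_Ob x y by auto
  obtain Z where Z: "is_initial C Z" using initial_exists by blast
  then have ZO: "Z \<in> Ob C" by (simp add: is_initial_def)
  obtain zA zB zT where z: "zA \<in> Hom C Z A" "zB \<in> Hom C Z B" "zT \<in> Hom C Z T"
    using initial_Hom_exists[OF Z Ob(2)] initial_Hom_exists[OF Z Ob(3)]
      initial_Hom_exists[OF Z Ob(1)]
    by blast
  note I = Id_in_Hom[OF Ob(1)]
  obtain \<rho> where \<rho>: "\<rho> \<in> Hom C (coprod_ob C Z T) T" "\<rho> \<cdot> inr Z T = Ide C T"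
    using coprod_copair[OF z(3) I] by blast
  \<comment> \<open>\<open>w\<close> swaps the summands. It is a map over
    \<open>coprod_ob C A B\<close> because the assumed equation matches the two structure maps on
    \<open>T\<close>.\<close>
  obtain w where w: "w \<in> Hom C (coprod_ob C T Z) (coprod_ob C Z T)" "w \<cdot> inl T Z = inr Z T"
    using coprod_copair[OF inr_Hom[OF ZO Ob(1)] inl_Hom[OF ZO Ob(1)]] by blast
  note ar = coprod_ar[OF x z(2)] and ar' = coprod_ar[OF z(1) y]
  have "coprod_ar C zA y \<cdot> w = coprod_ar C x zB"
  proof (rule coprod_eqI[OF Comp_in_Hom[OF w(1) ar'(1)] ar(1) _ _ Ob(1) ZO])
    show "(coprod_ar C zA y \<cdot> w) \<cdot> inl T Z = coprod_ar C x zB \<cdot> inl T Z"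
      using Comp_assoc[OF inl_Hom[OF Ob(1) ZO] w(1) ar'(1)] w(2) ar(2) ar'(3) eq by simp
    show "(coprod_ar C zA y \<cdot> w) \<cdot> inr T Z = coprod_ar C x zB \<cdot> inr T Z"
      by (rule initial_Hom_unique[OF Z]) (rule Comp_in_Hom inr_Hom Ob ZO w(1) ar(1) ar'(1))+
  qed
  from coprod_full[OF x z(2,1) y w(1) this] obtain u v where
    u: "u \<in> Hom C T Z" and v: "v \<in> Hom C Z T" "coprod_ar C u v = w" by blast
  have "inl Z T \<cdot> u = inr Z T" using coprod_ar(2)[OF u v(1)] v(2) w(2) by simp
  \<comment> \<open>This makes \<open>T\<close> a retract of the initial object \<open>Z\<close>,
    and a retract of an initial object is initial.\<close>
  then have retr: "(\<rho> \<cdot> inl Z T) \<cdot> u = Ide C T"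
    using Comp_assoc[OF u inl_Hom[OF ZO Ob(1)] \<rho>(1)] \<rho>(2) by simp
  have \<rho>l: "\<rho> \<cdot> inl Z T \<in> Hom C Z T" by (rule Comp_in_Hom[OF inl_Hom[OF ZO Ob(1)] \<rho>(1)])
  show ?thesis
    unfolding is_initial_def
  proof (intro conjI ballI)
    fix X assume "X \<in> Ob C"
    then obtain zX where zX: "zX \<in> Hom C Z X" using initial_Hom_exists[OF Z] by blast
    show "\<exists>!f. f \<in> Hom C T X"
    proof (rule ex1I[of _ "zX \<cdot> u"])
      show "zX \<cdot> u \<in> Hom C T X" by (rule Comp_in_Hom[OF u zX])
      fix f assume f: "f \<in> Hom C T X"
      have "f \<cdot> (\<rho> \<cdot> inl Z T) = zX" by (rule initial_Hom_unique[OF Z Comp_in_Hom[OF \<rho>l f] zX])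
      then show "f = zX \<cdot> u" using Comp_assoc[OF u \<rho>l f] retr Id_right[OF f] by simp
    qed
  qed (rule Ob(1))
qed

text \<open>Initiality makes the two injections into \<open>coprod_ob C Z Z\<close> equal, so
  \<open>T\<close> maps into the overlap of the two summands, and disjointness applies.\<close>

lemma initial_strict:
  assumes Z: "is_initial C Z" and x: "x \<in> Hom C T Z"
  shows "is_initial C T"
proof -
  have ZO: "Z \<in> Ob C" using Z by (simp add: is_initial_def)
  have "inl Z Z = inr Z Z" by (rule initial_Hom_unique[OF Z inl_Hom[OF ZO ZO] inr_Hom[OF ZO ZO]])
  then show ?thesis using coprod_disjoint[OF x x] by simp
qed

text \<open>After adding an initial summand, the hypothesis says that the identity of
  \<open>coprod_ob C T Z\<close> is a map over \<open>coprod_ob C A B\<close> from the sum of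
  \<open>x\<close> to the sum of \<open>y\<close>. Fullness splits it as \<open>u\<close> plus
  \<open>v\<close> with \<open>y \<cdot> u = x\<close>, and \<open>u\<close> is the identity because
  \<open>inl T Z\<close> has a retraction.\<close>

lemma inl_mono:
  assumes B: "B \<in> Ob C" and x: "x \<in> Hom C T A" and y: "y \<in> Hom C T A"
    and eq: "inl A B \<cdot> x = inl A B \<cdot> y"
  shows "x = y"
proof -
  have Ob: "T \<in> Ob C" "A \<in> Ob C" using Hom_Ob x by auto
  obtain Z where Z: "is_initial C Z" using initial_exists by blast
  then have ZO: "Z \<in> Ob C" by (simp add: is_initial_def)
  obtain zB zT where z: "zB \<in> Hom C Z B" "zT \<in> Hom C Z T"
    using initial_Hom_exists[OF Z B] initial_Hom_exists[OF Z Ob(1)] by blast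
  note I = Id_in_Hom[OF Ob(1)] and l = inl_Hom[OF Ob(1) ZO]
  obtain \<rho> where \<rho>: "\<rho> \<in> Hom C (coprod_ob C T Z) T" "\<rho> \<cdot> inl T Z = Ide C T"
    using coprod_copair[OF I z(2)] by blast
  note ar = coprod_ar[OF x z(1)] and ar' = coprod_ar[OF y z(1)]
  note IT = Id_in_Hom[OF coprod_Ob[OF Ob(1) ZO]]
  have "coprod_ar C y zB \<cdot> Ide C (coprod_ob C T Z) = coprod_ar C x zB"
    unfolding Id_right[OF ar'(1)]
    by (rule coprod_eqI[OF ar'(1) ar(1) _ _ Ob(1) ZO]) (simp_all only: ar(2,3) ar'(2,3) eq)
  from coprod_full[OF x z(1) y z(1) IT this] obtain u v where
    u: "u \<in> Hom C T T" "y \<cdot> u = x"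
        and v: "v \<in> Hom C Z Z" "coprod_ar C u v = Ide C (coprod_ob C T Z)"
    by blast
  have "inl T Z \<cdot> u = inl T Z \<cdot> Ide C T"
    using coprod_ar(2)[OF u(1) v(1)] v(2) Id_left[OF l] Id_right[OF l] by simp
  then have "u = Ide C T" using left_inverse_cancel[OF \<rho>(2) l \<rho>(1) u(1) I] by simp
  then show ?thesis using u(2) Id_right[OF y] by simp
qed

lemma inr_mono:
  assumes A: "A \<in> Ob C" and x: "x \<in> Hom C T B" and y: "y \<in> Hom C T B"
    and eq: "inr A B \<cdot> x = inr A B \<cdot> y"
  shows "x = y"
proof -
  have Ob: "T \<in> Ob C" "B \<in> Ob C" using Hom_Ob x by auto
  obtain Z where Z: "is_initial C Z" using initial_exists by blast
  then have ZO: "Z \<in> Ob C" by (simp add: is_initial_def)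
  obtain zA zT where z: "zA \<in> Hom C Z A" "zT \<in> Hom C Z T"
    using initial_Hom_exists[OF Z A] initial_Hom_exists[OF Z Ob(1)] by blast
  note I = Id_in_Hom[OF Ob(1)] and r = inr_Hom[OF ZO Ob(1)]
  obtain \<rho> where \<rho>: "\<rho> \<in> Hom C (coprod_ob C Z T) T" "\<rho> \<cdot> inr Z T = Ide C T"
    using coprod_copair[OF z(2) I] by blast
  note ar = coprod_ar[OF z(1) x] and ar' = coprod_ar[OF z(1) y]
  note IT = Id_in_Hom[OF coprod_Ob[OF ZO Ob(1)]]
  have "coprod_ar C zA y \<cdot> Ide C (coprod_ob C Z T) = coprod_ar C zA x"
    unfolding Id_right[OF ar'(1)]
    by (rule coprod_eqI[OF ar'(1) ar(1) _ _ ZO Ob(1)]) (simp_all only: ar(2,3) ar'(2,3) eq)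
  from coprod_full[OF z(1) x z(1) y IT this] obtain u v where
    u: "u \<in> Hom C T T" "y \<cdot> u = x"
        and v: "v \<in> Hom C Z Z" "coprod_ar C v u = Ide C (coprod_ob C Z T)"
    by blast
  have "inr Z T \<cdot> u = inr Z T \<cdot> Ide C T"
    using coprod_ar(3)[OF v(1) u(1)] v(2) Id_left[OF r] Id_right[OF r] by simp
  then have "u = Ide C T" using left_inverse_cancel[OF \<rho>(2) r \<rho>(1) u(1) I] by simp
  then show ?thesis using u(2) Id_right[OF y] by simp
qed

end

section \<open>Gluing along a monomorphism\<close>

context cocomplete_pretopos
begin

text \<open>The relation behind the quotient: elements of the subobject \<open>n\<close> are
  identified when \<open>g\<close> agrees on them, and any other element only with itself. The
  argument \<open>t\<close> is the restriction at which this is tested, so that the property can be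
  placed under \<open>cov\<close>.\<close>

definition identified :: "'b \<Rightarrow> 'b \<Rightarrow> 'b \<Rightarrow> 'b \<Rightarrow> 'b \<Rightarrow> bool" where
  "identified n g x y t \<longleftrightarrow> x \<cdot> t = y \<cdot> t \<or>
     (\<exists>z\<in>Hom C (Dom C t) (Dom C n). \<exists>z'\<in>Hom C (Dom C t) (Dom C n).
        x \<cdot> t = n \<cdot> z \<and> y \<cdot> t = n \<cdot> z' \<and> g \<cdot> z = g \<cdot> z')"

lemma identifiedE:
  assumes "identified n g x y t" "n \<in> Hom C D Y" "t \<in> Hom C S T"
  obtains "x \<cdot> t = y \<cdot> t"
  | z z' where "z \<in> Hom C S D" "z' \<in> Hom C S D" "x \<cdot> t = n \<cdot> z" "y \<cdot> t = n \<cdot> z'" "g \<cdot> z = g \<cdot> z'"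
proof -
  have "Dom C n = D" "Dom C t = S" using assms(2,3) by (simp_all add: Hom_def)
  then show ?thesis using assms(1) that unfolding identified_def by blast
qed

lemma identifiedI:
  assumes "n \<in> Hom C D Y" "t \<in> Hom C S T" "z \<in> Hom C S D" "z' \<in> Hom C S D"
    "x \<cdot> t = n \<cdot> z" "y \<cdot> t = n \<cdot> z'" "g \<cdot> z = g \<cdot> z'"
  shows "identified n g x y t"
proof -
  have "Dom C n = D" "Dom C t = S" using assms(1,2) by (simp_all add: Hom_def)
  then show ?thesis using assms(3-) unfolding identified_def by blast
qed

lemma identified_sym: "identified n g x y t \<Longrightarrow> identified n g y x t"
  unfolding identified_def by metis

text \<open>When both identifications pass through \<open>n\<close>, monicity of \<open>n\<close>
  makes the two preimages of the middle element coincide, so the equations for \<open>g\<close>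
  chain. The second hypothesis sits at a later stage because it will come from a cover of the first
  stage.\<close>

lemma identified_trans:
  assumes n: "n \<in> Hom C D Y" "is_mono C n" and g: "g \<in> Hom C D E"
    and xyz: "x \<in> Hom C T Y" "y \<in> Hom C T Y" "z \<in> Hom C T Y" and t: "t \<in> Hom C S T"
        and s: "s \<in> Hom C S' S"
    and 1: "identified n g x y t" and 2: "identified n g (y \<cdot> t) (z \<cdot> t) s"
  shows "identified n g x z (t \<cdot> s)"
proof -
  note ts = Comp_in_Hom[OF s t]
  have a: "u \<cdot> (t \<cdot> s) = (u \<cdot> t) \<cdot> s" if "u \<in> Hom C T Y" for u
    using Comp_assoc[OF s t that] .
  have ns: "(n \<cdot> w) \<cdot> s = n \<cdot> (w \<cdot> s)" "(g \<cdot> w) \<cdot> s = g \<cdot> (w \<cdot> s)" if "w \<in> Hom C S D" for w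
    using Comp_assoc[OF s that n(1)] Comp_assoc[OF s that g] by simp_all
  show ?thesis
    using 1 n(1) t
  proof (cases rule: identifiedE)
    case e1: 1
    then show ?thesis
      using 2 unfolding identified_def a[OF xyz(1)] a[OF xyz(3)]
      by (simp only: e1) (use ts s in \<open>auto simp: Hom_def\<close>)
  next
    case e1: (2 u u')
    note us = Comp_in_Hom[OF s e1(1)] Comp_in_Hom[OF s e1(2)]
    have x: "x \<cdot> (t \<cdot> s) = n \<cdot> (u \<cdot> s)" using a[OF xyz(1)] e1(3) ns[OF e1(1)] by simp
    have y: "(y \<cdot> t) \<cdot> s = n \<cdot> (u' \<cdot> s)" using e1(4) ns[OF e1(2)] by simp
    have gu: "g \<cdot> (u \<cdot> s) = g \<cdot> (u' \<cdot> s)" using ns(2)[OF e1(1)] ns(2)[OF e1(2)] e1(5) by simp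
    show ?thesis
      using 2 n(1) s
    proof (cases rule: identifiedE)
      case 1
      then show ?thesis
        using identifiedI[OF n(1) ts us x _ gu] y a[OF xyz(3)] by simp
    next
      case (2 v v')
      have "u' \<cdot> s = v" using mono_cancel[OF n(2,1) us(2) 2(1)] y 2(3) by simp
      then show ?thesis
        using identifiedI[OF n(1) ts us(1) 2(2) x] 2(4,5) gu a[OF xyz(3)] by simp
    qed
  qed
qed

text \<open>The relation is the union of the diagonal and the kernel pair of \<open>g\<close>
  transported along \<open>n\<close>. Once its elements are known to be the locally identified
  pairs, it is an equivalence relation by elementwise reasoning, and effectiveness provides
  \<open>b\<close>.\<close>

lemma quotient_by_mono:
  assumes n: "n \<in> Hom C D Y" "is_mono C n" and g: "g \<in> Hom C D E"
  shows "\<exists>Q b. b \<in> Hom C Y Q \<and> (\<forall>T. \<forall>x\<in>Hom C T Y. \<forall>y\<in>Hom C T Y.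
    b \<cdot> x = b \<cdot> y \<longleftrightarrow> cov T (identified n g x y))"
proof -
  obtain K k1 k2 where K: "is_pullback C g g K k1 k2" using pullback_exists[OF g g] by blast
  note k = pullback_Hom[OF K g g]
  have Ob: "Y \<in> Ob C" "K \<in> Ob C" using Hom_Ob n k by auto
  note IY = Id_in_Hom[OF Ob(1)]
  note nk = Comp_in_Hom[OF k(1) n(1)] Comp_in_Hom[OF k(2) n(1)]
  \<comment> \<open>The summand \<open>Y\<close> contributes the diagonal and the summand
    \<open>K\<close> the transported kernel pair; the image of this pair of maps is their
    union.\<close>
  obtain s1 s2 where s1: "s1 \<in> Hom C (coprod_ob C Y K) Y" "s1 \<cdot> inl Y K = Ide C Y"
      "s1 \<cdot> inr Y K = n \<cdot> k1"
    and s2: "s2 \<in> Hom C (coprod_ob C Y K) Y" "s2 \<cdot> inl Y K = Ide C Y" "s2 \<cdot> inr Y K = n \<cdot> k2"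
    using coprod_copair[OF IY nk(1)] coprod_copair[OF IY nk(2)] by blast
  obtain R e r1 r2 where R: "is_relation C Y (R, r1, r2)" and e: "e \<in> Hom C (coprod_ob C Y K) R"
    "is_regular_epi C e" and re: "r1 \<cdot> e = s1" "r2 \<cdot> e = s2"
    using relation_image[OF s1(1) s2(1)] by blast
  have r: "r1 \<in> Hom C R Y" "r2 \<in> Hom C R Y" using R by (auto simp: is_relation_def)
  define d1 where "d1 = e \<cdot> inl Y K"
  define d2 where "d2 = e \<cdot> inr Y K"
  have d: "d1 \<in> Hom C Y R" "d2 \<in> Hom C K R"
    unfolding d1_def d2_def using Comp_in_Hom[OF inl_Hom[OF Ob] e(1)]
      Comp_in_Hom[OF inr_Hom[OF Ob] e(1)] .
  have rd: "r1 \<cdot> d1 = Ide C Y" "r2 \<cdot> d1 = Ide C Y" "r1 \<cdot> d2 = n \<cdot> k1" "r2 \<cdot> d2 = n \<cdot> k2"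
    unfolding d1_def d2_def using re s1 s2 Comp_assoc[OF inl_Hom[OF Ob] e(1)]
      Comp_assoc[OF inr_Hom[OF Ob] e(1)] r
    by simp_all
  \<comment> \<open>From left to right, an element of the image comes locally from one of the two
    summands. From right to left, local factorizations glue because \<open>R\<close> is jointly
    monic.\<close>
  have rel: "(\<exists>w\<in>Hom C T R. r1 \<cdot> w = x \<and> r2 \<cdot> w = y) \<longleftrightarrow> cov T (identified n g x y)"
    if x: "x \<in> Hom C T Y" and y: "y \<in> Hom C T Y" for x y T
  proof
    assume "\<exists>w\<in>Hom C T R. r1 \<cdot> w = x \<and> r2 \<cdot> w = y"
    then obtain w where w: "w \<in> Hom C T R" "r1 \<cdot> w = x" "r2 \<cdot> w = y" by blast
    show "cov T (identified n g x y)"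
    proof (rule cov_mono[OF regular_epi_coprod_lift[OF e(2,1) Ob w(1)]])
      fix S t assume t: "t \<in> Hom C S T" and
        c: "(\<exists>a\<in>Hom C (Dom C t) Y. w \<cdot> t = (e \<cdot> inl Y K) \<cdot> a) \<or>
          (\<exists>b\<in>Hom C (Dom C t) K. w \<cdot> t = (e \<cdot> inr Y K) \<cdot> b)"
      have xy: "x \<cdot> t = r1 \<cdot> (w \<cdot> t)" "y \<cdot> t = r2 \<cdot> (w \<cdot> t)"
        using Comp_assoc[OF t w(1) r(1)] Comp_assoc[OF t w(1) r(2)] w by simp_all
      have "Dom C t = S" using t by (simp add: Hom_def)
      then consider a where "a \<in> Hom C S Y" "w \<cdot> t = d1 \<cdot> a" | b
          where "b \<in> Hom C S K" "w \<cdot> t = d2 \<cdot> b"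
        using c unfolding d1_def d2_def by auto
      then show "identified n g x y t"
      proof cases
        case 1
        have "r1 \<cdot> (d1 \<cdot> a) = a" "r2 \<cdot> (d1 \<cdot> a) = a"
          using Comp_assoc[OF 1(1) d(1) r(1)] Comp_assoc[OF 1(1) d(1) r(2)] rd Id_left[OF 1(1)]
            by simp_all
        then show ?thesis using 1 xy by (simp add: identified_def)
      next
        case 2
        have "r1 \<cdot> (d2 \<cdot> b) = n \<cdot> (k1 \<cdot> b)" "r2 \<cdot> (d2 \<cdot> b) = n \<cdot> (k2 \<cdot> b)"
          using comp_eq_comp[OF rd(3) d(2) r(1) k(1) n(1) 2(1)]
            comp_eq_comp[OF rd(4) d(2) r(2) k(2) n(1) 2(1)] .
        moreover have "g \<cdot> (k1 \<cdot> b) = g \<cdot> (k2 \<cdot> b)" by (rule comp_eq_comp[OF k(3,1) g k(2) g 2(1)])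
        ultimately show ?thesis
          using identifiedI[OF n(1) t Comp_in_Hom[OF 2(1) k(1)] Comp_in_Hom[OF 2(1) k(2)]] xy 2(2)
            by simp
      qed
    qed
  next
    assume "cov T (identified n g x y)"
    then show "\<exists>w\<in>Hom C T R. r1 \<cdot> w = x \<and> r2 \<cdot> w = y"
    proof (rule cov_factor[OF _ R x y])
      fix S t assume t: "t \<in> Hom C S T" and "identified n g x y t"
      from this(2) n(1) t show "\<exists>w\<in>Hom C S R. r1 \<cdot> w = x \<cdot> t \<and> r2 \<cdot> w = y \<cdot> t"
      proof (cases rule: identifiedE)
        case 1
        note xt = Comp_in_Hom[OF t x]
        have "r1 \<cdot> (d1 \<cdot> (x \<cdot> t)) = x \<cdot> t" "r2 \<cdot> (d1 \<cdot> (x \<cdot> t)) = x \<cdot> t"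
          using Comp_assoc[OF xt d(1) r(1)] Comp_assoc[OF xt d(1) r(2)] rd Id_left[OF xt]
            by simp_all
        then show ?thesis using 1 Comp_in_Hom[OF xt d(1)] by auto
      next
        case (2 z z')
        obtain b where b: "b \<in> Hom C S K" "k1 \<cdot> b = z" "k2 \<cdot> b = z'"
          using pullback_ump[OF K g g 2(1,2,5)] by blast
        have "r1 \<cdot> (d2 \<cdot> b) = n \<cdot> (k1 \<cdot> b)" "r2 \<cdot> (d2 \<cdot> b) = n \<cdot> (k2 \<cdot> b)"
          using comp_eq_comp[OF rd(3) d(2) r(1) k(1) n(1) b(1)]
            comp_eq_comp[OF rd(4) d(2) r(2) k(2) n(1) b(1)] .
        then show ?thesis using 2 b Comp_in_Hom[OF b(1) d(2)] by auto
      qed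
    qed
  qed
  have "is_equivalence_relation C Y (R, r1, r2)"
    unfolding is_equivalence_relation_def is_reflexive_relation_def prod.case
  proof (intro conjI allI impI)
    show "\<exists>s\<in>Hom C Y R. r1 \<cdot> s = Ide C Y \<and> r2 \<cdot> s = Ide C Y" using d rd by blast
    have "R \<in> Ob C" using Hom_Ob r by blast
    \<comment> \<open>The generic element, the identity of \<open>R\<close>, turns the elementwise
      symmetry of \<open>identified\<close> into the required symmetry map.\<close>
    then have "\<exists>w\<in>Hom C R R. r1 \<cdot> w = r1 \<and> r2 \<cdot> w = r2"
      using Id_in_Hom Id_right[OF r(1)] Id_right[OF r(2)] by blast
    then have "cov R (identified n g r1 r2)" by (simp only: rel[OF r])
    then have "cov R (identified n g r2 r1)" by (rule cov_mono) (rule identified_sym)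
    then show "\<exists>s\<in>Hom C R R. r1 \<cdot> s = r2 \<and> r2 \<cdot> s = r1" by (simp only: rel[OF r(2,1)])
  next
    fix P p q assume "is_pullback C r2 r1 P p q"
    note pq = pullback_Hom[OF this r(2,1)]
    note c = Comp_in_Hom[OF pq(1) r(1)] Comp_in_Hom[OF pq(1) r(2)] Comp_in_Hom[OF pq(2) r(2)]
    have "cov P (identified n g (r1 \<cdot> p) (r2 \<cdot> p))" using rel[OF c(1,2)] pq(1) by blast
    then have "cov P (identified n g (r1 \<cdot> p) (r2 \<cdot> q))"
    proof (rule cov_bind)
      fix S t assume t: "t \<in> Hom C S P" and i: "identified n g (r1 \<cdot> p) (r2 \<cdot> p) t"
      have "r1 \<cdot> (q \<cdot> t) = (r2 \<cdot> p) \<cdot> t" "r2 \<cdot> (q \<cdot> t) = (r2 \<cdot> q) \<cdot> t"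
        using Comp_assoc[OF t pq(2) r(1)] Comp_assoc[OF t pq(2) r(2)] pq(3) by simp_all
      then have "cov S (identified n g ((r2 \<cdot> p) \<cdot> t) ((r2 \<cdot> q) \<cdot> t))"
        using rel[OF Comp_in_Hom[OF t c(2)] Comp_in_Hom[OF t c(3)]] Comp_in_Hom[OF t pq(2)] by blast
      then show "cov S (\<lambda>s. identified n g (r1 \<cdot> p) (r2 \<cdot> q) (t \<cdot> s))"
        by (rule cov_mono) (rule identified_trans[OF n g c t _ i])
    qed
    then show "\<exists>t\<in>Hom C P R. r1 \<cdot> t = r1 \<cdot> p \<and> r2 \<cdot> t = r2 \<cdot> q"
      by (simp only: rel[OF c(1,3)])
  qed (rule R)
  from effective[OF this] obtain b where b: "is_pullback C b b R r1 r2"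
    by (auto simp: is_kernel_pair_def)
  then have bY: "b \<in> Hom C Y (Cod C b)" using r(1) by (auto simp: is_pullback_def Hom_def)
  have "b \<cdot> x = b \<cdot> y \<longleftrightarrow> cov T (identified n g x y)"
    if x: "x \<in> Hom C T Y" and y: "y \<in> Hom C T Y" for T x y
    unfolding rel[OF x y, symmetric]
  proof
    assume "b \<cdot> x = b \<cdot> y"
    from pullback_ump[OF b bY bY x y this] show "\<exists>w\<in>Hom C T R. r1 \<cdot> w = x \<and> r2 \<cdot> w = y" by blast
  next
    assume "\<exists>w\<in>Hom C T R. r1 \<cdot> w = x \<and> r2 \<cdot> w = y"
    then show "b \<cdot> x = b \<cdot> y"
      using comp_eq_comp[OF pullback_Hom(3)[OF b bY bY] r(1) bY r(2) bY] by blast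
  qed
  with bY show ?thesis by blast
qed

text \<open>Gluing along \<open>m: A \<rightarrow> B\<close> and \<open>f: A \<rightarrow> E\<close> is the quotient of \<open>B + E\<close> along the monomorphism
  \<open>m + 1: A + E \<rightarrow> B + E\<close> and \<open>[f, 1]: A + E \<rightarrow> E\<close>; this leaves only one kind of identification.\<close>

lemma coprod_ar_ide_mono:
  assumes m: "m \<in> Hom C A B" "is_mono C m" and E: "E \<in> Ob C"
  shows "is_mono C (coprod_ar C m (Ide C E))"
proof (rule is_monoI[OF coprod_ar(1)[OF m(1) Id_in_Hom[OF E]]])
  let ?n = "coprod_ar C m (Ide C E)"
  note n = coprod_ar[OF m(1) Id_in_Hom[OF E]]
  have Ob: "A \<in> Ob C" "B \<in> Ob C" using Hom_Ob m by auto
  note lA = inl_Hom[OF Ob(1) E] and rA = inr_Hom[OF Ob(1) E] and lB = inl_Hom[OF Ob(2) E]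
      and rB = inr_Hom[OF Ob(2) E]
  fix T x y assume x: "x \<in> Hom C T (coprod_ob C A E)" and y: "y \<in> Hom C T (coprod_ob C A E)"
    and xy: "?n \<cdot> x = ?n \<cdot> y"
  have nl: "?n \<cdot> (inl A E \<cdot> a) = inl B E \<cdot> (m \<cdot> a)" if "a \<in> Hom C S A" for S a
    by (rule comp_eq_comp[OF n(2) lA n(1) m(1) lB that])
  have nr: "?n \<cdot> (inr A E \<cdot> a) = inr B E \<cdot> a" if "a \<in> Hom C S E" for S a
    using comp_eq_comp[OF n(3) rA n(1) Id_in_Hom[OF E] rB that] Id_left[OF that] by simp
  \<comment> \<open>Elements in the same summand are compared through monic injections. Elements in
    different summands force the stage to be initial, where parallel maps agree.\<close>
  have key: "u = v" if u: "u \<in> Hom C S (coprod_ob C A E)" and v: "v \<in> Hom C S (coprod_ob C A E)"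
    and uv: "?n \<cdot> u = ?n \<cdot> v"
    and cu: "(\<exists>a\<in>Hom C S A. u = inl A E \<cdot> a) \<or> (\<exists>b\<in>Hom C S E. u = inr A E \<cdot> b)"
    and cv: "(\<exists>a\<in>Hom C S A. v = inl A E \<cdot> a) \<or> (\<exists>b\<in>Hom C S E. v = inr A E \<cdot> b)" for S u v
  proof -
    have init: "u = v" if "is_initial C S" by (rule initial_Hom_unique[OF that u v])
    from cu cv consider
        a a' where "a \<in> Hom C S A" "a' \<in> Hom C S A" "u = inl A E \<cdot> a" "v = inl A E \<cdot> a'"
      | a b where "a \<in> Hom C S A" "b \<in> Hom C S E" "inl B E \<cdot> (m \<cdot> a) = inr B E \<cdot> b"
      | b b' where "b \<in> Hom C S E" "b' \<in> Hom C S E" "u = inr A E \<cdot> b" "v = inr A E \<cdot> b'"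
      using uv nl nr by metis
    then show ?thesis
    proof cases
      case 1
      then have "inl B E \<cdot> (m \<cdot> a) = inl B E \<cdot> (m \<cdot> a')" using uv nl by simp
      then have "m \<cdot> a = m \<cdot> a'" using inl_mono[OF E] Comp_in_Hom[OF 1(1) m(1)]
          Comp_in_Hom[OF 1(2) m(1)] by blast
      then show ?thesis using mono_cancel[OF m(2,1) 1(1,2)] 1 by simp
    next
      case 2
      then show ?thesis using init coprod_disjoint[OF Comp_in_Hom[OF 2(1) m(1)] 2(2)] by blast
    next
      case 3
      then have "inr B E \<cdot> b = inr B E \<cdot> b'" using uv nr by simp
      then show ?thesis using inr_mono[OF Ob(2) 3(1,2)] 3 by simp
    qed
  qed
  show "x = y"
  proof (rule cov_eq[OF cov_coprod2[OF Ob(1) E x y] x y], elim conjE)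
    fix S t assume t: "t \<in> Hom C S T" and
      c: "(\<exists>a\<in>Hom C (Dom C t) A. x \<cdot> t = inl A E \<cdot> a) \<or> (\<exists>b\<in>Hom C (Dom C t) E. x \<cdot> t = inr A E \<cdot> b)"
        "(\<exists>a\<in>Hom C (Dom C t) A. y \<cdot> t = inl A E \<cdot> a) \<or> (\<exists>b\<in>Hom C (Dom C t) E. y \<cdot> t = inr A E \<cdot> b)"
    have "?n \<cdot> (x \<cdot> t) = ?n \<cdot> (y \<cdot> t)"
      using Comp_assoc[OF t x n(1)] Comp_assoc[OF t y n(1)] xy by simp
    moreover have "Dom C t = S" using t by (simp add: Hom_def)
    ultimately show "x \<cdot> t = y \<cdot> t"
      using key[OF Comp_in_Hom[OF t x] Comp_in_Hom[OF t y]] c by simp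
  qed
qed

text \<open>Each claim is a case analysis on \<open>identified n g\<close>. An equality across the
  summands is excluded by disjointness up to an initial stage, and one inside a summand is cancelled
  by a monic injection. For a genuine identification, \<open>inr_n\<close> and \<open>inl_n\<close>
  compute the preimage along \<open>n\<close> and its value under \<open>g\<close>.\<close>

lemma glue_along_mono:
  assumes m: "m \<in> Hom C A B" "is_mono C m" and f: "f \<in> Hom C A E"
  shows "\<exists>Q b c. b \<in> Hom C B Q \<and> c \<in> Hom C E Q \<and> b \<cdot> m = c \<cdot> f \<and> is_mono C c \<and>
    (\<forall>T. \<forall>x\<in>Hom C T B. \<forall>y\<in>Hom C T E. b \<cdot> x = c \<cdot> y \<longrightarrow> (\<exists>z\<in>Hom C T A. x = m \<cdot> z \<and> y = f \<cdot> z)) \<and>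
    (\<forall>T. \<forall>x\<in>Hom C T B. \<forall>y\<in>Hom C T B. b \<cdot> x = b \<cdot> y \<longrightarrow> cov T (identified m f x y))"
proof -
  have Ob: "A \<in> Ob C" "B \<in> Ob C" "E \<in> Ob C" using Hom_Ob m f by auto
  note IE = Id_in_Hom[OF Ob(3)]
  note lA = inl_Hom[OF Ob(1,3)] and rA = inr_Hom[OF Ob(1,3)] and lB = inl_Hom[OF Ob(2,3)]
      and rB = inr_Hom[OF Ob(2,3)]
  define n where "n = coprod_ar C m (Ide C E)"
  have n: "n \<in> Hom C (coprod_ob C A E) (coprod_ob C B E)" "n \<cdot> inl A E = inl B E \<cdot> m"
    "n \<cdot> inr A E = inr B E" "is_mono C n"
    using coprod_ar[OF m(1) IE] coprod_ar_ide_mono[OF m Ob(3)] Id_right[OF rB]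
      by (simp_all add: n_def)
  obtain g where g: "g \<in> Hom C (coprod_ob C A E) E" "g \<cdot> inl A E = f" "g \<cdot> inr A E = Ide C E"
    using coprod_copair[OF f IE] by blast
  obtain Q q where q: "q \<in> Hom C (coprod_ob C B E) Q" and
    qe: "\<And>T x y. x \<in> Hom C T (coprod_ob C B E) \<Longrightarrow> y \<in> Hom C T (coprod_ob C B E) \<Longrightarrow>
      q \<cdot> x = q \<cdot> y \<longleftrightarrow> cov T (identified n g x y)"
    using quotient_by_mono[OF n(1,4) g(1)] by blast
  have nl: "n \<cdot> (inl A E \<cdot> a) = inl B E \<cdot> (m \<cdot> a)" "g \<cdot> (inl A E \<cdot> a) = f \<cdot> a" if "a \<in> Hom C S A"
      for S a
    using comp_eq_comp[OF n(2) lA n(1) m(1) lB that] Comp_assoc[OF that lA g(1)] g(2) by simp_all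
  have nr: "n \<cdot> (inr A E \<cdot> a) = inr B E \<cdot> a" "g \<cdot> (inr A E \<cdot> a) = a" if "a \<in> Hom C S E" for S a
    using Comp_assoc[OF that rA n(1)] n(3) Comp_assoc[OF that rA g(1)] g(3) Id_left[OF that]
      by simp_all
  have inr_n: "g \<cdot> z = y" if y: "y \<in> Hom C S E" and z: "z \<in> Hom C S (coprod_ob C A E)"
      and "inr B E \<cdot> y = n \<cdot> z"
    for S y z
  proof -
    have "z = inr A E \<cdot> y" using mono_cancel[OF n(4,1) z Comp_in_Hom[OF y rA]] nr[OF y] that(3)
        by simp
    then show ?thesis using nr[OF y] by simp
  qed
  \<comment> \<open>The preimage \<open>z\<close> lies locally in \<open>A\<close> or in
    \<open>E\<close>. The second case puts an element in both summands, so its stage is initial;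
    since \<open>m\<close> is monic, the local preimages in \<open>A\<close> glue to one.\<close>
  have inl_n: "\<exists>a\<in>Hom C S A. x = m \<cdot> a \<and> g \<cdot> z = f \<cdot> a"
    if x: "x \<in> Hom C S B" and z: "z \<in> Hom C S (coprod_ob C A E)" and xz: "inl B E \<cdot> x = n \<cdot> z"
        for S x z
  proof -
    have "\<exists>a\<in>Hom C S A. m \<cdot> a = x"
    proof (rule cov_factor_mono[OF cov_coprod[OF Ob(1,3) z] m(2,1) x])
      fix S' s assume s: "s \<in> Hom C S' S" and c: "(\<exists>a\<in>Hom C (Dom C s) A. z \<cdot> s = inl A E \<cdot> a) \<or>
        (\<exists>b\<in>Hom C (Dom C s) E. z \<cdot> s = inr A E \<cdot> b)"
      have DS': "Dom C s = S'" using s by (simp add: Hom_def)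
      note xs = Comp_in_Hom[OF s x]
      have xzs: "inl B E \<cdot> (x \<cdot> s) = n \<cdot> (z \<cdot> s)" by (rule comp_eq_comp[OF xz x lB z n(1) s])
      from c[unfolded DS'] show "\<exists>a\<in>Hom C S' A. m \<cdot> a = x \<cdot> s"
      proof (elim disjE bexE)
        fix a assume a: "a \<in> Hom C S' A" "z \<cdot> s = inl A E \<cdot> a"
        then have "inl B E \<cdot> (m \<cdot> a) = inl B E \<cdot> (x \<cdot> s)" using xzs nl by simp
        from inl_mono[OF Ob(3) Comp_in_Hom[OF a(1) m(1)] xs this] a(1) show ?thesis by blast
      next
        fix b assume b: "b \<in> Hom C S' E" "z \<cdot> s = inr A E \<cdot> b"
        then have "inl B E \<cdot> (x \<cdot> s) = inr B E \<cdot> b" using xzs nr by simp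
        then have I: "is_initial C S'" by (rule coprod_disjoint[OF xs b(1)])
        then obtain a where a: "a \<in> Hom C S' A" using initial_Hom_exists Ob(1) by blast
        show ?thesis using a initial_Hom_unique[OF I Comp_in_Hom[OF a m(1)] xs] by blast
      qed
    qed
    then obtain a where a: "a \<in> Hom C S A" "m \<cdot> a = x" by blast
    have "z = inl A E \<cdot> a" using mono_cancel[OF n(4,1) z Comp_in_Hom[OF a(1) lA]] nl[OF a(1)]
        a(2) xz by simp
    then show ?thesis using nl[OF a(1)] a by auto
  qed
  define b where "b = q \<cdot> inl B E"
  define c where "c = q \<cdot> inr B E"
  have bc: "b \<in> Hom C B Q" "c \<in> Hom C E Q"
    unfolding b_def c_def using Comp_in_Hom[OF lB q] Comp_in_Hom[OF rB q] .
  have bq: "b \<cdot> x = q \<cdot> (inl B E \<cdot> x)" "inl B E \<cdot> x \<in> Hom C T (coprod_ob C B E)" if "x \<in> Hom C T B"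
      for T x
    unfolding b_def using Comp_assoc[OF that lB q] Comp_in_Hom[OF that lB] by simp_all
  have cq: "c \<cdot> x = q \<cdot> (inr B E \<cdot> x)" "inr B E \<cdot> x \<in> Hom C T (coprod_ob C B E)" if "x \<in> Hom C T E"
      for T x
    unfolding c_def using Comp_assoc[OF that rB q] Comp_in_Hom[OF that rB] by simp_all
  have comm: "b \<cdot> m = c \<cdot> f"
  proof -
    note IA = Id_in_Hom[OF Ob(1)]
    have "identified n g (inl B E \<cdot> m) (inr B E \<cdot> f) (Ide C A)"
      using identifiedI[OF n(1) IA lA Comp_in_Hom[OF f rA]]
        Id_right[OF bq(2)[OF m(1)]] Id_right[OF cq(2)[OF f]] n(2) nr[OF f] g(2) by simp
    then have "cov A (identified n g (inl B E \<cdot> m) (inr B E \<cdot> f))" by (rule cov_ide[OF Ob(1)])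
    then show ?thesis using qe[OF bq(2)[OF m(1)] cq(2)[OF f]] bq(1)[OF m(1)] cq(1)[OF f] by simp
  qed
  have c_mono: "is_mono C c"
  proof (rule is_monoI[OF bc(2)])
    fix T x y assume x: "x \<in> Hom C T E" and y: "y \<in> Hom C T E" and "c \<cdot> x = c \<cdot> y"
    then have "cov T (identified n g (inr B E \<cdot> x) (inr B E \<cdot> y))"
      using qe[OF cq(2)[OF x] cq(2)[OF y]] cq(1)[OF x] cq(1)[OF y] by simp
    then show "x = y"
    proof (rule cov_eq[OF _ x y])
      fix S t assume t: "t \<in> Hom C S T" and i: "identified n g (inr B E \<cdot> x) (inr B E \<cdot> y) t"
      note xt = Comp_in_Hom[OF t x] and yt = Comp_in_Hom[OF t y]
      have a: "(inr B E \<cdot> x) \<cdot> t = inr B E \<cdot> (x \<cdot> t)" "(inr B E \<cdot> y) \<cdot> t = inr B E \<cdot> (y \<cdot> t)"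
        using Comp_assoc[OF t x rB] Comp_assoc[OF t y rB] by simp_all
      show "x \<cdot> t = y \<cdot> t"
        using i n(1) t
      proof (cases rule: identifiedE)
        case 1
        then show ?thesis using inr_mono[OF Ob(2) xt yt] a by simp
      next
        case (2 z z')
        then show ?thesis using inr_n[OF xt 2(1)] inr_n[OF yt 2(2)] a by simp
      qed
    qed
  qed
  have bc_eq: "\<exists>z\<in>Hom C T A. x = m \<cdot> z \<and> y = f \<cdot> z"
    if x: "x \<in> Hom C T B" and y: "y \<in> Hom C T E" and xy: "b \<cdot> x = c \<cdot> y" for T x y
  proof -
    have "cov T (identified n g (inl B E \<cdot> x) (inr B E \<cdot> y))"
      using xy qe[OF bq(2)[OF x] cq(2)[OF y]] bq(1)[OF x] cq(1)[OF y] by simp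
    then have "\<exists>z\<in>Hom C T A. m \<cdot> z = x"
    proof (rule cov_factor_mono[OF _ m(2,1) x])
      fix S t assume t: "t \<in> Hom C S T" and i: "identified n g (inl B E \<cdot> x) (inr B E \<cdot> y) t"
      note xt = Comp_in_Hom[OF t x] and yt = Comp_in_Hom[OF t y]
      have a: "(inl B E \<cdot> x) \<cdot> t = inl B E \<cdot> (x \<cdot> t)" "(inr B E \<cdot> y) \<cdot> t = inr B E \<cdot> (y \<cdot> t)"
        using Comp_assoc[OF t x lB] Comp_assoc[OF t y rB] by simp_all
      show "\<exists>z\<in>Hom C S A. m \<cdot> z = x \<cdot> t"
        using i n(1) t
      proof (cases rule: identifiedE)
        case 1
        then have I: "is_initial C S" using coprod_disjoint[OF xt yt] a by simp
        then obtain z where z: "z \<in> Hom C S A" using initial_Hom_exists Ob(1) by blast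
        show ?thesis using z initial_Hom_unique[OF I Comp_in_Hom[OF z m(1)] xt] by blast
      next
        case (2 z z')
        then show ?thesis using inl_n[OF xt 2(1)] a by auto
      qed
    qed
    then obtain z where z: "z \<in> Hom C T A" "m \<cdot> z = x" by blast
    \<comment> \<open>The cover has produced only the equation for \<open>x\<close>; the one for
      \<open>y\<close> follows by cancelling the monomorphism \<open>c\<close>.\<close>
    have "c \<cdot> y = c \<cdot> (f \<cdot> z)" using comp_eq_comp[OF comm m(1) bc(1) f bc(2) z(1)] z(2) xy by simp
    then have "y = f \<cdot> z" by (rule mono_cancel[OF c_mono bc(2) y Comp_in_Hom[OF z(1) f]])
    with z show ?thesis by blast
  qed
  have bb_eq: "cov T (identified m f x y)"
    if x: "x \<in> Hom C T B" and y: "y \<in> Hom C T B" and xy: "b \<cdot> x = b \<cdot> y" for T x y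
  proof -
    have "cov T (identified n g (inl B E \<cdot> x) (inl B E \<cdot> y))"
      using xy qe[OF bq(2)[OF x] bq(2)[OF y]] bq(1)[OF x] bq(1)[OF y] by simp
    then show ?thesis
    proof (rule cov_mono)
      fix S t assume t: "t \<in> Hom C S T" and i: "identified n g (inl B E \<cdot> x) (inl B E \<cdot> y) t"
      note xt = Comp_in_Hom[OF t x] and yt = Comp_in_Hom[OF t y]
      have a: "(inl B E \<cdot> x) \<cdot> t = inl B E \<cdot> (x \<cdot> t)" "(inl B E \<cdot> y) \<cdot> t = inl B E \<cdot> (y \<cdot> t)"
        using Comp_assoc[OF t x lB] Comp_assoc[OF t y lB] by simp_all
      show "identified m f x y t"
        using i n(1) t
      proof (cases rule: identifiedE)
        case 1
        then have "x \<cdot> t = y \<cdot> t" using inl_mono[OF Ob(3) xt yt] a by simp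
        then show ?thesis by (simp add: identified_def)
      next
        case (2 z z')
        obtain u where u: "u \<in> Hom C S A" "x \<cdot> t = m \<cdot> u" "g \<cdot> z = f \<cdot> u"
          using inl_n[OF xt 2(1)] a 2(3) by auto
        obtain u' where u': "u' \<in> Hom C S A" "y \<cdot> t = m \<cdot> u'" "g \<cdot> z' = f \<cdot> u'"
          using inl_n[OF yt 2(2)] a 2(4) by auto
        show ?thesis using identifiedI[OF m(1) t u(1) u'(1) u(2) u'(2)] u u' 2(5) by simp
      qed
    qed
  qed
  show ?thesis using bc comm c_mono bc_eq bb_eq by blast
qed

end

section \<open>Monomorphisms, epimorphisms and corelations\<close>

lemma (in category) kernel_pair_is_equivalence_relation:
  assumes K: "is_kernel_pair C f R r1 r2" and f: "f \<in> Hom C X Y"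
  shows "is_equivalence_relation C X (R, r1, r2)"
proof -
  have pb: "is_pullback C f f R r1 r2" using K by (simp add: is_kernel_pair_def)
  note r = pullback_Hom[OF pb f f]
  have X: "X \<in> Ob C" using Hom_Ob[OF f] by blast
  note I = Id_in_Hom[OF X]
  have jm: "u = v" if u: "u \<in> Hom C T R" and v: "v \<in> Hom C T R"
      and uv: "r1 \<cdot> u = r1 \<cdot> v" "r2 \<cdot> u = r2 \<cdot> v" for T u v
  proof -
    have "f \<cdot> (r1 \<cdot> v) = f \<cdot> (r2 \<cdot> v)" by (rule comp_eq_comp[OF r(3,1) f r(2) f v])
    from pullback_ump[OF pb f f Comp_in_Hom[OF v r(1)] Comp_in_Hom[OF v r(2)] this]
    show ?thesis using u v uv by blast
  qed
  show ?thesis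
    unfolding is_equivalence_relation_def is_reflexive_relation_def is_relation_def prod.case
  proof (intro conjI allI ballI impI)
    show "\<exists>s\<in>Hom C X R. r1 \<cdot> s = Ide C X \<and> r2 \<cdot> s = Ide C X"
      using pullback_ump[OF pb f f I I refl] by blast
    show "\<exists>s\<in>Hom C R R. r1 \<cdot> s = r2 \<and> r2 \<cdot> s = r1"
      using pullback_ump[OF pb f f r(2,1) r(3)[symmetric]] by blast
  next
    fix P p q assume "is_pullback C r2 r1 P p q"
    note pq = pullback_Hom[OF this r(2,1)]
    have "f \<cdot> (r1 \<cdot> p) = f \<cdot> (r2 \<cdot> p)" by (rule comp_eq_comp[OF r(3,1) f r(2) f pq(1)])
    also have "\<dots> = f \<cdot> (r1 \<cdot> q)" using pq(3) by simp
    also have "\<dots> = f \<cdot> (r2 \<cdot> q)" by (rule comp_eq_comp[OF r(3,1) f r(2) f pq(2)])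
    finally show "\<exists>t\<in>Hom C P R. r1 \<cdot> t = r1 \<cdot> p \<and> r2 \<cdot> t = r2 \<cdot> q"
      using pullback_ump[OF pb f f Comp_in_Hom[OF pq(1) r(1)] Comp_in_Hom[OF pq(2) r(2)]] by blast
  qed (use r jm in blast)+
qed

lemma (in category) coequalizer_op_mono:
  assumes c: "is_coequalizer (op_cat C) f g m"
  shows "is_mono C m"
proof (rule is_monoI)
  have H: "f \<in> Hom C (Cod C m) (Cod C f)" "g \<in> Hom C (Cod C m) (Cod C f)" "f \<cdot> m = g \<cdot> m"
    and m: "m \<in> Hom C (Dom C m) (Cod C m)"
    using c by (auto simp: is_coequalizer_def Hom_def)
  show "m \<in> Hom C (Dom C m) (Cod C m)" by (rule m)
  fix T x y assume x: "x \<in> Hom C T (Dom C m)" and y: "y \<in> Hom C T (Dom C m)" and xy: "m \<cdot> x = m \<cdot> y"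
  have "f \<cdot> (m \<cdot> y) = g \<cdot> (m \<cdot> y)" by (rule comp_eq_comp[OF H(3) m H(1) m H(2) y])
  then have "\<exists>!k. k \<in> Hom (op_cat C) (Dom C m) T \<and> k \<cdot>\<^bsub>op_cat C\<^esub> m = m \<cdot> y"
    using coequalizer_ump[OF c, of "Cod C f" "Cod C m" "Dom C m" "m \<cdot> y" T] H m Comp_in_Hom[OF y m]
      by simp
  then show "x = y" using x y xy by auto
qed

lemma (in category) regular_mono_mono: "is_regular_epi (op_cat C) m \<Longrightarrow> is_mono C m"
  by (auto simp: is_regular_epi_def intro: coequalizer_op_mono)

lemma (in complete_category) equalizer:
  assumes f: "f \<in> Hom C A B" and g: "g \<in> Hom C A B"
  shows "\<exists>E e. is_coequalizer (op_cat C) f g e \<and> e \<in> Hom C E A \<and> is_mono C e \<and> f \<cdot> e = g \<cdot> e \<and>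
    (\<forall>T. \<forall>t\<in>Hom C T A. f \<cdot> t = g \<cdot> t \<longrightarrow> (\<exists>z\<in>Hom C T E. e \<cdot> z = t))"
proof -
  obtain e where e: "is_coequalizer (op_cat C) f g e" using equalizer_exists[OF f g] by blast
  then have eH: "e \<in> Hom C (Dom C e) A" "f \<cdot> e = g \<cdot> e"
      using f by (auto simp: is_coequalizer_def Hom_def)
  have "\<exists>z\<in>Hom C T (Dom C e). e \<cdot> z = t" if "t \<in> Hom C T A" "f \<cdot> t = g \<cdot> t" for T t
    using coequalizer_ump[OF e, of B A "Dom C e" t T] that f eH by auto
  then show ?thesis using e eH coequalizer_op_mono[OF e] by blast
qed

context cocomplete_pretopos
begin

text \<open>Glue two copies of \<open>B\<close> along \<open>m\<close>: an element on which the two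
  legs agree comes from \<open>A\<close>, so \<open>m\<close> is their equalizer.\<close>

lemma mono_is_equalizer:
  assumes m: "m \<in> Hom C A B" "is_mono C m"
  shows "is_regular_epi (op_cat C) m"
proof -
  obtain Q b c where b: "b \<in> Hom C B Q" and c: "c \<in> Hom C B Q" and bm: "b \<cdot> m = c \<cdot> m"
    and eq: "\<And>T x y. x \<in> Hom C T B \<Longrightarrow> y \<in> Hom C T B \<Longrightarrow> b \<cdot> x = c \<cdot> y \<Longrightarrow>
      \<exists>z\<in>Hom C T A. x = m \<cdot> z \<and> y = m \<cdot> z"
    using glue_along_mono[OF m m(1)] by blast
  have "\<exists>!k. k \<in> Hom C X A \<and> m \<cdot> k = h" if h: "h \<in> Hom C X B" "b \<cdot> h = c \<cdot> h" for X h
  proof -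
    obtain z where "z \<in> Hom C X A" "h = m \<cdot> z" using eq[OF h(1,1,2)] by blast
    then show ?thesis using mono_cancel[OF m(2,1)] by (intro ex1I[of _ z]) auto
  qed
  moreover have "b \<in> Ar C" "Dom C b = B" "Cod C b = Q" "m \<in> Ar C" "Dom C m = A" "Cod C m = B"
    using b m by (auto simp: Hom_def)
  ultimately have "is_coequalizer (op_cat C) b c m"
    unfolding is_coequalizer_def using bm c by simp
  then show ?thesis by (auto simp: is_regular_epi_def)
qed

text \<open>The monic part of the image is an equalizer of the two gluing legs. These legs agree
  after \<open>e\<close>, hence are equal, so the monic part is invertible and \<open>e\<close>
  inherits the coequalizer property of the other factor.\<close>

lemma epi_is_regular_epi:
  assumes e: "e \<in> Hom C S T"
    and epi: "\<And>X x y. x \<in> Hom C T X \<Longrightarrow> y \<in> Hom C T X \<Longrightarrow> x \<cdot> e = y \<cdot> e \<Longrightarrow> x = y"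
  shows "is_regular_epi C e"
proof -
  obtain I e' m where e': "e' \<in> Hom C S I" "is_regular_epi C e'"
      and m: "m \<in> Hom C I T" "is_mono C m"
    and me: "m \<cdot> e' = e"
    using image_factorization[OF e] by blast
  obtain Q b c where b: "b \<in> Hom C T Q" and c: "c \<in> Hom C T Q" and bm: "b \<cdot> m = c \<cdot> m"
    and eq: "\<And>X x y. x \<in> Hom C X T \<Longrightarrow> y \<in> Hom C X T \<Longrightarrow> b \<cdot> x = c \<cdot> y \<Longrightarrow>
      \<exists>z\<in>Hom C X I. x = m \<cdot> z \<and> y = m \<cdot> z"
    using glue_along_mono[OF m m(1)] by blast
  have "b \<cdot> e = c \<cdot> e" using comp_eq_comp[OF bm m(1) b m(1) c e'(1)] me by simp
  then have "b = c" by (rule epi[OF b c])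
  have T: "T \<in> Ob C" using Hom_Ob[OF e] by blast
  \<comment> \<open>With equal legs the identity of \<open>T\<close> is equalized by them, so it
    factors through \<open>m\<close>.\<close>
  obtain z where z: "z \<in> Hom C T I" "m \<cdot> z = Ide C T"
    using eq[OF Id_in_Hom[OF T] Id_in_Hom[OF T]] \<open>b = c\<close> by metis
  have I: "I \<in> Ob C" using Hom_Ob[OF m(1)] by blast
  have zm: "z \<cdot> m = Ide C I"
    by (rule mono_cancel[OF m(2,1) Comp_in_Hom[OF m(1) z(1)] Id_in_Hom[OF I]])
      (use Comp_assoc[OF m(1) z(1) m(1)] z(2) Id_left[OF m(1)] Id_right[OF m(1)] in simp)
  obtain f g where fg: "is_coequalizer C f g e'" using e'(2) by (auto simp: is_regular_epi_def)
  then have H: "f \<in> Hom C (Dom C f) S" "g \<in> Hom C (Dom C f) S" "e' \<cdot> f = e' \<cdot> g"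
    using e'(1) by (auto simp: is_coequalizer_def Hom_def)
  have ef: "e \<cdot> f = e \<cdot> g"
    using Comp_assoc[OF H(1) e'(1) m(1)] Comp_assoc[OF H(2) e'(1) m(1)] H(3) me by simp
  have ex: "\<exists>!k. k \<in> Hom C T X \<and> k \<cdot> e = h" if h: "h \<in> Hom C S X" "h \<cdot> f = h \<cdot> g" for X h
  proof -
    obtain k where k: "k \<in> Hom C I X" "k \<cdot> e' = h"
      using coequalizer_ump[OF fg H(1) e'(1) h] by blast
    have "(k \<cdot> z) \<cdot> e = k \<cdot> ((z \<cdot> m) \<cdot> e')"
      using Comp_assoc[OF e z(1) k(1)] Comp_assoc[OF e'(1) m(1) z(1)] me by simp
    then have "(k \<cdot> z) \<cdot> e = h" using zm Id_left[OF e'(1)] k(2) by simp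
    then show ?thesis using epi Comp_in_Hom[OF z(1) k(1)] by (intro ex1I[of _ "k \<cdot> z"]) auto
  qed
  have "Cod C f = S" "Cod C e = T" "Dom C e = S" "f \<in> Ar C" "e \<in> Ar C"
      using H e by (auto simp: Hom_def)
  then have "is_coequalizer C f g e"
    unfolding is_coequalizer_def using H(2) ef ex by simp
  then show ?thesis by (auto simp: is_regular_epi_def)
qed

text \<open>Joint epicness says that the copairing is epic, hence regular epic. This is how a
  universal property of two legs becomes the statement that the legs cover \<open>R\<close>.\<close>

lemma copair_regular_epi:
  assumes r: "r1 \<in> Hom C A R" "r2 \<in> Hom C B R"
    and je: "\<And>Z u v. u \<in> Hom C R Z \<Longrightarrow> v \<in> Hom C R Z \<Longrightarrow> u \<cdot> r1 = v \<cdot> r1 \<Longrightarrow> u \<cdot> r2 = v \<cdot> r2 \<Longrightarrow> u = v"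
  shows "\<exists>e\<in>Hom C (coprod_ob C A B) R. e \<cdot> inl A B = r1 \<and> e \<cdot> inr A B = r2 \<and> is_regular_epi C e"
proof -
  have Ob: "A \<in> Ob C" "B \<in> Ob C" using Hom_Ob r by auto
  obtain e where e: "e \<in> Hom C (coprod_ob C A B) R" "e \<cdot> inl A B = r1" "e \<cdot> inr A B = r2"
    using coprod_copair[OF r] by blast
  have "is_regular_epi C e"
  proof (rule epi_is_regular_epi[OF e(1)])
    fix X x y assume x: "x \<in> Hom C R X" and y: "y \<in> Hom C R X" and xy: "x \<cdot> e = y \<cdot> e"
    have "x \<cdot> r1 = y \<cdot> r1" "x \<cdot> r2 = y \<cdot> r2"
      using Comp_assoc[OF inl_Hom[OF Ob] e(1) x] Comp_assoc[OF inl_Hom[OF Ob] e(1) y]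
        Comp_assoc[OF inr_Hom[OF Ob] e(1) x] Comp_assoc[OF inr_Hom[OF Ob] e(1) y] xy e by simp_all
    then show "x = y" by (rule je[OF x y])
  qed
  with e show ?thesis by blast
qed

text \<open>A cocone \<open>u\<close>, \<open>v\<close> extends to \<open>R\<close> as soon as its
  copairing \<open>w\<close> respects what \<open>e\<close> identifies. The retraction
  \<open>s\<close> recovers an element from its image under either leg, so the only nontrivial case
  is one element in both copies; there the legs agree, the element comes from \<open>A\<close>, and
  \<open>u\<close>, \<open>v\<close> agree on it.\<close>

lemma coreflexive_is_cokernel_pair:
  assumes refl: "is_reflexive_relation (op_cat C) X (R, r1, r2)"
    and a: "a \<in> Hom C A X" "r1 \<cdot> a = r2 \<cdot> a"
    and au: "\<And>T t. t \<in> Hom C T X \<Longrightarrow> r1 \<cdot> t = r2 \<cdot> t \<Longrightarrow> \<exists>z\<in>Hom C T A. a \<cdot> z = t"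
  shows "is_kernel_pair (op_cat C) a R r1 r2"
proof -
  have r: "r1 \<in> Hom C X R" "r2 \<in> Hom C X R"
    and je: "\<And>Z u v. u \<in> Hom C R Z \<Longrightarrow> v \<in> Hom C R Z \<Longrightarrow> u \<cdot> r1 = v \<cdot> r1 \<Longrightarrow> u \<cdot> r2 = v \<cdot> r2 \<Longrightarrow> u = v"
    using refl by (auto simp: is_reflexive_relation_def is_relation_def)
  obtain s where s: "s \<in> Hom C R X" "s \<cdot> r1 = Ide C X" "s \<cdot> r2 = Ide C X"
    using refl by (auto simp: is_reflexive_relation_def)
  have X: "X \<in> Ob C" using Hom_Ob[OF s(1)] by blast
  note l = inl_Hom[OF X X] and ri = inr_Hom[OF X X]
  obtain e where e: "e \<in> Hom C (coprod_ob C X X) R" "e \<cdot> inl X X = r1" "e \<cdot> inr X X = r2"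
      "is_regular_epi C e"
    using copair_regular_epi[OF r] je by metis
  obtain f g where fg: "is_coequalizer C f g e" using e(4) by (auto simp: is_regular_epi_def)
  define W where "W = Dom C f"
  have H: "f \<in> Hom C W (coprod_ob C X X)" "g \<in> Hom C W (coprod_ob C X X)" "e \<cdot> f = e \<cdot> g"
    using fg e(1) by (auto simp: is_coequalizer_def Hom_def W_def)
  have ex: "\<exists>!h. h \<in> Hom C R Z \<and> h \<cdot> r1 = u \<and> h \<cdot> r2 = v"
    if u: "u \<in> Hom C X Z" and v: "v \<in> Hom C X Z" and uv: "u \<cdot> a = v \<cdot> a" for Z u v
  proof -
    obtain w where w: "w \<in> Hom C (coprod_ob C X X) Z" "w \<cdot> inl X X = u" "w \<cdot> inr X X = v"
      using coprod_copair[OF u v] by blast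
    have key: "w \<cdot> p = w \<cdot> q"
      if cp: "(\<exists>x\<in>Hom C S X. p = inl X X \<cdot> x) \<or> (\<exists>x\<in>Hom C S X. p = inr X X \<cdot> x)"
        and cq: "(\<exists>x\<in>Hom C S X. q = inl X X \<cdot> x) \<or> (\<exists>x\<in>Hom C S X. q = inr X X \<cdot> x)"
        and pq: "e \<cdot> p = e \<cdot> q" for p q S
    proof -
      have el: "e \<cdot> (inl X X \<cdot> x) = r1 \<cdot> x" "w \<cdot> (inl X X \<cdot> x) = u \<cdot> x" "s \<cdot> (r1 \<cdot> x) = x"
          if "x \<in> Hom C S X" for x
        using Comp_assoc[OF that l e(1)] Comp_assoc[OF that l w(1)]
          Comp_assoc[OF that r(1) s(1)] e w s Id_left[OF that]
        by simp_all
      have er: "e \<cdot> (inr X X \<cdot> x) = r2 \<cdot> x" "w \<cdot> (inr X X \<cdot> x) = v \<cdot> x" "s \<cdot> (r2 \<cdot> x) = x"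
          if "x \<in> Hom C S X" for x
        using Comp_assoc[OF that ri e(1)] Comp_assoc[OF that ri w(1)]
          Comp_assoc[OF that r(2) s(1)] e w s Id_left[OF that]
        by simp_all
      have uv': "u \<cdot> x = v \<cdot> x" if x: "x \<in> Hom C S X" "r1 \<cdot> x = r2 \<cdot> x" for x
      proof -
        obtain z where z: "z \<in> Hom C S A" "a \<cdot> z = x" using au[OF x] by blast
        show ?thesis using comp_eq_comp[OF uv a(1) u a(1) v z(1)] z(2) by simp
      qed
      from cp cq consider
          x y where "x \<in> Hom C S X" "y \<in> Hom C S X" "p = inl X X \<cdot> x" "q = inl X X \<cdot> y"
        | x y where "x \<in> Hom C S X" "y \<in> Hom C S X" "p = inl X X \<cdot> x" "q = inr X X \<cdot> y"
        | x y where "x \<in> Hom C S X" "y \<in> Hom C S X" "p = inr X X \<cdot> x" "q = inl X X \<cdot> y"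
        | x y where "x \<in> Hom C S X" "y \<in> Hom C S X" "p = inr X X \<cdot> x" "q = inr X X \<cdot> y"
        by blast
      then show ?thesis
      proof cases
        case 1
        then have "r1 \<cdot> x = r1 \<cdot> y" using pq el by simp
        then have "x = y" using el(3)[OF 1(1)] el(3)[OF 1(2)] by metis
        then show ?thesis using 1 by simp
      next
        case 2
        then have eq: "r1 \<cdot> x = r2 \<cdot> y" using pq el er by simp
        then have "x = y" using el(3)[OF 2(1)] er(3)[OF 2(2)] by metis
        then show ?thesis using 2 eq uv'[OF 2(1)] el er by simp
      next
        case 3
        then have eq: "r2 \<cdot> x = r1 \<cdot> y" using pq el er by simp
        then have "x = y" using er(3)[OF 3(1)] el(3)[OF 3(2)] by metis
        then show ?thesis using 3 eq uv'[OF 3(1)] el er by simp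
      next
        case 4
        then have "r2 \<cdot> x = r2 \<cdot> y" using pq er by simp
        then have "x = y" using er(3)[OF 4(1)] er(3)[OF 4(2)] by metis
        then show ?thesis using 4 by simp
      qed
    qed
    \<comment> \<open>\<open>f\<close> and \<open>g\<close> are two elements of the coproduct at
      stage \<open>W\<close>. On a common cover both lie in summands, where \<open>key\<close>
      applies.\<close>
    have "w \<cdot> f = w \<cdot> g"
    proof (rule cov_eq[OF cov_coprod2[OF X X H(1,2)] Comp_in_Hom[OF H(1) w(1)]
        Comp_in_Hom[OF H(2) w(1)]], elim conjE)
      fix S t assume t: "t \<in> Hom C S W" and
        c: "(\<exists>x\<in>Hom C (Dom C t) X. f \<cdot> t = inl X X \<cdot> x) \<or>
            (\<exists>x\<in>Hom C (Dom C t) X. f \<cdot> t = inr X X \<cdot> x)"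
          "(\<exists>x\<in>Hom C (Dom C t) X. g \<cdot> t = inl X X \<cdot> x) \<or>
              (\<exists>x\<in>Hom C (Dom C t) X. g \<cdot> t = inr X X \<cdot> x)"
      show "(w \<cdot> f) \<cdot> t = (w \<cdot> g) \<cdot> t"
        using key[OF c comp_eq_comp[OF H(3,1) e(1) H(2) e(1) t]] Comp_assoc[OF t H(1) w(1)]
          Comp_assoc[OF t H(2) w(1)]
        by simp
    qed
    then obtain h where h: "h \<in> Hom C R Z" "h \<cdot> e = w"
      using coequalizer_ump[OF fg H(1) e(1) w(1)] by blast
    have "h \<cdot> r1 = u" "h \<cdot> r2 = v"
      using Comp_assoc[OF l e(1) h(1)] Comp_assoc[OF ri e(1) h(1)] e w h by simp_all
    then show ?thesis using h(1) je by (intro ex1I[of _ h]) auto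
  qed
  have "a \<in> Ar C" "Cod C a = X" using a by (auto simp: Hom_def)
  then show ?thesis
    unfolding is_kernel_pair_def is_pullback_def using r a(2) ex by simp
qed

lemma coreflexive_effective:
  assumes refl: "is_reflexive_relation (op_cat C) X (R, r1, r2)"
  shows "\<exists>A a. a \<in> Hom C A X \<and> is_mono C a \<and> r1 \<cdot> a = r2 \<cdot> a \<and>
    (\<forall>T. \<forall>t\<in>Hom C T X. r1 \<cdot> t = r2 \<cdot> t \<longrightarrow> (\<exists>z\<in>Hom C T A. a \<cdot> z = t)) \<and>
    is_kernel_pair (op_cat C) a R r1 r2"
proof -
  have r: "r1 \<in> Hom C X R" "r2 \<in> Hom C X R"
    using refl by (auto simp: is_reflexive_relation_def is_relation_def)
  obtain A a where "a \<in> Hom C A X" "is_mono C a" "r1 \<cdot> a = r2 \<cdot> a"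
    "\<And>T t. t \<in> Hom C T X \<Longrightarrow> r1 \<cdot> t = r2 \<cdot> t \<Longrightarrow> \<exists>z\<in>Hom C T A. a \<cdot> z = t"
    using equalizer[OF r] by blast
  then show ?thesis using coreflexive_is_cokernel_pair[OF refl] by blast
qed

text \<open>A kernel pair is an equivalence relation in any category, so recognizing a reflexive
  relation as a kernel pair settles symmetry and transitivity together.\<close>

lemma maltsev_op_cat: "maltsev_category (op_cat C)"
proof (intro maltsev_category.intro maltsev_category_axioms.intro)
  show "category (op_cat C)" by (rule category_op_cat)
  show "finitely_complete (op_cat C)" by (rule finitely_complete_op_cat[OF cocomplete])
  fix X R r1 r2 assume "is_reflexive_relation (op_cat C) X (R, r1, r2)"
  from coreflexive_effective[OF this] obtain A a
      where "a \<in> Hom C A X" "is_kernel_pair (op_cat C) a R r1 r2"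
    by blast
  then show "is_equivalence_relation (op_cat C) X (R, r1, r2)"
    using category.kernel_pair_is_equivalence_relation[OF category_op_cat, of a R r1 r2 X A] by simp
qed

text \<open>The comparison \<open>h\<close> to the glued object carries equalities between elements
  of \<open>P\<close> to equalities between their images in \<open>Q\<close>, where the explicit
  description applies.\<close>

lemma pushout_mono:
  assumes m: "m \<in> Hom C A B" "is_mono C m" and f: "f \<in> Hom C A E"
    and po: "is_pullback (op_cat C) f m P p q"
  shows "p \<in> Hom C E P" "q \<in> Hom C B P" "p \<cdot> f = q \<cdot> m" "is_mono C p"
    "x \<in> Hom C T B \<Longrightarrow> y \<in> Hom C T E \<Longrightarrow> q \<cdot> x = p \<cdot> y \<Longrightarrow> \<exists>z\<in>Hom C T A. x = m \<cdot> z \<and> y = f \<cdot> z"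
    "x \<in> Hom C T B \<Longrightarrow> x' \<in> Hom C T B \<Longrightarrow> q \<cdot> x = q \<cdot> x' \<Longrightarrow> cov T (identified m f x x')"
proof -
  show p: "p \<in> Hom C E P" and q: "q \<in> Hom C B P" and "p \<cdot> f = q \<cdot> m"
    using pullback_Hom[OF po, of E A B] f m by simp_all
  obtain Q b c where b: "b \<in> Hom C B Q" and c: "c \<in> Hom C E Q" "is_mono C c" and bm: "b \<cdot> m = c \<cdot> f"
    and bc: "\<And>T x y. x \<in> Hom C T B \<Longrightarrow> y \<in> Hom C T E \<Longrightarrow> b \<cdot> x = c \<cdot> y \<Longrightarrow> \<exists>z\<in>Hom C T A. x = m \<cdot> z \<and>
        y = f \<cdot> z"
    and bb: "\<And>T x y. x \<in> Hom C T B \<Longrightarrow> y \<in> Hom C T B \<Longrightarrow> b \<cdot> x = b \<cdot> y \<Longrightarrow> cov T (identified m f x y)"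
    using glue_along_mono[OF m f] by blast
  obtain h where h: "h \<in> Hom C P Q" "h \<cdot> p = c" "h \<cdot> q = b"
    using pullback_ump[OF po, of E A B c Q b] f m c b bm by auto
  have hp: "h \<cdot> (p \<cdot> y) = c \<cdot> y" if "y \<in> Hom C T E" for T y using Comp_assoc[OF that p h(1)] h(2)
      by simp
  have hq: "h \<cdot> (q \<cdot> y) = b \<cdot> y" if "y \<in> Hom C T B" for T y using Comp_assoc[OF that q h(1)] h(3)
      by simp
  show "is_mono C p"
  proof (rule is_monoI[OF p])
    fix T x y assume xy: "x \<in> Hom C T E" "y \<in> Hom C T E" "p \<cdot> x = p \<cdot> y"
    then have "c \<cdot> x = c \<cdot> y" using hp[OF xy(1)] hp[OF xy(2)] by simp
    then show "x = y" by (rule mono_cancel[OF c(2,1) xy(1,2)])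
  qed
  show "\<exists>z\<in>Hom C T A. x = m \<cdot> z \<and> y = f \<cdot> z" if xy: "x \<in> Hom C T B" "y \<in> Hom C T E" "q \<cdot> x = p \<cdot> y"
    using bc[OF xy(1,2)] hq[OF xy(1)] hp[OF xy(2)] xy(3) by simp
  show "cov T (identified m f x x')" if xy: "x \<in> Hom C T B" "x' \<in> Hom C T B" "q \<cdot> x = q \<cdot> x'"
    using bb[OF xy(1,2)] hq[OF xy(1)] hq[OF xy(2)] xy(3) by simp
qed

text \<open>Regular epimorphisms of the opposite category are the monomorphisms of \<open>C\<close>,
  so their stability is stability of monomorphisms under pushout. Coequalizers of kernel pairs are
  equalizers in \<open>C\<close>, and effectiveness holds already for reflexive relations.\<close>

lemma exact_op_cat: "exact_category (op_cat C)"
proof (intro exact_category.intro regular_category.intro regular_category_axioms.intro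
    exact_category_axioms.intro)
  show "category (op_cat C)" by (rule category_op_cat)
  show "finitely_complete (op_cat C)" by (rule finitely_complete_op_cat[OF cocomplete])
next
  fix f R r1 r2 assume "is_kernel_pair (op_cat C) f R r1 r2"
  then have "r1 \<in> Hom C (Cod C f) R" "r2 \<in> Hom C (Cod C f) R"
    by (auto simp: is_kernel_pair_def is_pullback_def)
  then show "\<exists>q. is_coequalizer (op_cat C) r1 r2 q" by (rule equalizer_exists)
next
  fix m f P p q assume m: "is_regular_epi (op_cat C) m" and po: "is_pullback (op_cat C) f m P p q"
  have mH: "m \<in> Hom C (Dom C m) (Cod C m)" "f \<in> Hom C (Dom C m) (Cod C f)"
    using po by (auto simp: is_pullback_def Hom_def)
  have mm: "is_mono C m" by (rule regular_mono_mono[OF m])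
  show "is_regular_epi (op_cat C) p"
    using mono_is_equalizer pushout_mono(1,4)[OF mH(1) mm mH(2) po] by blast
next
  fix X R r1 r2 assume "is_equivalence_relation (op_cat C) X (R, r1, r2)"
  then have "is_reflexive_relation (op_cat C) X (R, r1, r2)"
      by (simp add: is_equivalence_relation_def)
  from coreflexive_effective[OF this] show "\<exists>f. is_kernel_pair (op_cat C) f R r1 r2" by blast
qed

end

section \<open>The lattice of equivalence relations\<close>

text \<open>The order is read off, reversed, from sets \<open>A x\<close>: joins become
  intersections and meets become \<open>U\<close>. The operation \<open>U\<close> stays abstract
  because the elements of a union of subobjects form more than the set-theoretic union.\<close>

lemma weak_distributive_latticeI:
  fixes L :: "'x gorder" (structure) and A :: "'x \<Rightarrow> 't set" and U :: "'t set \<Rightarrow> 't set \<Rightarrow> 't set"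
  assumes le: "\<And>x y. x \<in> carrier L \<Longrightarrow> y \<in> carrier L \<Longrightarrow> x \<sqsubseteq> y \<longleftrightarrow> A y \<subseteq> A x"
    and eq: "\<And>x y. x \<in> carrier L \<Longrightarrow> y \<in> carrier L \<Longrightarrow> x .= y \<longleftrightarrow> A x = A y"
    and join: "\<And>x y. x \<in> carrier L \<Longrightarrow> y \<in> carrier L \<Longrightarrow> \<exists>z\<in>carrier L. A z = A x \<inter> A y"
    and meet: "\<And>x y. x \<in> carrier L \<Longrightarrow> y \<in> carrier L \<Longrightarrow> \<exists>z\<in>carrier L. A z = U (A x) (A y)"
    and U_upper: "\<And>x y. x \<in> carrier L \<Longrightarrow> y \<in> carrier L \<Longrightarrow> A x \<subseteq> U (A x) (A y) \<and> A y \<subseteq> U (A x) (A y)"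
    and U_least: "\<And>x y z. x \<in> carrier L \<Longrightarrow> y \<in> carrier L \<Longrightarrow> z \<in> carrier L \<Longrightarrow>
      A x \<subseteq> A z \<Longrightarrow> A y \<subseteq> A z \<Longrightarrow> U (A x) (A y) \<subseteq> A z"
    and distrib: "\<And>x y z. x \<in> carrier L \<Longrightarrow> y \<in> carrier L \<Longrightarrow> z \<in> carrier L \<Longrightarrow>
      U (A x) (A y \<inter> A z) = U (A x) (A y) \<inter> U (A x) (A z)"
  shows "weak_distributive_lattice L"
proof -
  have "weak_partial_order L"
  proof
    show "x \<sqsubseteq> z \<longleftrightarrow> y \<sqsubseteq> w" if "x .= y" "z .= w" "x \<in> carrier L" "y \<in> carrier L" "z \<in> carrier L"
        "w \<in> carrier L"
      for x y z w
      using that by (simp add: le eq)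
  qed (auto simp: le eq)
  then interpret weak_partial_order L .
  have "weak_lattice L"
  proof
    fix x y assume xy: "x \<in> carrier L" "y \<in> carrier L"
    obtain z where z: "z \<in> carrier L" "A z = A x \<inter> A y" using join[OF xy] by blast
    have "least L z (Upper L {x, y})"
    proof (rule least_UpperI)
      fix v assume "v \<in> Upper L {x, y}"
      then have "v \<in> carrier L" "x \<sqsubseteq> v" "y \<sqsubseteq> v" using xy by (auto simp: Upper_def)
      then show "z \<sqsubseteq> v" using xy z by (simp add: le)
    qed (use xy z in \<open>auto simp: le\<close>)
    then show "\<exists>s. least L s (Upper L {x, y})" by blast
    obtain w where w: "w \<in> carrier L" "A w = U (A x) (A y)" using meet[OF xy] by blast
    have "greatest L w (Lower L {x, y})"
    proof (rule greatest_LowerI)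
      fix v assume "v \<in> Lower L {x, y}"
      then have "v \<in> carrier L" "v \<sqsubseteq> x" "v \<sqsubseteq> y" using xy by (auto simp: Lower_def)
      then show "v \<sqsubseteq> w" using xy w U_least by (simp add: le)
    qed (use xy w U_upper[OF xy] in \<open>auto simp: le\<close>)
    then show "\<exists>s. greatest L s (Lower L {x, y})" by blast
  qed
  then interpret weak_lattice L .
  have A_join: "A (x \<squnion> y) = A x \<inter> A y" if xy: "x \<in> carrier L" "y \<in> carrier L" for x y
  proof -
    obtain z where z: "z \<in> carrier L" "A z = A x \<inter> A y" using join[OF xy] by blast
    have "x \<squnion> y \<sqsubseteq> z" using xy z by (intro join_le) (auto simp: le)
    then have "A z \<subseteq> A (x \<squnion> y)" using xy z(1) by (simp add: le)
    moreover have "A (x \<squnion> y) \<subseteq> A x" "A (x \<squnion> y) \<subseteq> A y"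
      using join_left[OF xy] join_right[OF xy] xy by (simp_all add: le)
    ultimately show ?thesis using z(2) by blast
  qed
  have A_meet: "A (x \<sqinter> y) = U (A x) (A y)" if xy: "x \<in> carrier L" "y \<in> carrier L" for x y
  proof -
    obtain z where z: "z \<in> carrier L" "A z = U (A x) (A y)" using meet[OF xy] by blast
    have "z \<sqsubseteq> x \<sqinter> y" using xy z U_upper[OF xy] by (intro meet_le) (auto simp: le)
    then have "A (x \<sqinter> y) \<subseteq> A z" using xy z(1) by (simp add: le)
    moreover have "A x \<subseteq> A (x \<sqinter> y)" "A y \<subseteq> A (x \<sqinter> y)"
      using meet_left[OF xy] meet_right[OF xy] xy by (simp_all add: le)
    then have "U (A x) (A y) \<subseteq> A (x \<sqinter> y)" using U_least xy by simp
    ultimately show ?thesis using z(2) by blast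
  qed
  show ?thesis
  proof
    fix x y z assume "x \<in> carrier L" "y \<in> carrier L" "z \<in> carrier L"
    then show "x \<sqinter> (y \<squnion> z) .= (x \<sqinter> y) \<squnion> (x \<sqinter> z)"
      by (simp add: eq A_join A_meet distrib)
  qed
qed

context cocomplete_pretopos
begin

text \<open>An equivalence relation on \<open>X\<close> in the opposite category is the cokernel pair of the subobject on which
  its two legs agree; the order is reversed by this correspondence.\<close>

definition agree :: "'a \<Rightarrow> 'a \<times> 'b \<times> 'b \<Rightarrow> 'b set" where
  "agree X = (\<lambda>(R, r1, r2). {t \<in> Ar C. Cod C t = X \<and> r1 \<cdot> t = r2 \<cdot> t})"

lemma agree_iff: "t \<in> Hom C T X \<Longrightarrow> t \<in> agree X (R, r1, r2) \<longleftrightarrow> r1 \<cdot> t = r2 \<cdot> t"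
  by (auto simp: agree_def Hom_def)

text \<open>Makes these sets sieves, so that membership survives refining a cover.\<close>

lemma agree_comp:
  assumes "is_equivalence_relation (op_cat C) X E" "t \<in> agree X E" "t \<in> Hom C T X" "s \<in> Hom C S T"
  shows "t \<cdot> s \<in> agree X E"
proof -
  obtain R r1 r2 where E: "E = (R, r1, r2)" by (cases E) auto
  then have r: "r1 \<in> Hom C X R" "r2 \<in> Hom C X R"
    using assms(1) by (auto simp: is_equivalence_relation_def is_reflexive_relation_def
      is_relation_def)
  have "r1 \<cdot> t = r2 \<cdot> t" using assms(2,3) agree_iff E by blast
  from comp_eq_comp[OF this assms(3) r(1) assms(3) r(2) assms(4)]
  show ?thesis using agree_iff[OF Comp_in_Hom[OF assms(4,3)]] E by blast
qed

text \<open>A comparison map carries agreement of the legs of \<open>F\<close> to agreement of those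
  of \<open>E\<close>. Conversely, \<open>F\<close> is the cokernel pair of the subobject
  \<open>a\<close> on which its legs agree; if the legs of \<open>E\<close> agree on
  \<open>a\<close> as well, they factor through that cokernel pair.\<close>

lemma relation_le_iff_agree:
  assumes E: "is_equivalence_relation (op_cat C) X E"
      and F: "is_equivalence_relation (op_cat C) X F"
  shows "relation_le (op_cat C) E F \<longleftrightarrow> agree X F \<subseteq> agree X E"
proof -
  obtain R r1 r2 where ER: "E = (R, r1, r2)" by (cases E) auto
  obtain S s1 s2 where FS: "F = (S, s1, s2)" by (cases F) auto
  have r: "r1 \<in> Hom C X R" "r2 \<in> Hom C X R"
    using E by (auto simp: is_equivalence_relation_def is_reflexive_relation_def is_relation_def ER)
  have s: "s1 \<in> Hom C X S" "s2 \<in> Hom C X S"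
    using F by (auto simp: is_equivalence_relation_def is_reflexive_relation_def is_relation_def FS)
  have "is_reflexive_relation (op_cat C) X (S, s1, s2)"
    using F by (simp add: is_equivalence_relation_def FS)
  from coreflexive_effective[OF this] obtain A a where a: "a \<in> Hom C A X" "s1 \<cdot> a = s2 \<cdot> a"
    and K: "is_pullback (op_cat C) a a S s1 s2"
    unfolding is_kernel_pair_def by blast
  have "(\<exists>h\<in>Hom C S R. h \<cdot> s1 = r1 \<and> h \<cdot> s2 = r2) \<longleftrightarrow> agree X F \<subseteq> agree X E"
  proof
    assume "\<exists>h\<in>Hom C S R. h \<cdot> s1 = r1 \<and> h \<cdot> s2 = r2"
    then obtain h where h: "h \<in> Hom C S R" "h \<cdot> s1 = r1" "h \<cdot> s2 = r2" by blast
    show "agree X F \<subseteq> agree X E"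
    proof
      fix t assume "t \<in> agree X F"
      then have t: "t \<in> Hom C (Dom C t) X" "s1 \<cdot> t = s2 \<cdot> t" by (auto simp: agree_def Hom_def FS)
      have "r1 \<cdot> t = r2 \<cdot> t" using Comp_assoc[OF t(1) s(1) h(1)]
          Comp_assoc[OF t(1) s(2) h(1)] h t(2) by simp
      then show "t \<in> agree X E" using agree_iff[OF t(1)] ER by blast
    qed
  next
    assume le: "agree X F \<subseteq> agree X E"
    have "a \<in> agree X F" using agree_iff[OF a(1)] a(2) FS by blast
    then have "a \<in> agree X E" using le by blast
    then have "r1 \<cdot> a = r2 \<cdot> a" using agree_iff[OF a(1)] ER by blast
    then show "\<exists>h\<in>Hom C S R. h \<cdot> s1 = r1 \<and> h \<cdot> s2 = r2"
      using pullback_ump[OF K, of X A X r1 R r2] a(1) r by auto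
  qed
  then show ?thesis by (simp add: relation_le_def ER FS)
qed

text \<open>Take the cokernel pair of \<open>a\<close>. The description of pushouts along a
  monomorphism shows that its legs agree on nothing beyond \<open>A\<close>.\<close>

lemma equivalence_relation_of_mono:
  assumes a: "a \<in> Hom C A X" "is_mono C a"
  shows "\<exists>E. is_equivalence_relation (op_cat C) X E \<and>
    agree X E = {t \<in> Ar C. Cod C t = X \<and> (\<exists>z\<in>Hom C (Dom C t) A. a \<cdot> z = t)}"
proof -
  obtain R r1 r2 where K: "is_pullback (op_cat C) a a R r1 r2"
    using complete_category.pullback_exists[OF complete_category_op_cat, of a X A a X] a(1) by auto
  note r = pushout_mono[OF a a(1) K]
  have "r1 \<cdot> t = r2 \<cdot> t \<longleftrightarrow> (\<exists>z\<in>Hom C T A. a \<cdot> z = t)" if t: "t \<in> Hom C T X" for T t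
  proof
    assume "r1 \<cdot> t = r2 \<cdot> t"
    then show "\<exists>z\<in>Hom C T A. a \<cdot> z = t" using r(5)[OF t t] by auto
  next
    assume "\<exists>z\<in>Hom C T A. a \<cdot> z = t"
    then show "r1 \<cdot> t = r2 \<cdot> t" using comp_eq_comp[OF r(3) a(1) r(1) a(1) r(2)] by auto
  qed
  then have "agree X (R, r1, r2) = {t \<in> Ar C. Cod C t = X \<and> (\<exists>z\<in>Hom C (Dom C t) A. a \<cdot> z = t)}"
    unfolding agree_def by (auto simp: Hom_def)
  moreover have "is_equivalence_relation (op_cat C) X (R, r1, r2)"
    using category.kernel_pair_is_equivalence_relation[OF category_op_cat, of a R r1 r2 X A] K a(1)
    by (simp add: is_kernel_pair_def)
  ultimately show ?thesis by blast
qed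

lemma equivalence_relation_mono:
  assumes E: "is_equivalence_relation (op_cat C) X E"
  shows "\<exists>A a. a \<in> Hom C A X \<and> is_mono C a \<and>
    agree X E = {t \<in> Ar C. Cod C t = X \<and> (\<exists>z\<in>Hom C (Dom C t) A. a \<cdot> z = t)}"
proof -
  obtain R r1 r2 where ER: "E = (R, r1, r2)" by (cases E) auto
  have r: "r1 \<in> Hom C X R" "r2 \<in> Hom C X R"
    using E by (auto simp: is_equivalence_relation_def is_reflexive_relation_def is_relation_def ER)
  have "is_reflexive_relation (op_cat C) X (R, r1, r2)"
    using E by (simp add: is_equivalence_relation_def ER)
  from coreflexive_effective[OF this] obtain A a
      where a: "a \<in> Hom C A X" "is_mono C a" "r1 \<cdot> a = r2 \<cdot> a"
    and au: "\<And>T t. t \<in> Hom C T X \<Longrightarrow> r1 \<cdot> t = r2 \<cdot> t \<Longrightarrow> \<exists>z\<in>Hom C T A. a \<cdot> z = t"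
    by blast
  have "r1 \<cdot> t = r2 \<cdot> t \<longleftrightarrow> (\<exists>z\<in>Hom C T A. a \<cdot> z = t)" if t: "t \<in> Hom C T X" for T t
    using au[OF t] comp_eq_comp[OF a(3,1) r(1) a(1) r(2)] by auto
  then have "agree X (R, r1, r2) = {t \<in> Ar C. Cod C t = X \<and> (\<exists>z\<in>Hom C (Dom C t) A. a \<cdot> z = t)}"
    unfolding agree_def by (auto simp: Hom_def)
  with a ER show ?thesis by blast
qed

text \<open>The elements of a union of subobjects: each piece of a cover may lie in a different one,
  so membership is required only locally.\<close>

definition local_union :: "'a \<Rightarrow> 'b set \<Rightarrow> 'b set \<Rightarrow> 'b set" where
  "local_union X V W = {t \<in> Ar C. Cod C t = X \<and> cov (Dom C t) (\<lambda>s. t \<cdot> s \<in> V \<or> t \<cdot> s \<in> W)}"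

lemma weak_distributive_lattice_op_cat:
  assumes X: "X \<in> Ob C"
  shows "weak_distributive_lattice (equivalence_relations (op_cat C) X)"
proof (rule weak_distributive_latticeI[where A = "agree X" and U = "local_union X"])
  let ?L = "equivalence_relations (op_cat C) X" and ?A = "agree X" and ?U = "local_union X"
  have car: "E \<in> carrier ?L \<longleftrightarrow> is_equivalence_relation (op_cat C) X E" for E
    by (simp add: equivalence_relations_def)
  have AH: "t \<in> Hom C (Dom C t) X" if "t \<in> ?A E" for t E using that
      by (cases E) (auto simp: agree_def Hom_def)
  show le: "x \<sqsubseteq>\<^bsub>?L\<^esub> y \<longleftrightarrow> ?A y \<subseteq> ?A x" if "x \<in> carrier ?L" "y \<in> carrier ?L" for x y
    using that relation_le_iff_agree[of X x y]
      by (simp add: car) (simp add: equivalence_relations_def)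
  show "x .=\<^bsub>?L\<^esub> y \<longleftrightarrow> ?A x = ?A y" if "x \<in> carrier ?L" "y \<in> carrier ?L" for x y
    using that relation_le_iff_agree[of X x y] relation_le_iff_agree[of X y x]
    by (simp add: car) (auto simp: equivalence_relations_def)
  fix x y assume x: "x \<in> carrier ?L" and y: "y \<in> carrier ?L"
  obtain A a where a: "a \<in> Hom C A X" "is_mono C a"
    "?A x = {t \<in> Ar C. Cod C t = X \<and> (\<exists>z\<in>Hom C (Dom C t) A. a \<cdot> z = t)}"
    using equivalence_relation_mono x unfolding car by blast
  obtain B b where b: "b \<in> Hom C B X" "is_mono C b"
    "?A y = {t \<in> Ar C. Cod C t = X \<and> (\<exists>z\<in>Hom C (Dom C t) B. b \<cdot> z = t)}"
    using equivalence_relation_mono y unfolding car by blast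
  \<comment> \<open>The intersection of the subobjects is their pullback, included into
    \<open>X\<close> by \<open>a \<cdot> p\<close>.\<close>
  show "\<exists>z\<in>carrier ?L. ?A z = ?A x \<inter> ?A y"
  proof -
    obtain P p q where pb: "is_pullback C a b P p q" using pullback_exists[OF a(1) b(1)] by blast
    note pq = pullback_Hom[OF pb a(1) b(1)]
    have ap: "a \<cdot> p \<in> Hom C P X" by (rule Comp_in_Hom[OF pq(1) a(1)])
    have "is_mono C (a \<cdot> p)"
    proof (rule is_monoI[OF ap])
      fix T u v assume u: "u \<in> Hom C T P" and v: "v \<in> Hom C T P" and "(a \<cdot> p) \<cdot> u = (a \<cdot> p) \<cdot> v"
      then have *: "a \<cdot> (p \<cdot> u) = a \<cdot> (p \<cdot> v)" using Comp_assoc[OF u pq(1) a(1)]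
          Comp_assoc[OF v pq(1) a(1)] by simp
      then have pu: "p \<cdot> u = p \<cdot> v" by (rule mono_cancel[OF a(2,1) Comp_in_Hom[OF u pq(1)]
          Comp_in_Hom[OF v pq(1)]])
      have "b \<cdot> (q \<cdot> u) = b \<cdot> (q \<cdot> v)"
        using comp_eq_comp[OF pq(3,1) a(1) pq(2) b(1) u] comp_eq_comp[OF pq(3,1) a(1) pq(2) b(1) v]
          * by simp
      then have qu: "q \<cdot> u = q \<cdot> v" by (rule mono_cancel[OF b(2,1) Comp_in_Hom[OF u pq(2)]
          Comp_in_Hom[OF v pq(2)]])
      show "u = v"
        using pullback_ump[OF pb a(1) b(1) Comp_in_Hom[OF v pq(1)] Comp_in_Hom[OF v pq(2)]
            comp_eq_comp[OF pq(3,1) a(1) pq(2) b(1) v]] u v pu qu by blast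
    qed
    then obtain E where E: "is_equivalence_relation (op_cat C) X E"
      "?A E = {t \<in> Ar C. Cod C t = X \<and> (\<exists>z\<in>Hom C (Dom C t) P. (a \<cdot> p) \<cdot> z = t)}"
      using equivalence_relation_of_mono[OF ap] by blast
    have "(\<exists>z\<in>Hom C T P. (a \<cdot> p) \<cdot> z = t) \<longleftrightarrow> (\<exists>z\<in>Hom C T A. a \<cdot> z = t) \<and> (\<exists>z\<in>Hom C T B. b \<cdot> z = t)"
        for T t
    proof
      assume "\<exists>z\<in>Hom C T P. (a \<cdot> p) \<cdot> z = t"
      then obtain z where z: "z \<in> Hom C T P" "(a \<cdot> p) \<cdot> z = t" by blast
      then have "a \<cdot> (p \<cdot> z) = t" "b \<cdot> (q \<cdot> z) = t"
        using Comp_assoc[OF z(1) pq(1) a(1)] comp_eq_comp[OF pq(3,1) a(1) pq(2) b(1) z(1)]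
          by simp_all
      then show "(\<exists>z\<in>Hom C T A. a \<cdot> z = t) \<and> (\<exists>z\<in>Hom C T B. b \<cdot> z = t)"
        using Comp_in_Hom[OF z(1) pq(1)] Comp_in_Hom[OF z(1) pq(2)] by blast
    next
      assume "(\<exists>z\<in>Hom C T A. a \<cdot> z = t) \<and> (\<exists>z\<in>Hom C T B. b \<cdot> z = t)"
      then obtain z z' where z: "z \<in> Hom C T A" "z' \<in> Hom C T B" "a \<cdot> z = t" "b \<cdot> z' = t" by blast
      then obtain w where w: "w \<in> Hom C T P" "p \<cdot> w = z"
        using pullback_ump[OF pb a(1) b(1) z(1,2)] by auto
      then show "\<exists>z\<in>Hom C T P. (a \<cdot> p) \<cdot> z = t" using Comp_assoc[OF w(1) pq(1) a(1)] z(3) by auto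
    qed
    then have "?A E = ?A x \<inter> ?A y" unfolding E(2) a(3) b(3) by blast
    then show ?thesis using E(1) by (intro bexI[of _ E]) (simp_all add: car)
  qed
  show upper: "?A x \<subseteq> ?U (?A x) (?A y) \<and> ?A y \<subseteq> ?U (?A x) (?A y)"
  proof -
    have "t \<in> ?U (?A x) (?A y)" if t: "t \<in> ?A x \<or> t \<in> ?A y" for t
    proof -
      have tH: "t \<in> Hom C (Dom C t) X" using t AH by blast
      then have "Dom C t \<in> Ob C" using Hom_Ob by blast
      then have "cov (Dom C t) (\<lambda>s. t \<cdot> s \<in> ?A x \<or> t \<cdot> s \<in> ?A y)"
        using t Id_right[OF tH] by (intro cov_ide) auto
      then show ?thesis using tH by (auto simp: local_union_def Hom_def)
    qed
    then show ?thesis by blast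
  qed
  \<comment> \<open>The union is the image of the copairing of \<open>a\<close> and
    \<open>b\<close>. Its elements come locally from \<open>A\<close> or \<open>B\<close>, and
    conversely local factorizations through the monomorphism \<open>m\<close> glue.\<close>
  show meet: "\<exists>z\<in>carrier ?L. ?A z = ?U (?A x) (?A y)"
  proof -
    have Ob: "A \<in> Ob C" "B \<in> Ob C" using Hom_Ob a b by auto
    obtain c where c: "c \<in> Hom C (coprod_ob C A B) X" "c \<cdot> inl A B = a" "c \<cdot> inr A B = b"
      using coprod_copair[OF a(1) b(1)] by blast
    obtain I e m where e: "e \<in> Hom C (coprod_ob C A B) I" "is_regular_epi C e"
        and m: "m \<in> Hom C I X" "is_mono C m"
      and me: "m \<cdot> e = c"
      using image_factorization[OF c(1)] by blast
    obtain E where E: "is_equivalence_relation (op_cat C) X E"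
      "?A E = {t \<in> Ar C. Cod C t = X \<and> (\<exists>z\<in>Hom C (Dom C t) I. m \<cdot> z = t)}"
      using equivalence_relation_of_mono[OF m] by blast
    note el = Comp_in_Hom[OF inl_Hom[OF Ob] e(1)] and er = Comp_in_Hom[OF inr_Hom[OF Ob] e(1)]
    have mel: "m \<cdot> (e \<cdot> inl A B) = a" "m \<cdot> (e \<cdot> inr A B) = b"
      using Comp_assoc[OF inl_Hom[OF Ob] e(1) m(1)] Comp_assoc[OF inr_Hom[OF Ob] e(1) m(1)] me c
        by simp_all
    have xE: "?A x \<subseteq> ?A E" "?A y \<subseteq> ?A E"
    proof -
      have "\<exists>w\<in>Hom C T I. m \<cdot> w = a \<cdot> z" if "z \<in> Hom C T A" for T z
        using Comp_assoc[OF that el m(1)] mel Comp_in_Hom[OF that el] by auto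
      then show "?A x \<subseteq> ?A E" unfolding E(2) a(3) by blast
      have "\<exists>w\<in>Hom C T I. m \<cdot> w = b \<cdot> z" if "z \<in> Hom C T B" for T z
        using Comp_assoc[OF that er m(1)] mel Comp_in_Hom[OF that er] by auto
      then show "?A y \<subseteq> ?A E" unfolding E(2) b(3) by blast
    qed
    have "?A E = ?U (?A x) (?A y)"
    proof (intro equalityI subsetI)
      fix t assume tE: "t \<in> ?A E"
      note tH = AH[OF tE]
      obtain z where z: "z \<in> Hom C (Dom C t) I" "m \<cdot> z = t" using tE unfolding E(2) by blast
      have "cov (Dom C t) (\<lambda>s. t \<cdot> s \<in> ?A x \<or> t \<cdot> s \<in> ?A y)"
      proof (rule cov_mono[OF regular_epi_coprod_lift[OF e(2,1) Ob z(1)]])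
        fix S s assume s: "s \<in> Hom C S (Dom C t)" and
          d: "(\<exists>w\<in>Hom C (Dom C s) A. z \<cdot> s = (e \<cdot> inl A B) \<cdot> w) \<or>
              (\<exists>w\<in>Hom C (Dom C s) B. z \<cdot> s = (e \<cdot> inr A B) \<cdot> w)"
        have tsH: "t \<cdot> s \<in> Hom C S X" by (rule Comp_in_Hom[OF s tH])
        have D: "Dom C s = S" "Dom C (t \<cdot> s) = S" "t \<cdot> s \<in> Ar C" "Cod C (t \<cdot> s) = X"
          using s tsH by (auto simp: Hom_def)
        have ts: "t \<cdot> s = m \<cdot> (z \<cdot> s)" using Comp_assoc[OF s z(1) m(1)] z(2) by simp
        from d have "(\<exists>w\<in>Hom C S A. a \<cdot> w = t \<cdot> s) \<or> (\<exists>w\<in>Hom C S B. b \<cdot> w = t \<cdot> s)"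
          unfolding D(1)
        proof (elim disjE bexE)
          fix w assume w: "w \<in> Hom C S A" "z \<cdot> s = (e \<cdot> inl A B) \<cdot> w"
          then show ?thesis using Comp_assoc[OF w(1) el m(1)] mel ts by auto
        next
          fix w assume w: "w \<in> Hom C S B" "z \<cdot> s = (e \<cdot> inr A B) \<cdot> w"
          then show ?thesis using Comp_assoc[OF w(1) er m(1)] mel ts by auto
        qed
        then show "t \<cdot> s \<in> ?A x \<or> t \<cdot> s \<in> ?A y" unfolding a(3) b(3) using D by auto
      qed
      then show "t \<in> ?U (?A x) (?A y)" using tH by (auto simp: local_union_def Hom_def)
    next
      fix t assume "t \<in> ?U (?A x) (?A y)"
      then have tH: "t \<in> Hom C (Dom C t) X"
          and cv: "cov (Dom C t) (\<lambda>s. t \<cdot> s \<in> ?A x \<or> t \<cdot> s \<in> ?A y)"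
        by (auto simp: local_union_def Hom_def)
      have "\<exists>z\<in>Hom C (Dom C t) I. m \<cdot> z = t"
      proof (rule cov_factor_mono[OF cv m(2,1) tH])
        fix S s assume s: "s \<in> Hom C S (Dom C t)" and "t \<cdot> s \<in> ?A x \<or> t \<cdot> s \<in> ?A y"
        then have "t \<cdot> s \<in> ?A E" using xE by blast
        moreover have "Dom C (t \<cdot> s) = S" using Comp_in_Hom[OF s tH] by (simp add: Hom_def)
        ultimately show "\<exists>z\<in>Hom C S I. m \<cdot> z = t \<cdot> s" unfolding E(2) by auto
      qed
      then show "t \<in> ?A E" unfolding E(2) using tH by (auto simp: Hom_def)
    qed
    then show ?thesis using E(1) by (intro bexI[of _ E]) (simp_all add: car)
  qed
  fix z assume z: "z \<in> carrier ?L"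
  show "?U (?A x) (?A y) \<subseteq> ?A z" if sub: "?A x \<subseteq> ?A z" "?A y \<subseteq> ?A z"
  proof
    fix t assume "t \<in> ?U (?A x) (?A y)"
    then have tH: "t \<in> Hom C (Dom C t) X" and cv: "cov (Dom C t) (\<lambda>s. t \<cdot> s \<in> ?A x \<or> t \<cdot> s \<in> ?A y)"
      by (auto simp: local_union_def Hom_def)
    obtain R r1 r2 where zR: "z = (R, r1, r2)" by (cases z) auto
    have r: "r1 \<in> Hom C X R" "r2 \<in> Hom C X R"
      using z unfolding car
        by (auto simp: is_equivalence_relation_def is_reflexive_relation_def is_relation_def zR)
    have "r1 \<cdot> t = r2 \<cdot> t"
    proof (rule cov_eq[OF cv Comp_in_Hom[OF tH r(1)] Comp_in_Hom[OF tH r(2)]])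
      fix S s assume s: "s \<in> Hom C S (Dom C t)" and "t \<cdot> s \<in> ?A x \<or> t \<cdot> s \<in> ?A y"
      then have "r1 \<cdot> (t \<cdot> s) = r2 \<cdot> (t \<cdot> s)" using sub zR agree_iff[OF Comp_in_Hom[OF s tH]]
          by blast
      then show "(r1 \<cdot> t) \<cdot> s = (r2 \<cdot> t) \<cdot> s" using Comp_assoc[OF s tH r(1)]
          Comp_assoc[OF s tH r(2)] by simp
    qed
    then show "t \<in> ?A z" using agree_iff[OF tH] zR by blast
  qed
  show "?U (?A x) (?A y \<inter> ?A z) = ?U (?A x) (?A y) \<inter> ?U (?A x) (?A z)"
  proof (intro equalityI subsetI)
    fix t assume "t \<in> ?U (?A x) (?A y \<inter> ?A z)"
    then show "t \<in> ?U (?A x) (?A y) \<inter> ?U (?A x) (?A z)"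
      unfolding local_union_def by (auto elim: cov_mono)
  next
    fix t assume t: "t \<in> ?U (?A x) (?A y) \<inter> ?U (?A x) (?A z)"
    then have tH: "t \<in> Hom C (Dom C t) X" and cv: "cov (Dom C t) (\<lambda>s. t \<cdot> s \<in> ?A x \<or> t \<cdot> s \<in> ?A y)"
      and cv': "cov (Dom C t) (\<lambda>s. t \<cdot> s \<in> ?A x \<or> t \<cdot> s \<in> ?A z)"
      by (auto simp: local_union_def Hom_def)
    \<comment> \<open>On the cover for \<open>cv'\<close> only the pieces in \<open>?A z\<close>
      need more work. They are refined by a cover deciding between \<open>?A x\<close> and
      \<open>?A y\<close>, and stay in the sieve \<open>?A z\<close>.\<close>
    have "cov (Dom C t) (\<lambda>s. t \<cdot> s \<in> ?A x \<or> t \<cdot> s \<in> ?A y \<inter> ?A z)"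
    proof (rule cov_bind[OF cv'])
      fix S s assume s: "s \<in> Hom C S (Dom C t)" and d: "t \<cdot> s \<in> ?A x \<or> t \<cdot> s \<in> ?A z"
      note ts = Comp_in_Hom[OF s tH]
      have st: "t \<cdot> (s \<cdot> r) = (t \<cdot> s) \<cdot> r" if "r \<in> Hom C S' S" for r S'
        using Comp_assoc[OF that s tH] .
      have S: "S \<in> Ob C" using Hom_Ob[OF s] by blast
      show "cov S (\<lambda>r. t \<cdot> (s \<cdot> r) \<in> ?A x \<or> t \<cdot> (s \<cdot> r) \<in> ?A y \<inter> ?A z)"
      proof (cases "t \<cdot> s \<in> ?A x")
        case True
        then show ?thesis using Id_right[OF s] by (intro cov_ide[OF S]) simp
      next
        case False
        then have tz: "t \<cdot> s \<in> ?A z" using d by blast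
        \<comment> \<open>Realizing the local union as the sieve of some \<open>w\<close> restricts
          it along \<open>s\<close> without pulling a cover back.\<close>
        obtain w where w: "w \<in> carrier ?L" "?A w = ?U (?A x) (?A y)" using meet by blast
        have "t \<cdot> s \<in> ?A w"
          using agree_comp[where E = w, OF _ _ tH s] w t by (simp add: car)
        then have "cov S (\<lambda>r. (t \<cdot> s) \<cdot> r \<in> ?A x \<or> (t \<cdot> s) \<cdot> r \<in> ?A y)"
          using ts unfolding w(2) local_union_def by (auto simp: Hom_def)
        then show ?thesis
        proof (rule cov_mono)
          fix S' r assume r: "r \<in> Hom C S' S" and "(t \<cdot> s) \<cdot> r \<in> ?A x \<or> (t \<cdot> s) \<cdot> r \<in> ?A y"
          moreover have "(t \<cdot> s) \<cdot> r \<in> ?A z" using agree_comp[OF _ tz ts r] z by (simp add: car)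
          ultimately show "t \<cdot> (s \<cdot> r) \<in> ?A x \<or> t \<cdot> (s \<cdot> r) \<in> ?A y \<inter> ?A z" using st[OF r] by auto
        qed
      qed
    qed
    then show "t \<in> ?U (?A x) (?A y \<inter> ?A z)" using tH by (auto simp: local_union_def Hom_def)
  qed
qed

lemma arithmetical_op_cat: "arithmetical_category (op_cat C)"
  by (intro arithmetical_category.intro maltsev_op_cat arithmetical_category_axioms.intro)
    (simp add: weak_distributive_lattice_op_cat)

end

section \<open>Protomodularity\<close>

lemma is_iso_structured_cat_inverse:
  assumes "is_iso (structured_cat C K U H) (x, u, y)"
  shows "\<exists>v\<in>Hom C (U y) (U x). v \<cdot>\<^bsub>C\<^esub> u = Ide C (U x) \<and> u \<cdot>\<^bsub>C\<^esub> v = Ide C (U y)"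
proof -
  have D: "Dom (structured_cat C K U H) (x, u, y) = x" "Cod (structured_cat C K U H) (x, u, y) = y"
    by (simp_all add: structured_cat_def)
  from assms obtain k where k: "k \<in> Hom (structured_cat C K U H) y x"
    "k \<cdot>\<^bsub>structured_cat C K U H\<^esub> (x, u, y) = Ide (structured_cat C K U H) x"
    "(x, u, y) \<cdot>\<^bsub>structured_cat C K U H\<^esub> k = Ide (structured_cat C K U H) y"
    unfolding is_iso_def D by blast
  then obtain v where v: "k = (y, v, x)" "v \<in> Hom C (U y) (U x)" by (auto simp: Hom_structured_cat)
  show ?thesis using k(2,3) v(2) unfolding v(1) structured_cat_simps by blast
qed

lemma is_iso_structured_catI:
  assumes "(x, u, y) \<in> Ar (structured_cat C K U H)" "v \<in> Hom C (U y) (U x)" "H y v x"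
    "v \<cdot>\<^bsub>C\<^esub> u = Ide C (U x)" "u \<cdot>\<^bsub>C\<^esub> v = Ide C (U y)"
  shows "is_iso (structured_cat C K U H) (x, u, y)"
proof -
  have D: "Dom (structured_cat C K U H) (x, u, y) = x" "Cod (structured_cat C K U H) (x, u, y) = y"
    by (simp_all add: structured_cat_def)
  have "x \<in> K" "y \<in> K" using assms(1) by (auto simp: structured_cat_def)
  then have "(y, v, x) \<in> Hom (structured_cat C K U H) y x"
      using assms by (simp add: Hom_structured_cat)
  then show ?thesis
    unfolding is_iso_def D
    using assms by (intro conjI bexI[of _ "(y, v, x)"]) (simp_all add: structured_cat_simps)
qed

lemma pullback_is_pullback:
  assumes "is_pullback C f g P p q"
  shows "\<exists>P p q. pullback C f g = (P, p, q) \<and> is_pullback C f g P p q"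
proof -
  have "\<exists>x. case x of (P, p, q) \<Rightarrow> is_pullback C f g P p q" using assms by auto
  from someI_ex[OF this] show ?thesis by (auto simp: pullback_def)
qed

section \<open>Pushouts along split monomorphisms\<close>

context cocomplete_pretopos
begin

text \<open>A monomorphism is an equalizer; if it is also epic, the two equalized maps coincide, and
  the identity factors through it.\<close>

lemma mono_epi_is_iso:
  assumes u: "u \<in> Hom C A B" "is_mono C u"
    and epi: "\<And>X x y. x \<in> Hom C B X \<Longrightarrow> y \<in> Hom C B X \<Longrightarrow> x \<cdot> u = y \<cdot> u \<Longrightarrow> x = y"
  shows "\<exists>v\<in>Hom C B A. v \<cdot> u = Ide C A \<and> u \<cdot> v = Ide C B"
proof -
  obtain f g where fg: "is_coequalizer (op_cat C) f g u"
    using mono_is_equalizer[OF u] by (auto simp: is_regular_epi_def)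
  then have H: "f \<in> Hom C B (Cod C f)" "g \<in> Hom C B (Cod C f)" "f \<cdot> u = g \<cdot> u"
    using u(1) by (auto simp: is_coequalizer_def Hom_def)
  have "f = g" by (rule epi[OF H])
  have Ob: "A \<in> Ob C" "B \<in> Ob C" using Hom_Ob[OF u(1)] by auto
  note IA = Id_in_Hom[OF Ob(1)] and IB = Id_in_Hom[OF Ob(2)]
  obtain v where v: "v \<in> Hom C B A" "u \<cdot> v = Ide C B"
    using coequalizer_ump[OF fg, of "Cod C f" B A "Ide C B" B] H(1) u(1) IB \<open>f = g\<close> by auto
  have "v \<cdot> u = Ide C A"
    by (rule mono_cancel[OF u(2,1) Comp_in_Hom[OF u(1) v(1)] IA])
      (use Comp_assoc[OF u(1) v(1) u(1)] v(2) Id_left[OF u(1)] Id_right[OF u(1)] in simp)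
  with v show ?thesis by blast
qed

text \<open>It suffices that \<open>u\<close> is monic and epic. If \<open>u\<close> equates two
  elements, so does \<open>b2\<close>, since \<open>h\<close> is invertible; locally they are then
  equal or both in \<open>B\<close>, where \<open>u\<close> restricts to the monomorphism \<alpha>.
  For epicness, every element of \<open>A\<close> is locally either in \<open>B\<close> or in the
  image of \<open>u\<close>, and two maps that agree after \<open>u\<close> agree on both.\<close>

lemma pushout_reflects_iso:
  assumes p: "p \<in> Hom C B E"
    and \<alpha>: "\<alpha> \<in> Hom C B A" "\<beta> \<in> Hom C A B" "\<beta> \<cdot> \<alpha> = Ide C B"
    and \<alpha>': "\<alpha>' \<in> Hom C B A'" "\<beta>' \<in> Hom C A' B" "\<beta>' \<cdot> \<alpha>' = Ide C B"
    and u: "u \<in> Hom C A' A" "u \<cdot> \<alpha>' = \<alpha>"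
    and P: "is_pullback (op_cat C) p \<alpha> P a1 a2"
    and P': "is_pullback (op_cat C) p \<alpha>' P' b1 b2"
    and h: "h \<in> Hom C P' P" "h \<cdot> b1 = a1" "h \<cdot> b2 = a2 \<cdot> u"
    and k: "k \<in> Hom C P P'" "k \<cdot> h = Ide C P'" "h \<cdot> k = Ide C P"
  shows "\<exists>v\<in>Hom C A A'. v \<cdot> u = Ide C A' \<and> u \<cdot> v = Ide C A"
proof -
  have mono: "is_mono C \<alpha>" "is_mono C \<alpha>'"
    using is_monoI[OF \<alpha>(1)] left_inverse_cancel[OF \<alpha>(3,1,2)]
      is_monoI[OF \<alpha>'(1)] left_inverse_cancel[OF \<alpha>'(3,1,2)] by blast+
  note a = pushout_mono[OF \<alpha>(1) mono(1) p P] and b = pushout_mono[OF \<alpha>'(1) mono(2) p P']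
  have u\<alpha>: "u \<cdot> (\<alpha>' \<cdot> z) = \<alpha> \<cdot> z" if "z \<in> Hom C S B" for S z
    using Comp_assoc[OF that \<alpha>'(1) u(1)] u(2) by simp
  have hb: "h \<cdot> (b2 \<cdot> x) = a2 \<cdot> (u \<cdot> x)" if "x \<in> Hom C S A'" for S x
    by (rule comp_eq_comp[OF h(3) b(2) h(1) u(1) a(2) that])
  have "is_mono C u"
  proof (rule is_monoI[OF u(1)])
    fix T x y assume x: "x \<in> Hom C T A'" and y: "y \<in> Hom C T A'" and xy: "u \<cdot> x = u \<cdot> y"
    have "h \<cdot> (b2 \<cdot> x) = h \<cdot> (b2 \<cdot> y)" using hb[OF x] hb[OF y] xy by simp
    then have "b2 \<cdot> x = b2 \<cdot> y"
      by (rule left_inverse_cancel[OF k(2) h(1) k(1) Comp_in_Hom[OF x b(2)] Comp_in_Hom[OF y b(2)]])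
    then have "cov T (identified \<alpha>' p x y)" by (rule b(6)[OF x y])
    then show "x = y"
    proof (rule cov_eq[OF _ x y])
      fix S t assume t: "t \<in> Hom C S T" and i: "identified \<alpha>' p x y t"
      have uxy: "u \<cdot> (x \<cdot> t) = u \<cdot> (y \<cdot> t)" by (rule comp_eq_comp[OF xy x u(1) y u(1) t])
      show "x \<cdot> t = y \<cdot> t"
        using i \<alpha>'(1) t
      proof (cases rule: identifiedE)
        case (2 z z')
        then have "\<alpha> \<cdot> z = \<alpha> \<cdot> z'" using uxy u\<alpha>[OF 2(1)] u\<alpha>[OF 2(2)] by simp
        then have "z = z'" by (rule mono_cancel[OF mono(1) \<alpha>(1) 2(1,2)])
        then show ?thesis using 2 by simp
      qed
    qed
  qed
  moreover have "f = g" if f: "f \<in> Hom C A X" and g: "g \<in> Hom C A X" and fg: "f \<cdot> u = g \<cdot> u"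
      for X f g
  proof -
    have fgu: "f \<cdot> (u \<cdot> x) = g \<cdot> (u \<cdot> x)" if "x \<in> Hom C S A'" for S x
      by (rule comp_eq_comp[OF fg u(1) f u(1) g that])
    have fg\<alpha>: "f \<cdot> (\<alpha> \<cdot> z) = g \<cdot> (\<alpha> \<cdot> z)" if "z \<in> Hom C S B" for S z
      using fgu[OF Comp_in_Hom[OF that \<alpha>'(1)]] u\<alpha>[OF that] by simp
    have Ob: "E \<in> Ob C" "A' \<in> Ob C" using Hom_Ob p u by auto
    have je: "x = y" if x: "x \<in> Hom C P' Z" and y: "y \<in> Hom C P' Z"
        and xy: "x \<cdot> b1 = y \<cdot> b1" "x \<cdot> b2 = y \<cdot> b2"
      for Z x y
      using pullback_ump[OF P', of E B A' "y \<cdot> b1" Z "y \<cdot> b2"] p \<alpha>'(1) x y xy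
        Comp_in_Hom[OF b(1) y] Comp_in_Hom[OF b(2) y] comp_eq_comp[OF refl b(1) y b(1) y p]
        Comp_assoc[OF p b(1) y] Comp_assoc[OF \<alpha>'(1) b(2) y] b(3) by auto
    obtain e where e: "e \<in> Hom C (coprod_ob C E A') P'" "e \<cdot> inl E A' = b1" "e \<cdot> inr E A' = b2"
        "is_regular_epi C e"
      using copair_regular_epi[OF b(1,2)] je by metis
    \<comment> \<open>Transports elements of \<open>A\<close> to \<open>P'\<close>, which is covered
      by \<open>E\<close> and \<open>A'\<close>. Going back along \<open>h\<close>, a piece from
      \<open>E\<close> must lie in \<open>B\<close>, and a piece from \<open>A'\<close> is
      identified with its image under \<open>u\<close>.\<close>
    define w where "w = k \<cdot> a2"
    have w: "w \<in> Hom C A P'" unfolding w_def by (rule Comp_in_Hom[OF a(2) k(1)])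
    have hw: "h \<cdot> w = a2"
      using Comp_assoc[OF a(2) k(1) h(1)] k(3) Id_left[OF a(2)] by (simp add: w_def)
    show ?thesis
    proof (rule cov_eq[OF regular_epi_coprod_lift[OF e(4,1) Ob w] f g])
      fix S t assume t: "t \<in> Hom C S A" and c: "(\<exists>y\<in>Hom C (Dom C t) E. w \<cdot> t = (e \<cdot> inl E A') \<cdot> y) \<or>
        (\<exists>x\<in>Hom C (Dom C t) A'. w \<cdot> t = (e \<cdot> inr E A') \<cdot> x)"
      have D: "Dom C t = S" using t by (simp add: Hom_def)
      have a2t: "a2 \<cdot> t = h \<cdot> (w \<cdot> t)" using Comp_assoc[OF t w h(1)] hw by simp
      from c[unfolded D e(2,3)] show "f \<cdot> t = g \<cdot> t"
      proof (elim disjE bexE)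
        fix y assume y: "y \<in> Hom C S E" "w \<cdot> t = b1 \<cdot> y"
        then have "a2 \<cdot> t = a1 \<cdot> y" using a2t Comp_assoc[OF y(1) b(1) h(1)] h(2) by simp
        then obtain z where "z \<in> Hom C S B" "t = \<alpha> \<cdot> z" using a(5)[OF t y(1)] by blast
        then show ?thesis using fg\<alpha> by simp
      next
        fix x assume x: "x \<in> Hom C S A'" "w \<cdot> t = b2 \<cdot> x"
        note ux = Comp_in_Hom[OF x(1) u(1)]
        have "a2 \<cdot> t = a2 \<cdot> (u \<cdot> x)" using a2t x(2) hb[OF x(1)] by simp
        then have "cov S (identified \<alpha> p t (u \<cdot> x))" by (rule a(6)[OF t ux])
        then show ?thesis
        proof (rule cov_eq[OF _ Comp_in_Hom[OF t f] Comp_in_Hom[OF t g]])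
          fix S' s assume s: "s \<in> Hom C S' S" and i: "identified \<alpha> p t (u \<cdot> x) s"
          have "f \<cdot> (t \<cdot> s) = g \<cdot> (t \<cdot> s)"
            using i \<alpha>(1) s
          proof (cases rule: identifiedE)
            case 1
            then show ?thesis
              using fgu[OF Comp_in_Hom[OF s x(1)]] Comp_assoc[OF s x(1) u(1)] by simp
          next
            case (2 z z')
            then show ?thesis using fg\<alpha> by simp
          qed
          then show "(f \<cdot> t) \<cdot> s = (g \<cdot> t) \<cdot> s" using Comp_assoc[OF s t f] Comp_assoc[OF s t g]
              by simp
        qed
      qed
    qed
  qed
  ultimately show ?thesis using mono_epi_is_iso[OF u(1)] by blast
qed

lemma protomodular_op_cat: "protomodular_category (op_cat C)"
proof (intro protomodular_category.intro protomodular_category_axioms.intro)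
  show "category (op_cat C)" by (rule category_op_cat)
next
  fix \<alpha> \<beta> p A B E assume "\<alpha> \<in> Hom (op_cat C) A B" "p \<in> Hom (op_cat C) E B"
  then show "\<exists>P \<pi>1 \<pi>2. is_pullback (op_cat C) p \<alpha> P \<pi>1 \<pi>2"
    using complete_category.pullback_exists[OF complete_category_op_cat] by blast
next
  fix p E B assume "p \<in> Hom (op_cat C) E B"
  then have p: "p \<in> Hom C B E" by simp
  show "reflects_isos (Pt (op_cat C) B) (Pt (op_cat C) E) (pb_functor (op_cat C) p)"
    unfolding reflects_isos_def
  proof (intro ballI impI)
    fix f assume f: "f \<in> Ar (Pt (op_cat C) B)"
      and iso: "is_iso (Pt (op_cat C) E) (FAr (pb_functor (op_cat C) p) f)"
    obtain A \<alpha> \<beta> u A' \<alpha>' \<beta>' where fe: "f = ((A, \<alpha>, \<beta>), u, (A', \<alpha>', \<beta>'))" by (metis prod.exhaust)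
    have \<alpha>: "\<alpha> \<in> Hom C B A" "\<beta> \<in> Hom C A B" "\<beta> \<cdot> \<alpha> = Ide C B"
      and \<alpha>': "\<alpha>' \<in> Hom C B A'" "\<beta>' \<in> Hom C A' B" "\<beta>' \<cdot> \<alpha>' = Ide C B"
      and u: "u \<in> Hom C A' A" "u \<cdot> \<alpha>' = \<alpha>" "\<beta> \<cdot> u = \<beta>'"
      using f by (simp_all add: fe Pt_def structured_cat_def)
    obtain P a1 a2 where P: "pullback (op_cat C) p \<alpha> = (P, a1, a2)"
        "is_pullback (op_cat C) p \<alpha> P a1 a2"
      using complete_category.pullback_exists[OF complete_category_op_cat, of p E B \<alpha> A]
        pullback_is_pullback p \<alpha>(1) by fastforce
    obtain P' b1 b2 where P': "pullback (op_cat C) p \<alpha>' = (P', b1, b2)"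
        "is_pullback (op_cat C) p \<alpha>' P' b1 b2"
      using complete_category.pullback_exists[OF complete_category_op_cat, of p E B \<alpha>' A']
        pullback_is_pullback p \<alpha>'(1) by fastforce
    have a: "a1 \<in> Hom C E P" "a2 \<in> Hom C A P" "a1 \<cdot> p = a2 \<cdot> \<alpha>"
      using pullback_Hom[OF P(2), of E B A] p \<alpha>(1) by simp_all
    \<comment> \<open>The definite description in \<open>pb_ar\<close> is met by a unique map, by
      universality of \<open>P'\<close> in the opposite category; this gives \<open>h\<close> its
      defining equations below.\<close>
    define h where "h = pb_ar (op_cat C) p f"
    have "(a2 \<cdot> u) \<cdot> \<alpha>' = a1 \<cdot> p" using Comp_assoc[OF \<alpha>'(1) u(1) a(2)] u(2) a(3) by simp
    then have "\<exists>!h. h \<in> Hom (op_cat C) P P' \<and> b1 \<cdot>\<^bsub>op_cat C\<^esub> h = a1 \<and> b2 \<cdot>\<^bsub>op_cat C\<^esub> h = a2 \<cdot> u"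
      using pullback_ump[OF P'(2), of E B A' a1 P "a2 \<cdot> u"] p \<alpha>'(1) a Comp_in_Hom[OF u(1) a(2)]
        by simp
    from theI'[OF this] have h: "h \<in> Hom C P' P" "h \<cdot> b1 = a1" "h \<cdot> b2 = a2 \<cdot> u"
      by (simp_all add: h_def pb_ar_def fe P(1) P'(1))
    have "is_iso (Pt (op_cat C) E) (pb_ob (op_cat C) p (A, \<alpha>, \<beta>), h, pb_ob (op_cat C) p
        (A', \<alpha>', \<beta>'))"
      using iso by (simp add: pb_functor_def fe h_def)
    from is_iso_structured_cat_inverse[OF this[unfolded Pt_def]]
    obtain k where k: "k \<in> Hom C P P'" "k \<cdot> h = Ide C P'" "h \<cdot> k = Ide C P"
      by (auto simp: pb_ob_def P(1) P'(1))
    obtain v where v: "v \<in> Hom C A A'" "v \<cdot> u = Ide C A'" "u \<cdot> v = Ide C A"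
      using pushout_reflects_iso[OF p \<alpha> \<alpha>' u(1,2) P(2) P'(2) h k] by blast
    have "v \<cdot> \<alpha> = \<alpha>'" "\<beta>' \<cdot> v = \<beta>"
      using Comp_assoc[OF \<alpha>'(1) u(1) v(1)] Comp_assoc[OF v(1) u(1) \<alpha>(2)] u v
        Id_left[OF \<alpha>'(1)] Id_right[OF \<alpha>(2)] by simp_all
    then show "is_iso (Pt (op_cat C) B) f"
      unfolding Pt_def fe
      by (intro is_iso_structured_catI[where v = v]) (use f v in \<open>simp_all add: Pt_def fe\<close>)
  qed
qed

lemma ideally_exact_op_cat: "ideally_exact_category (op_cat C)"
proof (intro ideally_exact_category.intro exact_op_cat protomodular_op_cat
    ideally_exact_category_axioms.intro)
  show "finitely_cocomplete (op_cat C)" by (rule finitely_cocomplete_op_cat[OF finitely_complete])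
  fix Z T f assume Z: "is_initial (op_cat C) Z" and T: "is_terminal (op_cat C) T"
      and "f \<in> Hom (op_cat C) Z T"
  then have f: "f \<in> Hom C T Z" by simp
  have T': "is_initial C T" using T by (simp add: is_initial_def is_terminal_def)
  \<comment> \<open>A stage that maps to \<open>T\<close> is itself initial by strictness, so any
    two elements of \<open>T\<close> at that stage are equal.\<close>
  have "is_mono C f"
    by (rule is_monoI[OF f]) (use initial_Hom_unique initial_strict[OF T'] in blast)
  then show "is_regular_epi (op_cat C) f" by (rule mono_is_equalizer[OF f])
qed

end

theorem theorem4p13:
  fixes C :: "('o, 'm) cat"
  assumes "pretopos C" and "finitely_cocomplete C"
  shows "arithmetical_category (op_cat C) \<and> ideally_exact_category (op_cat C)"
proof -
  interpret cocomplete_pretopos C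
    using assms by (simp add: cocomplete_pretopos_def cocomplete_pretopos_axioms_def)
  show ?thesis using arithmetical_op_cat ideally_exact_op_cat by blast
qed

end
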